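(* Let $V\in H^{-1}(\mathbb R)$, let $H_0f=-f''$, $f\in\operatorname{dom}(H_0)=H^2(\mathbb R)$, in $L^2(\mathbb R)$, and define $$A_V(z):=-(H_0-zI_{L^2(\mathbb R)})^{-1/2}\,V\,(H_0-zI_{L^2(\mathbb R)})^{-1/2},\quad z\in\mathbb C\setminus[0,\infty),$$ $\mathcal D_{H_0,V}:=\{z\in\mathbb C\setminus[0,\infty)\,|\,1\notin\rho(A_V(z))\}$, and $$R(z):=(H_0-zI_{L^2(\mathbb R)})^{-1/2}[I_{L^2(\mathbb R)}-A_V(z)]^{-1}(H_0-zI_{L^2(\mathbb R)})^{-1/2},\quad z\in\mathbb C\setminus([0,\infty)\cup\mathcal D_{H_0,V}).$$ Then the map $R(\cdot)$ uniquely defines a densely defined, closed, linear operator $H$ in $L^2(\mathbb R)$ by $$R(z)=(H-zI_{L^2(\mathbb R)})^{-1},\quad z\in\mathbb C\setminus([0,\infty)\cup\mathcal D_{H_0,V}).$$ In addition, $\mathbb C\setminus([0,\infty)\cup\mathcal D_{H_0,V})\subseteq\rho(H)$, and $$(H-zI_{L^2(\mathbb R)})^{-1}-(H_0-zI_{L^2(\mathbb R)})^{-1}\ \text{ is a Hilbert--Schmidt operator on } L^2(\mathbb R)\text{ for all } z\in\rho(H_0)\cap\rho(H).$$ Moreover, a point $\lambda_0\in\mathbb C\setminus[0,\infty)$ is an eigenvalue of $H$ with geometric multiplicity $k\in\mathbb N$ if and only if $1$ is an eigenvalue of $A_V(\lambda_0)$ with geometric multiplicity $k$.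
   Context: Fourier transform: $\widehat f(\xi)=(2\pi)^{-1/2}\int_{\mathbb R}e^{-i\xi x}f(x)\,dx$, extended to tempered distributions. For $s\in\mathbb R$, $H^s(\mathbb R)=\{T\in\mathcal S'(\mathbb R)\,|\,(1+|\cdot|^2)^{s/2}\widehat T\in L^2(\mathbb R)\}$ with norm $\|T\|_{H^s(\mathbb R)}=\|(1+|\cdot|^2)^{s/2}\widehat T\|_{L^2(\mathbb R)}$; $H^{-1}(\mathbb R)=[H^1(\mathbb R)]^*$ (conjugate dual). Distributional pairings are conjugate linear in the first slot, $\langle\psi,T\rangle=\int\overline{\psi}\,T$ for functions $T$. A distribution $V\in H^{-1}(\mathbb R)$ acts as a bounded multiplication operator $V:H^1(\mathbb R)\to H^{-1}(\mathbb R)$: for $\varphi,\psi\in\mathcal S(\mathbb R)$, $\langle\psi,V\varphi\rangle:=\langle\overline\varphi\,\psi,V\rangle$, and this form satisfies $|\langle\psi,V\varphi\rangle|\le 2^{1/2}\|V\|_{H^{-1}(\mathbb R)}\|\psi\|_{H^1(\mathbb R)}\|\varphi\|_{H^1(\mathbb R)}$, hence extends by continuity to $H^1(\mathbb R)$. The complex square root is fixed by $z^{1/2}=|z|^{1/2}e^{i\arg(z)/2}$, $\arg(z)\in[0,2\pi)$. For $z\in\mathbb C\setminus[0,\infty)$, $(H_0-zI_{L^2(\mathbb R)})^{-1/2}$ is the Fourier multiplier by $(\xi^2-z)^{-1/2}$; it is bounded from $L^2(\mathbb R)$ to $H^1(\mathbb R)$ and from $H^{-1}(\mathbb R)$ to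 $L^2(\mathbb R)$, and $A_V(z)$ is the composition $L^2(\mathbb R)\to H^1(\mathbb R)\to H^{-1}(\mathbb R)\to L^2(\mathbb R)$, a bounded (in fact Hilbert--Schmidt) operator on $L^2(\mathbb R)$. $\rho(\cdot)$ denotes the resolvent set; $\rho(H_0)=\mathbb C\setminus[0,\infty)$. *)

theory Defs
  imports "HOL-Analysis.Analysis"
begin

section \<open>The complex Hilbert space of square integrable functions on the real line\<close>

definition square_integrable :: "(real \<Rightarrow> complex) \<Rightarrow> bool" where
  "square_integrable f \<longleftrightarrow>
     f \<in> borel_measurable lborel \<and> integrable lborel (\<lambda>x. (cmod (f x))\<^sup>2)"

definition l2_rel :: "(real \<Rightarrow> complex) \<Rightarrow> (real \<Rightarrow> complex) \<Rightarrow> bool" where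
  "l2_rel f g \<longleftrightarrow>
     square_integrable f \<and> square_integrable g \<and> (AE x in lborel. f x = g x)"

lemma square_integrable_zero: "square_integrable (\<lambda>x. 0)"
  by (simp add: square_integrable_def)

lemma cnj_measurable: "f \<in> borel_measurable M \<Longrightarrow> (\<lambda>x. cnj (f x)) \<in> borel_measurable M"
  by (rule borel_measurable_continuous_on) (intro continuous_intros)

lemma cnj_times_self: "cnj z * z = of_real ((cmod z)\<^sup>2)"
  by (simp only: complex_norm_square mult.commute)

lemma square_integrable_mult:
  assumes "square_integrable f" "square_integrable g"
  shows "integrable lborel (\<lambda>x. cnj (f x) * g x)"
proof (rule Bochner_Integration.integrable_bound)
  show "integrable lborel (\<lambda>x. (cmod (f x))\<^sup>2 + (cmod (g x))\<^sup>2)"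
    using assms by (simp add: square_integrable_def)
  show "(\<lambda>x. cnj (f x) * g x) \<in> borel_measurable lborel"
    using assms
    by (intro borel_measurable_times cnj_measurable) (simp_all add: square_integrable_def)
  have "cmod (f x) * cmod (g x) \<le> (cmod (f x))\<^sup>2 + (cmod (g x))\<^sup>2" for x
    using sum_squares_bound[of "cmod (f x)" "cmod (g x)"]
      mult_nonneg_nonneg[OF norm_ge_zero norm_ge_zero, of "f x" "g x"] by linarith
  then show "AE x in lborel.
      norm (cnj (f x) * g x) \<le> norm ((cmod (f x))\<^sup>2 + (cmod (g x))\<^sup>2)"
    by (simp add: norm_mult)
qed

lemma square_integrable_add:
  assumes "square_integrable f" "square_integrable g"
  shows "square_integrable (\<lambda>x. f x + g x)"
proof -
  have m: "(\<lambda>x. f x + g x) \<in> borel_measurable lborel"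
    using assms by (intro borel_measurable_add) (simp_all add: square_integrable_def)
  have "integrable lborel (\<lambda>x. (cmod (f x + g x))\<^sup>2)"
  proof (rule Bochner_Integration.integrable_bound)
    show "integrable lborel (\<lambda>x. 2 * (cmod (f x))\<^sup>2 + 2 * (cmod (g x))\<^sup>2)"
      using assms by (simp add: square_integrable_def)
    show "(\<lambda>x. (cmod (f x + g x))\<^sup>2) \<in> borel_measurable lborel"
      using m by measurable
    have "(cmod (f x + g x))\<^sup>2 \<le> 2 * (cmod (f x))\<^sup>2 + 2 * (cmod (g x))\<^sup>2" for x
    proof -
      have "(cmod (f x + g x))\<^sup>2 \<le> (cmod (f x) + cmod (g x))\<^sup>2"
        by (simp add: norm_triangle_ineq power_mono)
      also have "\<dots> \<le> 2 * (cmod (f x))\<^sup>2 + 2 * (cmod (g x))\<^sup>2"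
        using sum_squares_bound[of "cmod (f x)" "cmod (g x)"] by (simp add: power2_sum)
      finally show ?thesis .
    qed
    then show "AE x in lborel. norm ((cmod (f x + g x))\<^sup>2)
        \<le> norm (2 * (cmod (f x))\<^sup>2 + 2 * (cmod (g x))\<^sup>2)"
      by simp
  qed
  with m show ?thesis by (simp add: square_integrable_def)
qed

lemma square_integrable_scale:
  "square_integrable f \<Longrightarrow> square_integrable (\<lambda>x. c * f x)"
  by (auto simp: square_integrable_def norm_mult power_mult_distrib)

quotient_type l2 = "real \<Rightarrow> complex" / partial: l2_rel
proof (rule part_equivpI)
  show "\<exists>f. l2_rel f f"
    using square_integrable_zero by (auto simp: l2_rel_def)
  show "symp l2_rel"
    by (auto intro!: sympI simp: l2_rel_def elim: AE_mp)
  show "transp l2_rel"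
    by (auto intro!: transpI simp: l2_rel_def)
qed

instantiation l2 :: real_vector
begin

lift_definition zero_l2 :: l2 is "\<lambda>x. 0"
  by (simp add: l2_rel_def square_integrable_zero)

lift_definition plus_l2 :: "l2 \<Rightarrow> l2 \<Rightarrow> l2" is "\<lambda>f g x. f x + g x"
  by (auto simp: l2_rel_def square_integrable_add)

lift_definition uminus_l2 :: "l2 \<Rightarrow> l2" is "\<lambda>f x. - f x"
  using square_integrable_scale[of _ "-1"] by (auto simp: l2_rel_def)

definition minus_l2 :: "l2 \<Rightarrow> l2 \<Rightarrow> l2" where
  "minus_l2 f g = f + - g"

lift_definition scaleR_l2 :: "real \<Rightarrow> l2 \<Rightarrow> l2" is "\<lambda>c f x. of_real c * f x"
  by (auto simp: l2_rel_def square_integrable_scale)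

instance
proof
  fix a b c :: l2 and r s :: real
  show "a + b + c = a + (b + c)"
    by transfer (auto simp: l2_rel_def square_integrable_add add.assoc)
  show "a + b = b + a"
    by transfer (auto simp: l2_rel_def square_integrable_add add.commute)
  show "0 + a = a"
    by transfer (auto simp: l2_rel_def)
  show "- a + a = 0"
    by transfer (auto simp: l2_rel_def square_integrable_zero)
  show "a - b = a + - b"
    by (simp add: minus_l2_def)
  show "r *\<^sub>R (a + b) = r *\<^sub>R a + r *\<^sub>R b"
    by transfer (auto simp: l2_rel_def distrib_left
        intro!: square_integrable_add square_integrable_scale)
  show "(r + s) *\<^sub>R a = r *\<^sub>R a + s *\<^sub>R a"
    by transfer (auto simp: l2_rel_def distrib_right
        intro!: square_integrable_add square_integrable_scale)
  show "r *\<^sub>R s *\<^sub>R a = (r * s) *\<^sub>R a"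
    by transfer (auto simp: l2_rel_def mult.assoc
        intro!: square_integrable_scale)
  show "1 *\<^sub>R a = a"
    by transfer (auto simp: l2_rel_def)
qed

end

lift_definition scaleC :: "complex \<Rightarrow> l2 \<Rightarrow> l2" (infixr \<open>*\<^sub>C\<close> 75) is "\<lambda>c f x. c * f x"
  by (auto simp: l2_rel_def square_integrable_scale)

lift_definition cinner :: "l2 \<Rightarrow> l2 \<Rightarrow> complex" is "\<lambda>f g. \<integral>x. cnj (f x) * g x \<partial>lborel"
proof -
  fix f f' g g' :: "real \<Rightarrow> complex"
  assume f: "l2_rel f f'" and g: "l2_rel g g'"
  show "(\<integral>x. cnj (f x) * g x \<partial>lborel) = (\<integral>x. cnj (f' x) * g' x \<partial>lborel)"
  proof (rule integral_cong_AE)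
    show "(\<lambda>x. cnj (f x) * g x) \<in> borel_measurable lborel"
      "(\<lambda>x. cnj (f' x) * g' x) \<in> borel_measurable lborel"
      using f g unfolding l2_rel_def
      by (blast intro: borel_measurable_integrable square_integrable_mult)+
    show "AE x in lborel. cnj (f x) * g x = cnj (f' x) * g' x"
      using f g by (auto simp: l2_rel_def)
  qed
qed

instantiation l2 :: real_inner
begin

definition inner_l2 :: "l2 \<Rightarrow> l2 \<Rightarrow> real" where
  "inner_l2 f g = Re (cinner f g)"

definition norm_l2 :: "l2 \<Rightarrow> real" where
  "norm_l2 f = sqrt (inner f f)"

definition sgn_l2 :: "l2 \<Rightarrow> l2" where
  "sgn_l2 f = f /\<^sub>R norm f"

definition dist_l2 :: "l2 \<Rightarrow> l2 \<Rightarrow> real" where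
  "dist_l2 f g = norm (f - g)"

definition uniformity_l2 :: "(l2 \<times> l2) filter" where
  "uniformity_l2 = (INF e\<in>{0<..}. principal {(f, g). dist f g < e})"

definition open_l2 :: "l2 set \<Rightarrow> bool" where
  "open_l2 U \<longleftrightarrow> (\<forall>f\<in>U. eventually (\<lambda>(f', g). f' = f \<longrightarrow> g \<in> U) uniformity)"

instance
proof
  fix f g h :: l2 and r :: real
  have self: "cinner f f = of_real (\<integral>x. (cmod (rep_l2 f x))\<^sup>2 \<partial>lborel)" for f
  proof -
    have "cinner f f = (\<integral>x. of_real ((cmod (rep_l2 f x))\<^sup>2) \<partial>lborel)"
      unfolding cinner.rep_eq by (simp only: cnj_times_self)
    then show ?thesis by (simp only: integral_complex_of_real)
  qed
  show "dist f g = norm (f - g)" "sgn f = f /\<^sub>R norm f" "norm f = sqrt (inner f f)"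
    "uniformity = (INF e\<in>{0<..}. principal {(f::l2, g). dist f g < e})"
    by (simp_all add: dist_l2_def sgn_l2_def norm_l2_def uniformity_l2_def)
  show "open U \<longleftrightarrow> (\<forall>f\<in>U. eventually (\<lambda>(f', g). f' = f \<longrightarrow> g \<in> U) uniformity)"
    for U :: "l2 set"
    by (simp add: open_l2_def)
  have "cinner f g = cnj (cinner g f)"
  proof transfer
    fix f g :: "real \<Rightarrow> complex"
    show "(\<integral>x. cnj (f x) * g x \<partial>lborel) = cnj (\<integral>x. cnj (g x) * f x \<partial>lborel)"
      by (subst Bochner_Integration.integral_cnj[symmetric]) (simp add: mult.commute)
  qed
  then show "inner f g = inner g f"
    by (simp add: inner_l2_def)
  have "cinner (f + g) h = cinner f h + cinner g h"
    by transfer (auto simp: l2_rel_def distrib_right square_integrable_mult)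
  then show "inner (f + g) h = inner f h + inner g h"
    by (simp add: inner_l2_def)
  have "cinner (r *\<^sub>R f) g = of_real r * cinner f g"
    by transfer (simp add: mult.assoc)
  then show "inner (r *\<^sub>R f) g = r * inner f g"
    by (simp add: inner_l2_def)
  show "0 \<le> inner f f"
    by (simp add: inner_l2_def self)
  have "(\<integral>x. cnj (f x) * f x \<partial>lborel) = 0 \<longrightarrow> (AE x in lborel. f x = 0)"
    if "square_integrable f" for f :: "real \<Rightarrow> complex"
  proof
    assume "(\<integral>x. cnj (f x) * f x \<partial>lborel) = 0"
    then have "(\<integral>x. of_real ((cmod (f x))\<^sup>2) \<partial>lborel) = (0::complex)"
      by (simp only: cnj_times_self)
    then have "(\<integral>x. (cmod (f x))\<^sup>2 \<partial>lborel) = 0"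
      by (simp only: integral_complex_of_real of_real_eq_0_iff)
    then show "AE x in lborel. f x = 0"
      using that integral_nonneg_eq_0_iff_AE[of lborel "\<lambda>x. (cmod (f x))\<^sup>2"]
      by (simp add: square_integrable_def)
  qed
  then have "cinner f f = 0 \<Longrightarrow> f = 0"
    by transfer (auto simp: l2_rel_def square_integrable_zero)
  moreover have "cinner 0 0 = 0"
    by transfer simp
  ultimately show "inner f f = 0 \<longleftrightarrow> f = 0"
    using self[of f] by (auto simp: inner_l2_def)
qed

end

global_interpretation l2: vector_space scaleC
proof
  fix a b :: complex and f g :: l2
  show "a *\<^sub>C (f + g) = a *\<^sub>C f + a *\<^sub>C g"
    by transfer (auto simp: l2_rel_def distrib_left
        intro!: square_integrable_add square_integrable_scale)
  show "(a + b) *\<^sub>C f = a *\<^sub>C f + b *\<^sub>C f"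
    by transfer (auto simp: l2_rel_def distrib_right
        intro!: square_integrable_add square_integrable_scale)
  show "a *\<^sub>C b *\<^sub>C f = (a * b) *\<^sub>C f"
    by transfer (auto simp: l2_rel_def mult.assoc intro!: square_integrable_scale)
  show "1 *\<^sub>C f = f"
    by transfer (auto simp: l2_rel_def)
qed


section \<open>Linear operators in the Hilbert space\<close>

definition bounded_clinear :: "(l2 \<Rightarrow> l2) \<Rightarrow> bool" where
  "bounded_clinear B \<longleftrightarrow>
     Vector_Spaces.linear scaleC scaleC B \<and> (\<exists>K. \<forall>f. norm (B f) \<le> K * norm f)"

definition orthonormal_basis :: "l2 set \<Rightarrow> bool" where
  "orthonormal_basis E \<longleftrightarrow>
     (\<forall>e\<in>E. \<forall>e'\<in>E. cinner e e' = (if e = e' then 1 else 0)) \<and> closure (l2.span E) = UNIV"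

text \<open>The sum below does not depend on the choice of the orthonormal basis.\<close>

definition hilbert_schmidt :: "(l2 \<Rightarrow> l2) \<Rightarrow> bool" where
  "hilbert_schmidt B \<longleftrightarrow>
     bounded_clinear B \<and>
     (\<exists>E. orthonormal_basis E \<and> (\<lambda>e. (norm (B e))\<^sup>2) summable_on E)"

text \<open>An operator that need not be everywhere defined is identified with its graph.\<close>

type_synonym l2_op = "(l2 \<times> l2) set"

definition op_graph :: "(l2 \<Rightarrow> l2) \<Rightarrow> l2_op" where
  "op_graph B = {(f, g). g = B f}"

definition linear_op :: "l2_op \<Rightarrow> bool" where
  "linear_op G \<longleftrightarrow>
     single_valued G \<and> (0, 0) \<in> G \<and>
     (\<forall>f g f' g'. (f, g) \<in> G \<longrightarrow> (f', g') \<in> G \<longrightarrow> (f + f', g + g') \<in> G) \<and>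
     (\<forall>c f g. (f, g) \<in> G \<longrightarrow> (c *\<^sub>C f, c *\<^sub>C g) \<in> G)"

definition densely_defined :: "l2_op \<Rightarrow> bool" where
  "densely_defined G \<longleftrightarrow> closure (Domain G) = UNIV"

definition op_shift :: "l2_op \<Rightarrow> complex \<Rightarrow> l2_op" where
  "op_shift G z = {(f, g - z *\<^sub>C f) | f g. (f, g) \<in> G}"

text \<open>The relation \<open>(op_shift G z)\<inverse>\<close> is the graph of the inverse of \<open>G - z I\<close>; it being the graph of
  a total bounded function says that \<open>G - z I\<close> is a bijection of its domain onto the whole
  space, with bounded inverse.\<close>

definition resolvent_set :: "l2_op \<Rightarrow> complex set" where
  "resolvent_set G = {z. \<exists>B. bounded_clinear B \<and> (op_shift G z)\<inverse> = op_graph B}"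

definition resolvent :: "l2_op \<Rightarrow> complex \<Rightarrow> l2 \<Rightarrow> l2" where
  "resolvent G z = (THE B. (op_shift G z)\<inverse> = op_graph B)"

definition eigenspace :: "l2_op \<Rightarrow> complex \<Rightarrow> l2 set" where
  "eigenspace G z = {f. (f, z *\<^sub>C f) \<in> G}"

text \<open>The dimension provided by the library is \<open>0\<close> for infinite-dimensional spaces, which is why
  positivity is demanded.\<close>

definition eigenvalue_of_mult :: "l2_op \<Rightarrow> complex \<Rightarrow> nat \<Rightarrow> bool" where
  "eigenvalue_of_mult G z k \<longleftrightarrow>
     (\<exists>f. f \<noteq> 0 \<and> f \<in> eigenspace G z) \<and> 0 < k \<and> l2.dim (eigenspace G z) = k"


section \<open>Schwartz functions and tempered distributions\<close>

definition nth_deriv :: "nat \<Rightarrow> (real \<Rightarrow> complex) \<Rightarrow> real \<Rightarrow> complex" where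
  "nth_deriv n = (\<lambda>\<phi> x. vector_derivative \<phi> (at x)) ^^ n"

definition schwartz :: "(real \<Rightarrow> complex) set" where
  "schwartz = {\<phi>. \<forall>n. (\<forall>x. nth_deriv n \<phi> differentiable (at x)) \<and>
     (\<forall>m. bounded (range (\<lambda>x. of_real (x ^ m) * nth_deriv n \<phi> x)))}"

definition schwartz_seminorm :: "nat \<Rightarrow> nat \<Rightarrow> (real \<Rightarrow> complex) \<Rightarrow> real" where
  "schwartz_seminorm m n \<phi> = (SUP x. cmod (of_real (x ^ m) * nth_deriv n \<phi> x))"

text \<open>Distributions are conjugate linear functionals: \<open>T \<psi>\<close> stands for the pairing
  \<open>\<langle>\<psi>, T\<rangle>\<close>. Only the values on Schwartz functions are meaningful, so two
  functionals represent the same distribution if they agree on \<^const>\<open>schwartz\<close>.\<close>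

type_synonym distribution = "(real \<Rightarrow> complex) \<Rightarrow> complex"

definition tempered :: "distribution \<Rightarrow> bool" where
  "tempered T \<longleftrightarrow>
     (\<forall>\<phi>\<in>schwartz. \<forall>\<psi>\<in>schwartz. T (\<lambda>x. \<phi> x + \<psi> x) = T \<phi> + T \<psi>) \<and>
     (\<forall>c. \<forall>\<psi>\<in>schwartz. T (\<lambda>x. c * \<psi> x) = cnj c * T \<psi>) \<and>
     (\<exists>C N. \<forall>\<psi>\<in>schwartz. cmod (T \<psi>) \<le> C * (\<Sum>m\<le>N. \<Sum>n\<le>N. schwartz_seminorm m n \<psi>))"

definition fun_dist :: "(real \<Rightarrow> complex) \<Rightarrow> distribution" where
  "fun_dist f \<psi> = (\<integral>x. cnj (\<psi> x) * f x \<partial>lborel)"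

definition l2_dist :: "l2 \<Rightarrow> distribution" where
  "l2_dist f = fun_dist (rep_l2 f)"

definition represents :: "l2 \<Rightarrow> distribution \<Rightarrow> bool" where
  "represents f T \<longleftrightarrow> (\<forall>\<psi>\<in>schwartz. T \<psi> = l2_dist f \<psi>)"

definition l2_of_dist :: "distribution \<Rightarrow> l2" where
  "l2_of_dist T = (THE f. represents f T)"

text \<open>Derivative, multiplication by a smooth function and Fourier transform are extended to
  distributions by duality with respect to the sesquilinear pairing; for the Fourier
  transform this amounts to Parseval's identity
  \<open>\<langle>\<F> \<psi>, \<F> T\<rangle> = \<langle>\<psi>, T\<rangle>\<close>.\<close>

definition deriv_dist :: "distribution \<Rightarrow> distribution" where
  "deriv_dist T \<psi> = - T (\<lambda>x. vector_derivative \<psi> (at x))"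

definition mult_dist :: "(real \<Rightarrow> complex) \<Rightarrow> distribution \<Rightarrow> distribution" where
  "mult_dist m T \<psi> = T (\<lambda>x. cnj (m x) * \<psi> x)"

definition fourier :: "(real \<Rightarrow> complex) \<Rightarrow> real \<Rightarrow> complex" where
  "fourier f \<xi> = of_real ((2 * pi) powr (-1/2)) * (\<integral>x. exp (- \<i> * of_real (\<xi> * x)) * f x \<partial>lborel)"

definition inv_fourier :: "(real \<Rightarrow> complex) \<Rightarrow> real \<Rightarrow> complex" where
  "inv_fourier f x = of_real ((2 * pi) powr (-1/2)) * (\<integral>\<xi>. exp (\<i> * of_real (\<xi> * x)) * f \<xi> \<partial>lborel)"

definition fourier_dist :: "distribution \<Rightarrow> distribution" where
  "fourier_dist T \<psi> = T (inv_fourier \<psi>)"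

definition inv_fourier_dist :: "distribution \<Rightarrow> distribution" where
  "inv_fourier_dist T \<psi> = T (fourier \<psi>)"

definition fourier_multiplier :: "(real \<Rightarrow> complex) \<Rightarrow> distribution \<Rightarrow> distribution" where
  "fourier_multiplier m T = inv_fourier_dist (mult_dist m (fourier_dist T))"


section \<open>Sobolev spaces and multiplication by a distribution\<close>

definition weighted_fourier :: "real \<Rightarrow> distribution \<Rightarrow> distribution" where
  "weighted_fourier s T = mult_dist (\<lambda>\<xi>. of_real ((1 + \<xi>\<^sup>2) powr (s / 2))) (fourier_dist T)"

definition sobolev :: "real \<Rightarrow> distribution set" where
  "sobolev s = {T. tempered T \<and> (\<exists>g. represents g (weighted_fourier s T))}"

definition sobolev_norm :: "real \<Rightarrow> distribution \<Rightarrow> real" where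
  "sobolev_norm s T = norm (l2_of_dist (weighted_fourier s T))"

definition sobolev_tendsto :: "real \<Rightarrow> (nat \<Rightarrow> real \<Rightarrow> complex) \<Rightarrow> distribution \<Rightarrow> bool" where
  "sobolev_tendsto s \<phi> T \<longleftrightarrow>
     (\<lambda>n. sobolev_norm s (\<lambda>\<psi>. fun_dist (\<phi> n) \<psi> - T \<psi>)) \<longlonglongrightarrow> 0"

text \<open>For \<open>V \<in> sobolev (-1)\<close>, the operator \<open>T \<mapsto> V T\<close> is the continuous extension to
  \<open>sobolev 1\<close> of \<open>\<langle>\<psi>, V \<phi>\<rangle> = \<langle>cnj \<phi> \<psi>, V\<rangle>\<close>, given for Schwartz functions \<open>\<phi>\<close>: the value
  is the common limit along all sequences of Schwartz functions approximating \<open>T\<close>.\<close>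

definition mult_op :: "distribution \<Rightarrow> distribution \<Rightarrow> distribution" where
  "mult_op V T \<psi> = (THE l. \<forall>\<phi>. (\<forall>n. \<phi> n \<in> schwartz) \<longrightarrow> sobolev_tendsto 1 \<phi> T \<longrightarrow>
     (\<lambda>n. V (\<lambda>x. cnj (\<phi> n x) * \<psi> x)) \<longlonglongrightarrow> l)"


section \<open>The operators of the theorem\<close>

definition op_H0 :: l2_op where
  "op_H0 = {(f, g). l2_dist f \<in> sobolev 2 \<and>
     represents g (\<lambda>\<psi>. - deriv_dist (deriv_dist (l2_dist f)) \<psi>)}"

definition csqrt_2pi :: "complex \<Rightarrow> complex" where
  "csqrt_2pi z = of_real (sqrt (cmod z)) * exp (\<i> * of_real (Arg2pi z / 2))"

definition res_half :: "complex \<Rightarrow> distribution \<Rightarrow> distribution" where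
  "res_half z = fourier_multiplier (\<lambda>\<xi>. inverse (csqrt_2pi (of_real (\<xi>\<^sup>2) - z)))"

definition res_half_l2 :: "complex \<Rightarrow> l2 \<Rightarrow> l2" where
  "res_half_l2 z f = l2_of_dist (res_half z (l2_dist f))"

definition op_A :: "distribution \<Rightarrow> complex \<Rightarrow> l2 \<Rightarrow> l2" where
  "op_A V z f = - l2_of_dist (res_half z (mult_op V (res_half z (l2_dist f))))"

definition D_H0 :: "distribution \<Rightarrow> complex set" where
  "D_H0 V = {z. z \<notin> \<real>\<^sub>\<ge>\<^sub>0 \<and> 1 \<notin> resolvent_set (op_graph (op_A V z))}"

definition op_R :: "distribution \<Rightarrow> complex \<Rightarrow> l2 \<Rightarrow> l2" where
  "op_R V z = res_half_l2 z \<circ> inv (\<lambda>f. f - op_A V z f) \<circ> res_half_l2 z"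

definition defined_by_R :: "distribution \<Rightarrow> l2_op \<Rightarrow> bool" where
  "defined_by_R V H \<longleftrightarrow>
     (\<forall>z. z \<notin> \<real>\<^sub>\<ge>\<^sub>0 \<union> D_H0 V \<longrightarrow> (op_shift H z)\<inverse> = op_graph (op_R V z))"

end

theory Submission
  imports Defs "HOL-Probability.Characteristic_Functions" "HOL-Probability.Sinc_Integral"
begin


text \<open>
  In momentum space all operators of the theorem are explicit. Let \<open>g\<close> be the square integrable function
  with \<open>V^(\<xi>) = (1 + \<xi>\<^sup>2)\<^sup>1\<^sup>/\<^sup>2 g(\<xi>)\<close>, where the hat denotes the Fourier transform, and let
  \<open>m(\<xi>) = (\<xi>\<^sup>2 - z)\<^sup>-\<^sup>1\<^sup>/\<^sup>2\<close>. Multiplication by \<open>V\<close> is convolution with \<open>V^\<close>, so that \<open>- A\<^sub>V(z)\<close> becomes the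
  integral operator with the kernel \<open>(2\<pi>)\<^sup>-\<^sup>1\<^sup>/\<^sup>2 m(\<xi>) V^(\<xi> - \<eta>) m(\<eta>)\<close> (\<open>op_A_eq\<close>). As \<open>m\<close> decays like
  \<open>1 / \<bar>\<xi>\<bar>\<close>, the kernel is square integrable (\<open>l2_kernel_potential\<close>). For \<open>z = - n\<^sup>2\<close> its
  norm tends to zero by dominated convergence, hence \<open>R(z)\<close> is defined for some \<open>z\<close>
  (\<open>exists_point_off_D_H0\<close>), and an operator is determined by its resolvent at that point.

  The key is \<open>schroedinger_op_iff_birman\<close>. For \<open>f = (H\<^sub>0 - z)\<^sup>-\<^sup>1\<^sup>/\<^sup>2 h\<close> the equation
  \<open>h - A\<^sub>V(z) h = (H\<^sub>0 - z)\<^sup>-\<^sup>1\<^sup>/\<^sup>2 u\<close>, divided by \<open>m\<close> in momentum space, becomes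
  \<open>\<xi>\<^sup>2 f^ + (2\<pi>)\<^sup>-\<^sup>1\<^sup>/\<^sup>2 V^ * f^ = u^ + z f^\<close>. Its left side does not depend on \<open>z\<close>; it defines the operator \<open>H\<close>.
  Wherever \<open>I - A\<^sub>V(z)\<close> is invertible, the equation says that \<open>R(z)\<close> is the resolvent of \<open>H\<close>, and for
  \<open>u = 0\<close> it says, for all \<open>z\<close> off the half-axis, that the eigenvectors of \<open>H\<close> are the images of the
  fixed vectors of \<open>A\<^sub>V(z)\<close>.

  The difference of the resolvents at a point \<open>w\<close> where \<open>R(w)\<close> is defined contains the factor \<open>A\<^sub>V(w)\<close>, and
  the difference at any other common point of the resolvent sets is the one at \<open>w\<close> between
  bounded operators (\<open>resolvent_difference\<close>). That a kernel operator between bounded operators is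
  Hilbert-Schmidt follows from Bessel's inequality, applied for almost every \<open>\<xi>\<close> to a bounded functional
  (\<open>hilbert_schmidt_kernel_op\<close>).

  The greater part of the text makes momentum space available: completeness of the space of square integrable
  functions, existence of orthonormal bases, inversion formula and Parseval identity for
  Schwartz functions, their density and the resulting unitary Fourier transform, and the smoothness of \<open>m\<close>,
  which ensures that the multipliers act on Schwartz functions and thus on distributions.\<close>

section \<open>Representatives and the inner product\<close>

lemma l2_rel_refl: "l2_rel f f \<longleftrightarrow> square_integrable f"
  by (simp add: l2_rel_def)

lemma square_integrable_rep [simp, intro]: "square_integrable (rep_l2 f)"
  using Quotient3_rep_reflp[OF Quotient3_l2, of f] by (simp add: l2_rel_def)

lemma abs_rep_l2 [simp]: "abs_l2 (rep_l2 f) = f"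
  by (rule Quotient3_abs_rep[OF Quotient3_l2])

lemma measurable_rep [measurable]: "rep_l2 f \<in> borel_measurable lborel"
  using square_integrable_rep[of f] by (simp add: square_integrable_def)

lemma rep_abs_l2: "square_integrable h \<Longrightarrow> AE x in lborel. rep_l2 (abs_l2 h) x = h x"
  using rep_abs_rsp[OF Quotient3_l2, of h h] by (auto simp: l2_rel_def)

lemma l2_eqI:
  assumes "AE x in lborel. rep_l2 f x = rep_l2 g x"
  shows "f = g"
  using Quotient3_rel_rep[OF Quotient3_l2, of f g] assms by (simp add: l2_rel_def)

lemma abs_l2_eqI:
  assumes "square_integrable h" "AE x in lborel. rep_l2 f x = h x"
  shows "f = abs_l2 h"
  by (rule l2_eqI) (use rep_abs_l2[OF assms(1)] assms(2) in \<open>eventually_elim; simp\<close>)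

lemma rep_plus: "AE x in lborel. rep_l2 (f + g) x = rep_l2 f x + rep_l2 g x"
  using plus_l2.abs_eq[of "rep_l2 f" "rep_l2 g"]
    rep_abs_l2[OF square_integrable_add[OF square_integrable_rep square_integrable_rep], of f g]
  by (simp add: l2_rel_refl)

lemma rep_scaleC: "AE x in lborel. rep_l2 (c *\<^sub>C f) x = c * rep_l2 f x"
  using scaleC.abs_eq[of "rep_l2 f" c]
    rep_abs_l2[OF square_integrable_scale[OF square_integrable_rep], of c f]
  by (simp add: l2_rel_refl)

lemma rep_uminus: "AE x in lborel. rep_l2 (- f) x = - rep_l2 f x"
  using uminus_l2.abs_eq[of "rep_l2 f"]
    rep_abs_l2[OF square_integrable_scale[OF square_integrable_rep], of "-1" f]
  by (simp add: l2_rel_refl)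

lemma rep_minus: "AE x in lborel. rep_l2 (f - g) x = rep_l2 f x - rep_l2 g x"
  using rep_plus[of f "-g"] rep_uminus[of g] by eventually_elim simp

lemma rep_zero: "AE x in lborel. rep_l2 0 x = 0"
  using rep_abs_l2[OF square_integrable_zero] by (simp add: zero_l2.abs_eq)

lemma scaleR_l2_eq: "r *\<^sub>R f = of_real r *\<^sub>C (f::l2)"
  using scaleR_l2.abs_eq[of "rep_l2 f" r] scaleC.abs_eq[of "rep_l2 f" "of_real r"]
  by (simp add: l2_rel_refl)

lemma scaleC_one [simp]: "1 *\<^sub>C f = f" and scaleC_zero [simp]: "0 *\<^sub>C f = 0"
  and scaleC_zero_right [simp]: "c *\<^sub>C 0 = 0"
  by simp_all

lemma square_integrable_diff:
  "square_integrable f \<Longrightarrow> square_integrable g \<Longrightarrow> square_integrable (\<lambda>x. f x - g x)"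
  using square_integrable_add[of f "\<lambda>x. -1 * g x"] square_integrable_scale[of g "-1"] by simp

lemma square_integrable_bound:
  assumes "square_integrable f" "g \<in> borel_measurable lborel"
    "AE x in lborel. cmod (g x) \<le> C * cmod (f x)"
  shows "square_integrable g"
proof -
  have "integrable lborel (\<lambda>x. (cmod (g x))\<^sup>2)"
  proof (rule Bochner_Integration.integrable_bound)
    show "integrable lborel (\<lambda>x. C\<^sup>2 * (cmod (f x))\<^sup>2)"
      using assms(1) by (simp add: square_integrable_def)
    show "AE x in lborel. norm ((cmod (g x))\<^sup>2) \<le> norm (C\<^sup>2 * (cmod (f x))\<^sup>2)"
      using assms(3)
    proof eventually_elim
      case (elim x)
      have "(cmod (g x))\<^sup>2 \<le> (C * cmod (f x))\<^sup>2"
        by (rule power_mono[OF elim]) simp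
      then show ?case by (simp add: power_mult_distrib)
    qed
  qed (use assms(2) in measurable)
  with assms(2) show ?thesis by (simp add: square_integrable_def)
qed

lemma cinner_rep: "cinner f g = (\<integral>x. cnj (rep_l2 f x) * rep_l2 g x \<partial>lborel)"
  by (rule cinner.rep_eq)

lemma cinner_abs:
  "square_integrable f \<Longrightarrow> square_integrable g \<Longrightarrow>
    cinner (abs_l2 f) (abs_l2 g) = (\<integral>x. cnj (f x) * g x \<partial>lborel)"
  by (simp add: cinner.abs_eq l2_rel_refl)

lemma cinner_abs_left:
  "square_integrable f \<Longrightarrow> cinner (abs_l2 f) g = (\<integral>x. cnj (f x) * rep_l2 g x \<partial>lborel)"
  using cinner_abs[of f "rep_l2 g"] by simp

lemma cinner_commute: "cinner f g = cnj (cinner g f)"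
  unfolding cinner_rep
  by (subst Bochner_Integration.integral_cnj[symmetric]) (simp add: mult.commute)

lemma cinner_add_right: "cinner f (g + h) = cinner f g + cinner f h"
proof -
  have "cinner (abs_l2 (rep_l2 f)) (abs_l2 (\<lambda>x. rep_l2 g x + rep_l2 h x))
      = cinner f g + cinner f h"
    by (subst cinner_abs) (auto simp: cinner_rep distrib_left square_integrable_mult
        intro!: square_integrable_add)
  moreover have "abs_l2 (\<lambda>x. rep_l2 g x + rep_l2 h x) = g + h"
    using plus_l2.abs_eq[of "rep_l2 g" "rep_l2 h"] by (simp add: l2_rel_refl)
  ultimately show ?thesis by simp
qed

lemma cinner_scale_right: "cinner f (c *\<^sub>C g) = c * cinner f g"
proof -
  have "cinner (abs_l2 (rep_l2 f)) (abs_l2 (\<lambda>x. c * rep_l2 g x)) = c * cinner f g"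
    by (subst cinner_abs) (auto simp: cinner_rep mult.left_commute[of _ c]
        intro!: square_integrable_scale)
  moreover have "abs_l2 (\<lambda>x. c * rep_l2 g x) = c *\<^sub>C g"
    using scaleC.abs_eq[of "rep_l2 g" c] by (simp add: l2_rel_refl)
  ultimately show ?thesis by simp
qed

lemma cinner_add_left: "cinner (f + g) h = cinner f h + cinner g h"
  by (subst (1 2 3) cinner_commute) (simp add: cinner_add_right)

lemma cinner_scale_left: "cinner (c *\<^sub>C f) g = cnj c * cinner f g"
  by (subst (1 2) cinner_commute) (simp add: cinner_scale_right)

lemma cinner_zero_right [simp]: "cinner f 0 = 0" and cinner_zero_left [simp]: "cinner 0 f = 0"
  using cinner_scale_right[of f 0 0] cinner_scale_left[of 0 0 f] by simp_all

lemma cinner_minus_right: "cinner f (- g) = - cinner f g"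
  and cinner_minus_left: "cinner (- f) g = - cinner f g"
  using cinner_scale_right[of f "-1" g] cinner_scale_left[of "-1" f g] by (simp_all)

lemma cinner_diff_right: "cinner f (g - h) = cinner f g - cinner f h"
  using cinner_add_right[of f g "-h"] by (simp add: cinner_minus_right)

lemma cinner_diff_left: "cinner (f - g) h = cinner f h - cinner g h"
  using cinner_add_left[of f "-g" h] by (simp add: cinner_minus_left)

lemma cinner_sum_right: "cinner f (\<Sum>i\<in>I. g i) = (\<Sum>i\<in>I. cinner f (g i))"
  by (induction I rule: infinite_finite_induct) (simp_all add: cinner_add_right)

lemma cinner_sum_left: "cinner (\<Sum>i\<in>I. g i) f = (\<Sum>i\<in>I. cinner (g i) f)"
  by (induction I rule: infinite_finite_induct) (simp_all add: cinner_add_left)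

lemma norm_l2_sq: "(norm f)\<^sup>2 = (\<integral>x. (cmod (rep_l2 f x))\<^sup>2 \<partial>lborel)"
proof -
  have "cinner f f = (\<integral>x. of_real ((cmod (rep_l2 f x))\<^sup>2) \<partial>lborel)"
    unfolding cinner_rep by (simp only: cnj_times_self)
  then have "cinner f f = of_real (\<integral>x. (cmod (rep_l2 f x))\<^sup>2 \<partial>lborel)"
    by (simp only: integral_complex_of_real)
  then show ?thesis
    by (simp add: norm_l2_def inner_l2_def)
qed

lemma cinner_self: "cinner f f = of_real ((norm f)\<^sup>2)"
proof -
  have "cinner f f = (\<integral>x. of_real ((cmod (rep_l2 f x))\<^sup>2) \<partial>lborel)"
    unfolding cinner_rep by (simp only: cnj_times_self)
  then show ?thesis by (simp only: integral_complex_of_real norm_l2_sq)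
qed

lemma norm_abs_l2_sq:
  assumes "square_integrable f"
  shows "(norm (abs_l2 f))\<^sup>2 = (\<integral>x. (cmod (f x))\<^sup>2 \<partial>lborel)"
proof -
  have "cinner (abs_l2 f) (abs_l2 f) = of_real (\<integral>x. (cmod (f x))\<^sup>2 \<partial>lborel)"
    by (simp only: cinner_abs[OF assms assms] cnj_times_self integral_complex_of_real)
  then show ?thesis by (metis cinner_self of_real_eq_iff)
qed

lemma norm_scaleC [simp]: "norm (c *\<^sub>C f) = cmod c * norm f"
proof -
  have "cinner (c *\<^sub>C f) (c *\<^sub>C f) = cnj c * c * cinner f f"
    by (simp only: cinner_scale_left cinner_scale_right mult.assoc mult.left_commute)
  then have "(norm (c *\<^sub>C f))\<^sup>2 = (cmod c * norm f)\<^sup>2"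
    by (simp only: cnj_times_self cinner_self of_real_mult[symmetric] of_real_eq_iff
        power_mult_distrib)
  then show ?thesis
    by (simp only: power2_eq_iff_nonneg mult_nonneg_nonneg norm_ge_zero)
qed

text \<open>Only the real part of \<^const>\<open>cinner\<close> is an inner product in the sense of the type class;
  rotating one argument by a phase makes the complex inner product real.\<close>

lemma cauchy_schwarz_l2: "cmod (cinner f g) \<le> norm f * norm g"
proof (cases "cinner f g = 0")
  case False
  define c where "c = cinner f g / of_real (cmod (cinner f g))"
  have c: "cmod c = 1" using False by (simp add: c_def norm_divide)
  have "cinner (c *\<^sub>C f) g = of_real (cmod (cinner f g))"
    using False by (simp add: c_def cinner_scale_left cnj_times_self power2_eq_square)
  then have "cmod (cinner f g) = inner (c *\<^sub>C f) g"
    by (simp add: inner_l2_def)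
  also have "\<dots> \<le> norm (c *\<^sub>C f) * norm g"
    by (rule norm_cauchy_schwarz)
  finally show ?thesis by (simp add: c)
qed simp

lemma tendsto_cinner:
  assumes "(f \<longlongrightarrow> a) F" "(g \<longlongrightarrow> b) F"
  shows "((\<lambda>n. cinner (f n) (g n)) \<longlongrightarrow> cinner a b) F"
proof -
  have "bounded_bilinear (cinner :: l2 \<Rightarrow> l2 \<Rightarrow> complex)"
  proof
    show "\<exists>K. \<forall>a b. norm (cinner a b) \<le> norm a * norm b * K"
      by (rule exI[of _ 1]) (simp add: cauchy_schwarz_l2)
  qed (simp_all add: cinner_add_left cinner_add_right scaleR_l2_eq cinner_scale_left
      cinner_scale_right scaleR_conv_of_real)
  from bounded_bilinear.tendsto[OF this assms] show ?thesis .
qed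

lemma tendsto_scaleC: "(f \<longlongrightarrow> a) F \<Longrightarrow> ((\<lambda>n. c *\<^sub>C f n) \<longlongrightarrow> c *\<^sub>C a) F"
proof -
  assume f: "(f \<longlongrightarrow> a) F"
  have "((\<lambda>n. norm (c *\<^sub>C f n - c *\<^sub>C a)) \<longlongrightarrow> 0) F"
    unfolding l2.scale_right_diff_distrib[symmetric] norm_scaleC
    by (rule tendsto_mult_right_zero) (use f in \<open>simp add: LIM_zero_iff tendsto_norm_zero_iff\<close>)
  then show ?thesis
    by (simp add: LIM_zero_iff tendsto_norm_zero_iff)
qed

section \<open>Completeness\<close>

lemma square_integrable_iff_nn:
  assumes [measurable]: "f \<in> borel_measurable lborel"
  shows "square_integrable f \<longleftrightarrow> (\<integral>\<^sup>+x. ennreal ((cmod (f x))\<^sup>2) \<partial>lborel) < \<infinity>"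
  by (simp add: square_integrable_def integrable_iff_bounded)

lemma nn_norm_abs_l2:
  assumes "square_integrable f"
  shows "(\<integral>\<^sup>+x. ennreal ((cmod (f x))\<^sup>2) \<partial>lborel) = ennreal ((norm (abs_l2 f))\<^sup>2)"
  using assms by (subst nn_integral_eq_integral) (simp_all add: norm_abs_l2_sq square_integrable_def)

text \<open>The proof of the Riesz-Fischer theorem extracts a subsequence with increments \<open>d n\<close> of norm
  at most \<open>4\<^sup>-\<^sup>n\<close>. Then \<open>\<Sum>n. 4\<^sup>n \<bar>d n\<bar>\<^sup>2\<close> has a finite integral, hence is finite almost everywhere, and
  a finite value at a point makes the increments there decay geometrically.\<close>

lemma term_le_suminf_ennreal: "g n \<le> (\<Sum>n. g n)" for g :: "nat \<Rightarrow> ennreal"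
  using sum_le_suminf[OF summableI finite.insertI[OF finite.emptyI], of n g] by simp

lemma convergent_of_weighted_square_sum:
  fixes f :: "nat \<Rightarrow> complex"
  assumes fin: "(\<Sum>n. ennreal (4 ^ n * (cmod (f (Suc n) - f n))\<^sup>2)) \<noteq> \<infinity>"
  shows "convergent f"
proof -
  obtain C where C: "(\<Sum>n. ennreal (4 ^ n * (cmod (f (Suc n) - f n))\<^sup>2)) = ennreal C" "0 \<le> C"
    using fin less_top_ennreal unfolding infinity_ennreal_def less_top by blast
  have le: "cmod (f (Suc n) - f n) \<le> sqrt C * (1/2) ^ n" for n
  proof -
    have "ennreal (4 ^ n * (cmod (f (Suc n) - f n))\<^sup>2) \<le> ennreal C"
      unfolding C(1)[symmetric] by (rule term_le_suminf_ennreal)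
    then have "4 ^ n * (cmod (f (Suc n) - f n))\<^sup>2 \<le> C"
      by (rule ennreal_le_iff[OF C(2), THEN iffD1])
    moreover have "(2 ^ n * cmod (f (Suc n) - f n))\<^sup>2 = 4 ^ n * (cmod (f (Suc n) - f n))\<^sup>2"
      by (simp add: power_mult_distrib power_even_eq[symmetric] power2_eq_square flip: power_mult_distrib)
    ultimately have "(2 ^ n * cmod (f (Suc n) - f n))\<^sup>2 \<le> C"
      by linarith
    then have "2 ^ n * cmod (f (Suc n) - f n) \<le> sqrt C"
      by (rule real_le_rsqrt)
    then show ?thesis by (simp add: power_divide pos_le_divide_eq mult.commute)
  qed
  have "summable (\<lambda>n. sqrt C * (1/2) ^ n)"
    by (intro summable_mult summable_geometric) simp
  then have "summable (\<lambda>n. f (Suc n) - f n)"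
    by (rule summable_comparison_test') (rule le)
  then have "convergent (\<lambda>n. \<Sum>i<n. f (Suc i) - f i)"
    by (simp only: summable_iff_convergent)
  then have "convergent (\<lambda>n. f n - f 0)"
    by (simp only: sum_lessThan_telescope)
  then show ?thesis
    by (simp only: convergent_diff_const_right_iff)
qed

lemma AE_Cauchy_rep:
  fixes X :: "nat \<Rightarrow> l2"
  assumes X: "\<And>n. norm (X (Suc n) - X n) \<le> (1/4) ^ n"
  shows "AE x in lborel. convergent (\<lambda>n. rep_l2 (X n) x)"
proof -
  define d where "d n x = rep_l2 (X (Suc n)) x - rep_l2 (X n) x" for n x
  have si: "square_integrable (d n)" for n
    unfolding d_def by (intro square_integrable_diff square_integrable_rep)
  have [measurable]: "d n \<in> borel_measurable lborel" for n
    using si by (simp add: square_integrable_def)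
  have d_int: "(\<integral>\<^sup>+x. ennreal (4 ^ n * (cmod (d n x))\<^sup>2) \<partial>lborel) \<le> ennreal ((1/4) ^ n)" for n
  proof -
    have "AE x in lborel. rep_l2 (X (Suc n) - X n) x = d n x"
      unfolding d_def by (rule rep_minus)
    then have "abs_l2 (d n) = X (Suc n) - X n"
      using abs_l2_eqI[OF si] by metis
    then have "(\<integral>\<^sup>+x. ennreal ((cmod (d n x))\<^sup>2) \<partial>lborel) = ennreal ((norm (X (Suc n) - X n))\<^sup>2)"
      using nn_norm_abs_l2[OF si] by simp
    then have "(\<integral>\<^sup>+x. ennreal (4 ^ n * (cmod (d n x))\<^sup>2) \<partial>lborel)
        = ennreal (4 ^ n * (norm (X (Suc n) - X n))\<^sup>2)"
      by (simp add: ennreal_mult nn_integral_cmult)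
    also have "\<dots> \<le> ennreal (4 ^ n * ((1/4) ^ n)\<^sup>2)"
      by (intro ennreal_leI mult_left_mono power_mono X) simp_all
    also have "4 ^ n * ((1/4::real) ^ n)\<^sup>2 = (1/4) ^ n"
      by (simp add: power2_eq_square power_divide)
    finally show ?thesis .
  qed
  have "(\<integral>\<^sup>+x. (\<Sum>n. ennreal (4 ^ n * (cmod (d n x))\<^sup>2)) \<partial>lborel)
      = (\<Sum>n. \<integral>\<^sup>+x. ennreal (4 ^ n * (cmod (d n x))\<^sup>2) \<partial>lborel)"
    by (rule nn_integral_suminf) measurable
  also have "\<dots> \<le> (\<Sum>n. ennreal ((1/4) ^ n))"
    by (intro suminf_le d_int) auto
  also have "\<dots> = ennreal (\<Sum>n. (1/4) ^ n)"
    by (intro suminf_ennreal2) (auto intro: summable_geometric)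
  also have "\<dots> < \<infinity>" by simp
  finally have fin: "(\<integral>\<^sup>+x. (\<Sum>n. ennreal (4 ^ n * (cmod (d n x))\<^sup>2)) \<partial>lborel) \<noteq> \<infinity>"
    by (rule less_imp_neq)
  have "AE x in lborel. (\<Sum>n. ennreal (4 ^ n * (cmod (d n x))\<^sup>2)) \<noteq> \<infinity>"
    by (rule nn_integral_PInf_AE[OF _ fin]) measurable
  then show ?thesis
    by (rule AE_mp) (simp add: d_def convergent_of_weighted_square_sum)
qed

text \<open>By Fatou's lemma the almost everywhere limit is also the limit in norm.\<close>

lemma convergent_l2_of_AE:
  fixes X :: "nat \<Rightarrow> l2"
  assumes "Cauchy X" and conv: "AE x in lborel. convergent (\<lambda>n. rep_l2 (X n) x)"
  shows "convergent X"
proof -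
  define F where "F x = lim (\<lambda>n. rep_l2 (X n) x)" for x
  have [measurable]: "F \<in> borel_measurable lborel"
    unfolding F_def by (rule borel_measurable_lim_metric) measurable
  have le: "(\<integral>\<^sup>+x. ennreal ((cmod (F x - rep_l2 (X n) x))\<^sup>2) \<partial>lborel) \<le> ennreal (e\<^sup>2)"
    if n: "\<And>k. k \<ge> n \<Longrightarrow> norm (X k - X n) \<le> e" and "e > 0" for n e
  proof -
    have k: "(\<integral>\<^sup>+x. ennreal ((cmod (rep_l2 (X k) x - rep_l2 (X n) x))\<^sup>2) \<partial>lborel)
        = ennreal ((norm (X k - X n))\<^sup>2)" for k
    proof -
      have si: "square_integrable (\<lambda>x. rep_l2 (X k) x - rep_l2 (X n) x)"
        by (intro square_integrable_diff square_integrable_rep)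
      have "X k - X n = abs_l2 (\<lambda>x. rep_l2 (X k) x - rep_l2 (X n) x)"
        by (rule abs_l2_eqI[OF si rep_minus])
      then show ?thesis using nn_norm_abs_l2[OF si] by simp
    qed
    have "(\<integral>\<^sup>+x. ennreal ((cmod (F x - rep_l2 (X n) x))\<^sup>2) \<partial>lborel)
      = (\<integral>\<^sup>+x. liminf (\<lambda>k. ennreal ((cmod (rep_l2 (X k) x - rep_l2 (X n) x))\<^sup>2)) \<partial>lborel)"
    proof (rule nn_integral_cong_AE)
      show "AE x in lborel. ennreal ((cmod (F x - rep_l2 (X n) x))\<^sup>2)
         = liminf (\<lambda>k. ennreal ((cmod (rep_l2 (X k) x - rep_l2 (X n) x))\<^sup>2))"
        using conv
      proof eventually_elim
        case (elim x)
        then have "(\<lambda>k. rep_l2 (X k) x) \<longlonglongrightarrow> F x"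
          by (simp add: F_def convergent_LIMSEQ_iff)
        then have "(\<lambda>k. ennreal ((cmod (rep_l2 (X k) x - rep_l2 (X n) x))\<^sup>2))
            \<longlonglongrightarrow> ennreal ((cmod (F x - rep_l2 (X n) x))\<^sup>2)"
          by (intro tendsto_intros)
        then show ?case
          by (metis lim_imp_Liminf sequentially_bot)
      qed
    qed
    also have "\<dots> \<le> liminf (\<lambda>k. \<integral>\<^sup>+x. ennreal ((cmod (rep_l2 (X k) x - rep_l2 (X n) x))\<^sup>2) \<partial>lborel)"
      by (rule nn_integral_liminf) measurable
    also have "\<dots> \<le> ennreal (e\<^sup>2)"
      unfolding k
    proof (rule Liminf_le)
      show "\<forall>\<^sub>F k in sequentially. ennreal ((norm (X k - X n))\<^sup>2) \<le> ennreal (e\<^sup>2)"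
        using eventually_ge_at_top[of n]
        by eventually_elim (auto intro!: ennreal_leI power_mono n)
    qed simp
    finally show ?thesis .
  qed
  have ex: "\<exists>N. \<forall>n\<ge>N. \<forall>k\<ge>n. norm (X k - X n) \<le> e" if "e > 0" for e
    using assms(1) that unfolding Cauchy_def dist_norm
    by (meson le_trans less_imp_le order_refl)
  have siF': "square_integrable (\<lambda>x. F x - rep_l2 (X n) x)"
    if "\<And>k. k \<ge> n \<Longrightarrow> norm (X k - X n) \<le> e" "e > 0" for n e
    using le_less_trans[OF le[OF that]]
    by (subst square_integrable_iff_nn) (auto simp: ennreal_less_top)
  obtain N where "\<forall>n\<ge>N. \<forall>k\<ge>n. norm (X k - X n) \<le> 1" using ex[of 1] by auto
  then have "square_integrable (\<lambda>x. F x - rep_l2 (X N) x)"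
    using siF'[of N 1] by auto
  then have siF: "square_integrable F"
    using square_integrable_add[OF _ square_integrable_rep, of _ "X N"] by fastforce
  have "X \<longlonglongrightarrow> abs_l2 F"
    unfolding LIMSEQ_def dist_norm
  proof (intro allI impI)
    fix e :: real assume "e > 0"
    then obtain N where N: "\<forall>n\<ge>N. \<forall>k\<ge>n. norm (X k - X n) \<le> e/2" using ex[of "e/2"] by auto
    have "norm (X n - abs_l2 F) < e" if "n \<ge> N" for n
    proof -
      have n: "\<And>k. k \<ge> n \<Longrightarrow> norm (X k - X n) \<le> e/2" using N that by auto
      note si = siF'[OF n] and l = le[OF n]
      have "abs_l2 F - X n = abs_l2 (\<lambda>x. F x - rep_l2 (X n) x)"
        using si \<open>e > 0\<close>
        by (intro abs_l2_eqI) (use rep_minus[of "abs_l2 F" "X n"] rep_abs_l2[OF siF] in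
            \<open>auto elim: eventually_elim2\<close>)
      then have "ennreal ((norm (abs_l2 F - X n))\<^sup>2) \<le> ennreal ((e/2)\<^sup>2)"
        using nn_norm_abs_l2[OF si] l \<open>e > 0\<close> by simp
      then have "norm (abs_l2 F - X n) \<le> e/2"
        using \<open>e > 0\<close> by (simp add: power2_le_iff_abs_le)
      then show ?thesis using \<open>e > 0\<close> by (simp add: norm_minus_commute)
    qed
    then show "\<exists>no. \<forall>n\<ge>no. norm (X n - abs_l2 F) < e" by blast
  qed
  then show ?thesis by (rule convergentI)
qed

instance l2 :: banach
proof
  fix X :: "nat \<Rightarrow> l2"
  assume X: "Cauchy X"
  have "\<exists>r. strict_mono r \<and> (\<forall>n. norm (X (r (Suc n)) - X (r n)) \<le> (1/4) ^ n)"
  proof -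
    have "\<exists>N. \<forall>m\<ge>N. \<forall>k\<ge>N. norm (X m - X k) \<le> (1/4) ^ n" for n
    proof -
      have "(1/4::real) ^ n > 0" by simp
      from CauchyD[OF X this] show ?thesis by (meson less_imp_le)
    qed
    then obtain N where N: "\<And>n m k. m \<ge> N n \<Longrightarrow> k \<ge> N n \<Longrightarrow> norm (X m - X k) \<le> (1/4) ^ n"
      by metis
    define r where "r = rec_nat (N 0) (\<lambda>n a. max (Suc a) (N (Suc n)))"
    have r: "r 0 = N 0" "r (Suc n) = max (Suc (r n)) (N (Suc n))" for n
      by (simp_all add: r_def)
    have "strict_mono r" by (rule strict_monoI_Suc) (simp add: r)
    moreover have "r n \<ge> N n" for n by (cases n) (simp_all add: r)
    moreover have "r (Suc n) \<ge> r n" for n by (simp add: r)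
    ultimately show ?thesis using N by (meson le_trans)
  qed
  then obtain r where r: "strict_mono r" "\<And>n. norm (X (r (Suc n)) - X (r n)) \<le> (1/4) ^ n"
    by auto
  have "convergent (X \<circ> r)"
    using r by (intro convergent_l2_of_AE AE_Cauchy_rep Cauchy_subseq_Cauchy X) auto
  then obtain L where "(X \<circ> r) \<longlonglongrightarrow> L" by (auto simp: convergent_def)
  then have "X \<longlonglongrightarrow> L"
    using X r(1) by (meson Cauchy_converges_subseq)
  then show "convergent X" by (rule convergentI)
qed

section \<open>Bounded operators, orthonormal bases and Hilbert-Schmidt operators\<close>

lemma bounded_clinearI:
  assumes "\<And>f g. B (f + g) = B f + B g" "\<And>c f. B (c *\<^sub>C f) = c *\<^sub>C B f"
    "\<And>f. norm (B f) \<le> K * norm f"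
  shows "bounded_clinear B"
proof -
  have "Vector_Spaces.linear scaleC scaleC B"
    by unfold_locales (use assms in simp_all)
  then show ?thesis using assms(3) by (auto simp: bounded_clinear_def)
qed

lemma
  assumes "bounded_clinear B"
  shows bounded_clinear_add: "B (f + g) = B f + B g"
    and bounded_clinear_scale: "B (c *\<^sub>C f) = c *\<^sub>C B f"
proof -
  interpret Vector_Spaces.linear scaleC scaleC B
    using assms by (simp add: bounded_clinear_def)
  show "B (f + g) = B f + B g" "B (c *\<^sub>C f) = c *\<^sub>C B f"
    by (simp_all add: add scale)
qed

lemma bounded_clinear_diff: "bounded_clinear B \<Longrightarrow> B (f - g) = B f - B g"
  using bounded_clinear_add[of B f "-g"] bounded_clinear_scale[of B "-1" g] by simp

lemma bounded_clinear_zero: "bounded_clinear B \<Longrightarrow> B 0 = 0"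
  using bounded_clinear_scale[of B 0 0] by simp

lemma bounded_clinear_bound:
  assumes "bounded_clinear B"
  obtains K where "K > 0" "\<And>f. norm (B f) \<le> K * norm f"
proof -
  obtain K where K: "\<And>f. norm (B f) \<le> K * norm f"
    using assms by (auto simp: bounded_clinear_def)
  have "norm (B f) \<le> (\<bar>K\<bar> + 1) * norm f" for f
    by (rule order_trans[OF K mult_right_mono]) simp_all
  then show ?thesis using that[of "\<bar>K\<bar> + 1"] by simp
qed

lemma bounded_clinear_tendsto:
  assumes "bounded_clinear B" "(f \<longlongrightarrow> a) F"
  shows "((\<lambda>n. B (f n)) \<longlongrightarrow> B a) F"
proof -
  obtain K where K: "\<And>f. norm (B f) \<le> K * norm f"
    using assms(1) bounded_clinear_bound by metis
  have "bounded_linear B"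
  proof
    show "\<exists>K. \<forall>x. norm (B x) \<le> norm x * K"
      using K by (auto simp: mult.commute intro!: exI[of _ K])
  qed (simp_all add: scaleR_l2_eq bounded_clinear_add[OF assms(1)] bounded_clinear_scale[OF assms(1)])
  then show ?thesis using assms(2) by (rule bounded_linear.tendsto)
qed

lemma bounded_clinear_id: "bounded_clinear (\<lambda>f. f)"
  by (rule bounded_clinearI[of _ 1]) simp_all

lemma bounded_clinear_compose:
  assumes "bounded_clinear A" "bounded_clinear B"
  shows "bounded_clinear (\<lambda>f. A (B f))"
proof -
  obtain K where K: "K > 0" "\<And>f. norm (A f) \<le> K * norm f" using bounded_clinear_bound[OF assms(1)] by metis
  obtain L where L: "L > 0" "\<And>f. norm (B f) \<le> L * norm f" using bounded_clinear_bound[OF assms(2)] by metis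
  show ?thesis
  proof (rule bounded_clinearI)
    show "norm (A (B f)) \<le> K * L * norm f" for f
      using order_trans[OF K(2) mult_left_mono[OF L(2)]] K(1) by (simp add: mult.assoc)
  qed (simp_all add: assms bounded_clinear_add bounded_clinear_scale)
qed

lemma bounded_clinear_plus:
  assumes "bounded_clinear A" "bounded_clinear B"
  shows "bounded_clinear (\<lambda>f. A f + B f)"
proof -
  obtain K where K: "K > 0" "\<And>f. norm (A f) \<le> K * norm f" using bounded_clinear_bound[OF assms(1)] by metis
  obtain L where L: "L > 0" "\<And>f. norm (B f) \<le> L * norm f" using bounded_clinear_bound[OF assms(2)] by metis
  show ?thesis
  proof (rule bounded_clinearI)
    show "norm (A f + B f) \<le> (K + L) * norm f" for f
      using norm_triangle_le[OF add_mono[OF K(2) L(2)], of f f] by (simp add: distrib_right)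
  qed (simp_all add: assms bounded_clinear_add bounded_clinear_scale l2.scale_right_distrib)
qed

lemma bounded_clinear_scaled:
  assumes "bounded_clinear A"
  shows "bounded_clinear (\<lambda>f. c *\<^sub>C A f)"
proof -
  obtain K where K: "K > 0" "\<And>f. norm (A f) \<le> K * norm f" using bounded_clinear_bound[OF assms(1)] by metis
  show ?thesis
  proof (rule bounded_clinearI)
    show "norm (c *\<^sub>C A f) \<le> cmod c * K * norm f" for f
      using mult_left_mono[OF K(2), of "cmod c" f] by (simp add: mult.assoc)
  qed (simp_all add: assms bounded_clinear_add bounded_clinear_scale l2.scale_right_distrib mult.commute)
qed

lemma bounded_clinear_neg: "bounded_clinear A \<Longrightarrow> bounded_clinear (\<lambda>f. - A f)"
  using bounded_clinear_scaled[of A "-1"] by simp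

text \<open>The solution of \<open>f = u + A f\<close> is a fixed point of a contraction.\<close>

lemma neumann:
  assumes A: "bounded_clinear A" and q: "q < 1" "\<And>f. norm (A f) \<le> q * norm f"
  obtains B where "bounded_clinear B" "\<And>f u. f - A f = u \<longleftrightarrow> f = B u"
proof -
  have "0 \<le> max q 0" "max q 0 < 1" using q by auto
  have q': "norm (A f) \<le> max q 0 * norm f" for f
    using order_trans[OF q(2) mult_right_mono[OF max.cobounded1]] by simp
  have "\<exists>!f. u + A f = f" for u
  proof -
    have "dist (u + A f) (u + A g) \<le> max q 0 * dist f g" for f g
      using q'[of "f - g"] by (simp add: dist_norm bounded_clinear_diff[OF A])
    then show ?thesis
      using \<open>0 \<le> max q 0\<close> \<open>max q 0 < 1\<close> by (intro banach_fix_type[of "max q 0"]) auto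
  qed
  then obtain B where B: "\<And>u f. u + A f = f \<longleftrightarrow> f = B u" by metis
  then have B': "f - A f = u \<longleftrightarrow> f = B u" for f u by (metis add_diff_cancel_right' diff_add_cancel)
  have eq: "B u = u + A (B u)" for u using B by metis
  have "bounded_clinear B"
  proof (rule bounded_clinearI)
    fix f g c
    show "B (f + g) = B f + B g"
      using B'[of "B f + B g" "f + g"] eq[of f] eq[of g]
      by (simp add: bounded_clinear_add[OF A] algebra_simps)
    show "B (c *\<^sub>C f) = c *\<^sub>C B f"
      using B'[of "c *\<^sub>C B f" "c *\<^sub>C f"] eq[of f]
      by (simp add: bounded_clinear_scale[OF A] l2.scale_right_diff_distrib[symmetric] diff_eq_eq)
    have "norm (B f) \<le> norm f + max q 0 * norm (B f)"
      using norm_triangle_ineq[of f "A (B f)"] eq[of f] q'[of "B f"] by simp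
    then have "(1 - max q 0) * norm (B f) \<le> norm f" by (simp add: algebra_simps)
    then show "norm (B f) \<le> (1 / (1 - max q 0)) * norm f"
      using \<open>max q 0 < 1\<close> by (simp add: field_simps)
  qed
  with B' show ?thesis using that by blast
qed

definition orthonormal :: "l2 set \<Rightarrow> bool" where
  "orthonormal E \<longleftrightarrow> (\<forall>e\<in>E. \<forall>e'\<in>E. cinner e e' = (if e = e' then 1 else 0))"

lemma norm_diff_scaleC_sq:
  fixes w g :: l2
  assumes "w \<noteq> 0"
  defines "t \<equiv> cinner w g / of_real ((norm w)\<^sup>2)"
  shows "(norm (g - t *\<^sub>C w))\<^sup>2 = (norm g)\<^sup>2 - (cmod (cinner w g))\<^sup>2 / (norm w)\<^sup>2"
proof -
  have w: "(of_real ((norm w)\<^sup>2) :: complex) \<noteq> 0" using assms(1) by simp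
  have *: "t * of_real ((norm w)\<^sup>2) = cinner w g"
    using w by (simp add: t_def)
  have "cinner (g - t *\<^sub>C w) (g - t *\<^sub>C w)
      = cinner g g - t * cinner g w - cnj t * (cinner w g - t * cinner w w)"
    by (simp add: cinner_diff_left cinner_diff_right cinner_scale_left cinner_scale_right algebra_simps)
  also have "\<dots> = of_real ((norm g)\<^sup>2) - t * cnj (cinner w g)"
    using * cinner_commute[of g w] by (simp add: cinner_self[of w] cinner_self[of g])
  also have "t * cnj (cinner w g) = of_real ((cmod (cinner w g))\<^sup>2 / (norm w)\<^sup>2)"
    by (simp add: t_def cnj_times_self[symmetric] mult.commute of_real_divide del: of_real_power)
  finally have "of_real ((norm (g - t *\<^sub>C w))\<^sup>2) 
      = (of_real ((norm g)\<^sup>2 - (cmod (cinner w g))\<^sup>2 / (norm w)\<^sup>2) :: complex)"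
    by (simp only: cinner_self of_real_diff)
  then show ?thesis by (simp only: of_real_eq_iff)
qed

text \<open>The difference between a vector and its best approximation in a closed subspace is
  orthogonal to the subspace; minimizing sequences converge by the parallelogram law.\<close>

lemma exists_orthogonal_vector:
  assumes W: "l2.subspace W" "closed W" and f: "f \<notin> W"
  shows "\<exists>g. g \<noteq> 0 \<and> (\<forall>w\<in>W. cinner w g = 0)"
proof -
  have W0: "0 \<in> W" and Wadd: "\<And>x y. x \<in> W \<Longrightarrow> y \<in> W \<Longrightarrow> x + y \<in> W"
    and Wsc: "\<And>c x. x \<in> W \<Longrightarrow> c *\<^sub>C x \<in> W"
    using W(1) by (auto simp: l2.subspace_def)
  define d where "d = (INF w\<in>W. (norm (f - w))\<^sup>2)"
  have bdd: "bdd_below ((\<lambda>w. (norm (f - w))\<^sup>2) ` W)" by (rule bdd_belowI[of _ 0]) auto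
  have d_le: "d \<le> (norm (f - w))\<^sup>2" if "w \<in> W" for w
    unfolding d_def by (rule cINF_lower[OF bdd that])
  have "\<exists>w\<in>W. (norm (f - w))\<^sup>2 < d + 1 / real (Suc n)" for n
    using cINF_less_iff[of W "\<lambda>w. (norm (f - w))\<^sup>2" "d + 1 / real (Suc n)"] bdd W0
    by (auto simp: d_def)
  then obtain w where w: "\<And>n. w n \<in> W" "\<And>n. (norm (f - w n))\<^sup>2 < d + 1 / real (Suc n)"
    by metis
  have par: "(norm (w m - w n))\<^sup>2 \<le> 2 / real (Suc m) + 2 / real (Suc n)" for m n
  proof -
    have "(1/2) *\<^sub>R (w m + w n) \<in> W" by (simp add: scaleR_l2_eq Wsc Wadd w)
    then have "d \<le> (norm (f - (1/2) *\<^sub>R (w m + w n)))\<^sup>2" by (rule d_le)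
    moreover have "(norm (w m - w n))\<^sup>2 + 4 * (norm (f - (1/2) *\<^sub>R (w m + w n)))\<^sup>2
        = 2 * (norm (f - w m))\<^sup>2 + 2 * (norm (f - w n))\<^sup>2"
      by (simp add: power2_norm_eq_inner inner_diff inner_add inner_commute algebra_simps)
    ultimately show ?thesis using w(2)[of m] w(2)[of n] by simp
  qed
  have "Cauchy w"
    unfolding Cauchy_def dist_norm
  proof (intro allI impI)
    fix e :: real assume e: "e > 0"
    obtain N where N: "4 / e\<^sup>2 < real (Suc N)"
      using reals_Archimedean2[of "4 / e\<^sup>2"] by (metis less_trans lessI of_nat_less_iff)
    have "norm (w m - w n) < e" if "m \<ge> N" "n \<ge> N" for m n
    proof -
      have "2 / real (Suc m) + 2 / real (Suc n) \<le> 2 / real (Suc N) + 2 / real (Suc N)"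
        using that by (intro add_mono divide_left_mono) auto
      also have "\<dots> = 4 / real (Suc N)" by simp
      also have "\<dots> < e\<^sup>2" using N e by (simp add: pos_divide_less_eq mult.commute)
      finally have "(norm (w m - w n))\<^sup>2 < e\<^sup>2" using par[of m n] by simp
      then show ?thesis using e by (simp add: power_less_imp_less_base)
    qed
    then show "\<exists>M. \<forall>m\<ge>M. \<forall>n\<ge>M. norm (w m - w n) < e" by blast
  qed
  then obtain p where p: "w \<longlonglongrightarrow> p" by (auto simp: Cauchy_convergent_iff convergent_def)
  have pW: "p \<in> W" using closed_sequentially[OF W(2) w(1) p] .
  have "(\<lambda>n. (norm (f - w n))\<^sup>2) \<longlonglongrightarrow> (norm (f - p))\<^sup>2" by (intro tendsto_intros p)
  moreover have "(\<lambda>n. d + 1 / real (Suc n)) \<longlonglongrightarrow> d + 0"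
    using LIMSEQ_Suc[OF lim_1_over_n] by (intro tendsto_intros) (simp add: )
  ultimately have pd: "(norm (f - p))\<^sup>2 \<le> d"
    using w(2) by (intro LIMSEQ_le[of _ _ "\<lambda>n. d + 1 / real (Suc n)" d]) (auto intro: less_imp_le)
  have "cinner v (f - p) = 0" if v: "v \<in> W" for v
  proof (cases "v = 0")
    case False
    define t where "t = cinner v (f - p) / of_real ((norm v)\<^sup>2)"
    have "d \<le> (norm (f - (p + t *\<^sub>C v)))\<^sup>2" using v pW by (intro d_le Wadd Wsc)
    also have "\<dots> = (norm (f - p))\<^sup>2 - (cmod (cinner v (f - p)))\<^sup>2 / (norm v)\<^sup>2"
      using norm_diff_scaleC_sq[OF False, of "f - p"] by (simp add: t_def diff_diff_eq)
    finally have "(cmod (cinner v (f - p)))\<^sup>2 / (norm v)\<^sup>2 \<le> 0" using pd by simp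
    then show ?thesis using False by (simp add: divide_le_0_iff)
  qed simp
  moreover have "f - p \<noteq> 0" using f pW by auto
  ultimately show ?thesis by blast
qed

lemma closure_subspace:
  assumes "l2.subspace S"
  shows "l2.subspace (closure S)"
  unfolding l2.subspace_def
proof (intro conjI ballI allI)
  show "0 \<in> closure S"
    using assms closure_subset by (auto simp: l2.subspace_def)
next
  fix x y assume "x \<in> closure S" "y \<in> closure S"
  then obtain a b where "\<forall>n. a n \<in> S" "a \<longlonglongrightarrow> x" "\<forall>n. b n \<in> S" "b \<longlonglongrightarrow> y"
    by (auto simp: closure_sequential)
  then show "x + y \<in> closure S"
    using assms unfolding closure_sequential
    by (intro exI[of _ "\<lambda>n. a n + b n"]) (auto intro: tendsto_add simp: l2.subspace_def)
next
  fix c x assume "x \<in> closure S"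
  then obtain a where "\<forall>n. a n \<in> S" "a \<longlonglongrightarrow> x"
    by (auto simp: closure_sequential)
  then show "c *\<^sub>C x \<in> closure S"
    using assms unfolding closure_sequential
    by (intro exI[of _ "\<lambda>n. c *\<^sub>C a n"]) (auto intro: tendsto_scaleC simp: l2.subspace_def)
qed

text \<open>The form in which the projection onto a closed subspace is used, both for orthonormal bases
  and for the density of the Schwartz functions.\<close>

lemma dense_if_annihilator_trivial:
  assumes "l2.subspace S" "\<And>g. (\<And>w. w \<in> S \<Longrightarrow> cinner w g = 0) \<Longrightarrow> g = 0"
  shows "closure S = UNIV"
proof (rule ccontr)
  assume "closure S \<noteq> UNIV"
  then obtain f where "f \<notin> closure S" by auto
  then obtain g where "g \<noteq> 0" "\<forall>w\<in>closure S. cinner w g = 0"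
    using exists_orthogonal_vector[OF closure_subspace[OF assms(1)]] by auto
  then show False using assms(2)[of g] closure_subset by auto
qed

text \<open>A maximal orthonormal set, which exists by Zorn's lemma, spans a dense subspace: a vector
  orthogonal to it could be normalized and added.\<close>

lemma exists_orthonormal_basis: "\<exists>E. orthonormal_basis E"
proof -
  have "\<exists>M\<in>Collect orthonormal. \<forall>X\<in>Collect orthonormal. M \<subseteq> X \<longrightarrow> X = M"
  proof (rule subset_Zorn')
    fix C assume C: "subset.chain (Collect orthonormal) C"
    have "cinner e e' = (if e = e' then 1 else 0)" if ee: "e \<in> \<Union> C" "e' \<in> \<Union> C" for e e'
    proof -
      obtain X Y where XY: "X \<in> C" "e \<in> X" "Y \<in> C" "e' \<in> Y" using ee by auto
      then have "X \<subseteq> Y \<or> Y \<subseteq> X" using C by (auto simp: subset.chain_def)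
      then obtain Z where "Z \<in> C" "e \<in> Z" "e' \<in> Z" using XY by auto
      then show ?thesis using C by (auto simp: subset.chain_def orthonormal_def)
    qed
    then show "\<Union> C \<in> Collect orthonormal" by (simp add: orthonormal_def)
  qed
  then obtain E where E: "orthonormal E" "\<And>X. orthonormal X \<Longrightarrow> E \<subseteq> X \<Longrightarrow> X = E" by auto
  have "closure (l2.span E) = UNIV"
  proof (rule dense_if_annihilator_trivial)
    fix g assume g: "\<And>w. w \<in> l2.span E \<Longrightarrow> cinner w g = 0"
    show "g = 0"
    proof (rule ccontr)
      assume "g \<noteq> 0"
      define e where "e = (1 / of_real (norm g)) *\<^sub>C g"
      have e0: "cinner w e = 0" "cinner e w = 0" if "w \<in> E" for w
        using g[OF l2.span_base[OF that]] cinner_commute[of g w]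
        by (simp_all add: e_def cinner_scale_right cinner_scale_left)
      have e1: "cinner e e = 1"
        using \<open>g \<noteq> 0\<close> by (simp add: e_def cinner_self norm_divide)
      have "e \<notin> E" using e0 e1 by force
      moreover have "orthonormal (insert e E)"
        using E(1) e0 e1 \<open>e \<notin> E\<close> by (auto simp: orthonormal_def)
      ultimately show False using E(2)[of "insert e E"] by auto
    qed
  qed simp
  then have "orthonormal_basis E"
    using E(1) unfolding orthonormal_basis_def orthonormal_def by (rule conjI[rotated])
  then show ?thesis by (rule exI)
qed

text \<open>Bessel's inequality, stated for a bounded functional instead of the vector that represents
  it. The functional is tested with the combination of the vectors whose coefficients are the
  conjugates of its values.\<close>

lemma bessel_functional:
  assumes F: "finite F" "orthonormal F"
    and l: "\<And>f g. l (f + g) = l f + l g" "\<And>c f. l (c *\<^sub>C f) = c * l f"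
      "\<And>f. cmod (l f) \<le> K * norm f"
  shows "(\<Sum>e\<in>F. (cmod (l e))\<^sup>2) \<le> K\<^sup>2"
proof -
  define x where "x = (\<Sum>e\<in>F. cnj (l e) *\<^sub>C e)"
  define s where "s = (\<Sum>e\<in>F. (cmod (l e))\<^sup>2)"
  have "s \<ge> 0" by (simp add: s_def sum_nonneg)
  have l0: "l 0 = 0" using l(2)[of 0 0] by simp
  have ls: "l (\<Sum>e\<in>F'. h e) = (\<Sum>e\<in>F'. l (h e))" for h and F' :: "l2 set"
    by (induction F' rule: infinite_finite_induct) (simp_all add: l0 l(1))
  have lx: "l x = of_real s"
    by (simp add: x_def s_def ls l(2) cnj_times_self del: of_real_power)
  have "cinner x x = (\<Sum>e\<in>F. cnj (l e) * (\<Sum>e'\<in>F. l e' * cinner e' e))"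
    by (simp add: x_def cinner_sum_left cinner_sum_right cinner_scale_left cinner_scale_right)
  also have "\<dots> = (\<Sum>e\<in>F. cnj (l e) * (\<Sum>e'\<in>F. if e' = e then l e' else 0))"
    using F(2) by (intro sum.cong arg_cong2[of _ _ _ _ "(*)"] refl) (auto simp: orthonormal_def)
  also have "\<dots> = (\<Sum>e\<in>F. of_real ((cmod (l e))\<^sup>2))"
    using F(1) by (intro sum.cong) (simp_all add: cnj_times_self[symmetric] mult.commute del: of_real_power)
  also have "\<dots> = of_real s" by (simp add: s_def)
  finally have "of_real ((norm x)\<^sup>2) = (of_real s :: complex)" by (simp only: cinner_self)
  then have nx: "(norm x)\<^sup>2 = s" by (simp only: of_real_eq_iff)
  have "s \<le> K * norm x" using l(3)[of x] \<open>s \<ge> 0\<close> by (simp add: lx)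
  then have "s\<^sup>2 \<le> (K * norm x)\<^sup>2" using \<open>s \<ge> 0\<close> by (rule power_mono)
  then have "s * s \<le> K\<^sup>2 * s" by (simp add: power_mult_distrib nx power2_eq_square[of s])
  then show ?thesis
    using \<open>s \<ge> 0\<close> by (cases "s = 0") (auto simp: s_def[symmetric])
qed

text \<open>A bound that is uniform in the finite orthonormal families gives summability over
  every basis.\<close>

lemma hilbert_schmidtI:
  assumes "bounded_clinear B"
    and "\<And>F. finite F \<Longrightarrow> orthonormal F \<Longrightarrow> (\<Sum>e\<in>F. (norm (B e))\<^sup>2) \<le> K"
  shows "hilbert_schmidt B"
proof -
  obtain E where E: "orthonormal_basis E" using exists_orthonormal_basis by auto
  have "(\<lambda>e. (norm (B e))\<^sup>2) summable_on E"
  proof (rule nonneg_bdd_above_summable_on)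
    show "bdd_above (sum (\<lambda>e. (norm (B e))\<^sup>2) ` {F. F \<subseteq> E \<and> finite F})"
    proof (rule bdd_aboveI2)
      fix F assume "F \<in> {F. F \<subseteq> E \<and> finite F}"
      then show "(\<Sum>e\<in>F. (norm (B e))\<^sup>2) \<le> K"
        using E unfolding orthonormal_basis_def
        by (intro assms(2)) (simp_all add: orthonormal_def subset_iff)
    qed
  qed simp
  with E assms(1) show ?thesis by (auto simp: hilbert_schmidt_def)
qed

section \<open>Schwartz functions and their multipliers\<close>

lemma nth_deriv_0 [simp]: "nth_deriv 0 \<phi> = \<phi>"
  by (simp add: nth_deriv_def)

lemma nth_deriv_Suc: "nth_deriv (Suc n) \<phi> = (\<lambda>x. vector_derivative (nth_deriv n \<phi>) (at x))"
  by (simp add: nth_deriv_def)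

lemma nth_deriv_Suc': "nth_deriv (Suc n) \<phi> = nth_deriv n (\<lambda>x. vector_derivative \<phi> (at x))"
  by (induction n) (simp_all add: nth_deriv_Suc)

lemma has_vector_derivative_unique_fun:
  "(\<And>x. (f has_vector_derivative f' x) (at x)) \<Longrightarrow> (\<lambda>x. vector_derivative f (at x)) = f'"
  by (auto simp: vector_derivative_at)

definition poly_growth :: "(real \<Rightarrow> complex) \<Rightarrow> bool" where
  "poly_growth f \<longleftrightarrow> (\<exists>C N. \<forall>x. cmod (f x) \<le> C * (1 + \<bar>x\<bar>) ^ N)"

definition rapid_decay :: "(real \<Rightarrow> complex) \<Rightarrow> bool" where
  "rapid_decay f \<longleftrightarrow> (\<forall>m. \<exists>C. \<forall>x. (1 + \<bar>x\<bar>) ^ m * cmod (f x) \<le> C)"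

text \<open>The smooth functions of polynomial growth together with all their derivatives; they
  are the multipliers of the Schwartz space.\<close>

definition moderate :: "(real \<Rightarrow> complex) set" where
  "moderate = {f. \<forall>n. (\<forall>x. nth_deriv n f differentiable (at x)) \<and> poly_growth (nth_deriv n f)}"

lemma one_plus_abs_power_le: "(1 + \<bar>x\<bar>) ^ m \<le> 2 ^ m * (1 + \<bar>x::real\<bar> ^ m)"
proof -
  have "(1 + \<bar>x\<bar>) ^ m \<le> (2 * max 1 \<bar>x\<bar>) ^ m"
    by (rule power_mono) auto
  also have "\<dots> = 2 ^ m * max 1 \<bar>x\<bar> ^ m" by (simp add: power_mult_distrib)
  also have "max 1 \<bar>x\<bar> ^ m \<le> 1 + \<bar>x\<bar> ^ m" by (auto simp: max_def)
  finally show ?thesis by simp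
qed

lemma rapid_decay_iff:
  "rapid_decay f \<longleftrightarrow> (\<forall>m. bounded (range (\<lambda>x. of_real (x ^ m) * f x)))"
proof
  assume f: "rapid_decay f"
  show "\<forall>m. bounded (range (\<lambda>x. of_real (x ^ m) * f x))"
  proof
    fix m
    obtain C where C: "\<And>x. (1 + \<bar>x\<bar>) ^ m * cmod (f x) \<le> C"
      using f unfolding rapid_decay_def by blast
    have "cmod (of_real (x ^ m) * f x) \<le> C" for x
    proof -
      have "\<bar>x\<bar> ^ m * cmod (f x) \<le> (1 + \<bar>x\<bar>) ^ m * cmod (f x)"
        by (intro mult_right_mono power_mono) auto
      then show ?thesis using C[of x] by (simp add: norm_mult power_abs norm_power)
    qed
    then show "bounded (range (\<lambda>x. of_real (x ^ m) * f x))" by (intro boundedI) auto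
  qed
next
  assume *: "\<forall>m. bounded (range (\<lambda>x. of_real (x ^ m) * f x))"
  show "rapid_decay f"
    unfolding rapid_decay_def
  proof
    fix m
    have "\<exists>B. \<forall>x. cmod (of_real (x ^ m) * f x) \<le> B" for m
      using *[rule_format, of m] by (auto simp: bounded_iff)
    then obtain B where B: "\<And>m x. cmod (of_real (x ^ m) * f x) \<le> B m" by metis
    have "(1 + \<bar>x\<bar>) ^ m * cmod (f x) \<le> 2 ^ m * (B 0 + B m)" for x
    proof -
      have "(1 + \<bar>x\<bar>) ^ m * cmod (f x) \<le> 2 ^ m * (1 + \<bar>x\<bar> ^ m) * cmod (f x)"
        by (intro mult_right_mono one_plus_abs_power_le) auto
      also have "\<dots> = 2 ^ m * (cmod (f x) + \<bar>x\<bar> ^ m * cmod (f x))"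
        by (simp add: algebra_simps)
      also have "\<dots> \<le> 2 ^ m * (B 0 + B m)"
        using B[where x = x and m = 0] B[where x = x and m = m]
        by (intro mult_left_mono add_mono) (auto simp: norm_mult norm_power)
      finally show ?thesis .
    qed
    then show "\<exists>C. \<forall>x. (1 + \<bar>x\<bar>) ^ m * cmod (f x) \<le> C" by blast
  qed
qed

lemma schwartz_altdef:
  "schwartz = {\<phi>. \<forall>n. (\<forall>x. nth_deriv n \<phi> differentiable (at x)) \<and> rapid_decay (nth_deriv n \<phi>)}"
  by (simp add: schwartz_def rapid_decay_iff)

text \<open>To see that a function is a Schwartz function it suffices to exhibit a set of
  rapidly decaying functions that contains it and is closed under differentiation, since the
  derivatives of all orders stay in that set.\<close>

lemma schwartz_coinduct:
  assumes "\<phi> \<in> S" "\<And>f. f \<in> S \<Longrightarrow> rapid_decay f"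
    "\<And>f. f \<in> S \<Longrightarrow> \<exists>f'\<in>S. \<forall>x. (f has_vector_derivative f' x) (at x)"
  shows "\<phi> \<in> schwartz"
proof -
  have "nth_deriv n \<phi> \<in> S" for n
  proof (induction n)
    case (Suc n)
    then obtain f' where "f' \<in> S" "\<forall>x. (nth_deriv n \<phi> has_vector_derivative f' x) (at x)"
      using assms(3) by blast
    then show ?case using has_vector_derivative_unique_fun[of "nth_deriv n \<phi>" f']
      by (simp add: nth_deriv_Suc)
  qed (simp add: assms(1))
  then show ?thesis
    unfolding schwartz_altdef using assms(2,3) differentiableI_vector by blast
qed

lemma moderate_coinduct:
  assumes "\<phi> \<in> S" "\<And>f. f \<in> S \<Longrightarrow> poly_growth f"
    "\<And>f. f \<in> S \<Longrightarrow> \<exists>f'\<in>S. \<forall>x. (f has_vector_derivative f' x) (at x)"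
  shows "\<phi> \<in> moderate"
proof -
  have "nth_deriv n \<phi> \<in> S" for n
  proof (induction n)
    case (Suc n)
    then obtain f' where "f' \<in> S" "\<forall>x. (nth_deriv n \<phi> has_vector_derivative f' x) (at x)"
      using assms(3) by blast
    then show ?case using has_vector_derivative_unique_fun[of "nth_deriv n \<phi>" f']
      by (simp add: nth_deriv_Suc)
  qed (simp add: assms(1))
  then show ?thesis
    unfolding moderate_def using assms(2,3) differentiableI_vector by blast
qed

lemma schwartz_deriv: "\<phi> \<in> schwartz \<Longrightarrow> (\<lambda>x. vector_derivative \<phi> (at x)) \<in> schwartz"
  unfolding schwartz_altdef mem_Collect_eq nth_deriv_Suc'[symmetric] by blast

lemma schwartz_has_derivative:
  "\<phi> \<in> schwartz \<Longrightarrow> (\<phi> has_vector_derivative vector_derivative \<phi> (at x)) (at x)"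
  unfolding schwartz_altdef mem_Collect_eq vector_derivative_works[symmetric]
  by (drule spec[of _ 0]) simp

lemma schwartz_rapid_decay: "\<phi> \<in> schwartz \<Longrightarrow> rapid_decay \<phi>"
  unfolding schwartz_altdef mem_Collect_eq by (drule spec[of _ 0]) simp

lemma moderate_deriv: "\<phi> \<in> moderate \<Longrightarrow> (\<lambda>x. vector_derivative \<phi> (at x)) \<in> moderate"
  unfolding moderate_def mem_Collect_eq nth_deriv_Suc'[symmetric] by blast

lemma moderate_has_derivative:
  "\<phi> \<in> moderate \<Longrightarrow> (\<phi> has_vector_derivative vector_derivative \<phi> (at x)) (at x)"
  unfolding moderate_def mem_Collect_eq vector_derivative_works[symmetric]
  by (drule spec[of _ 0]) simp

lemma moderate_poly_growth: "\<phi> \<in> moderate \<Longrightarrow> poly_growth \<phi>"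
  unfolding moderate_def mem_Collect_eq by (drule spec[of _ 0]) simp

lemma schwartz_continuous: "\<phi> \<in> schwartz \<Longrightarrow> continuous_on A \<phi>"
  by (meson continuous_at_imp_continuous_on has_vector_derivative_continuous schwartz_has_derivative)

lemma schwartz_measurable: "\<phi> \<in> schwartz \<Longrightarrow> \<phi> \<in> borel_measurable borel"
  by (simp add: borel_measurable_continuous_onI schwartz_continuous)

lemma moderate_measurable: "\<phi> \<in> moderate \<Longrightarrow> \<phi> \<in> borel_measurable borel"
  by (meson borel_measurable_continuous_onI continuous_at_imp_continuous_on
      has_vector_derivative_continuous moderate_has_derivative)

lemma rapid_decay_add:
  assumes "rapid_decay f" "rapid_decay g"
  shows "rapid_decay (\<lambda>x. f x + g x)"
  unfolding rapid_decay_def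
proof
  fix m
  obtain C D where *: "\<And>x. (1 + \<bar>x\<bar>) ^ m * cmod (f x) \<le> C" "\<And>x. (1 + \<bar>x\<bar>) ^ m * cmod (g x) \<le> D"
    using assms unfolding rapid_decay_def by meson
  have "(1 + \<bar>x\<bar>) ^ m * cmod (f x + g x) \<le> C + D" for x
  proof -
    have "(1 + \<bar>x\<bar>) ^ m * cmod (f x + g x) \<le> (1 + \<bar>x\<bar>) ^ m * (cmod (f x) + cmod (g x))"
      by (intro mult_left_mono norm_triangle_ineq) auto
    then show ?thesis using *[of x] by (simp add: distrib_left)
  qed
  then show "\<exists>C. \<forall>x. (1 + \<bar>x\<bar>) ^ m * cmod (f x + g x) \<le> C" by blast
qed

lemma rapid_decay_mult_poly_growth:
  assumes "poly_growth a" "rapid_decay f"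
  shows "rapid_decay (\<lambda>x. a x * f x)"
  unfolding rapid_decay_def
proof
  fix m
  obtain C N where a: "\<And>x. cmod (a x) \<le> C * (1 + \<bar>x\<bar>) ^ N"
    using assms(1) unfolding poly_growth_def by blast
  obtain D where f: "\<And>x. (1 + \<bar>x\<bar>) ^ (m + N) * cmod (f x) \<le> D"
    using assms(2) unfolding rapid_decay_def by meson
  have "C \<ge> 0" using order_trans[OF norm_ge_zero a[of 0]] by simp
  have "(1 + \<bar>x\<bar>) ^ m * cmod (a x * f x) \<le> C * D" for x
  proof -
    have "(1 + \<bar>x\<bar>) ^ m * cmod (a x * f x) \<le> (1 + \<bar>x\<bar>) ^ m * ((C * (1 + \<bar>x\<bar>) ^ N) * cmod (f x))"
      unfolding norm_mult by (intro mult_left_mono mult_right_mono a) auto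
    also have "\<dots> = C * ((1 + \<bar>x\<bar>) ^ (m + N) * cmod (f x))"
      by (simp add: power_add mult_ac)
    also have "\<dots> \<le> C * D"
      by (intro mult_left_mono f \<open>C \<ge> 0\<close>)
    finally show ?thesis .
  qed
  then show "\<exists>C. \<forall>x. (1 + \<bar>x\<bar>) ^ m * cmod (a x * f x) \<le> C" by blast
qed

lemma poly_growth_mult:
  assumes "poly_growth f" "poly_growth g"
  shows "poly_growth (\<lambda>x. f x * g x)"
proof -
  obtain C N where f: "\<And>x. cmod (f x) \<le> C * (1 + \<bar>x\<bar>) ^ N"
    using assms(1) unfolding poly_growth_def by blast
  obtain D M where g: "\<And>x. cmod (g x) \<le> D * (1 + \<bar>x\<bar>) ^ M"
    using assms(2) unfolding poly_growth_def by blast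
  have "cmod (f x * g x) \<le> C * D * (1 + \<bar>x\<bar>) ^ (N + M)" for x
    using mult_mono[OF f[of x] g[of x]] order_trans[OF norm_ge_zero f[of x]]
    by (simp add: norm_mult power_add mult_ac)
  then show ?thesis unfolding poly_growth_def by blast
qed

lemma poly_growth_add:
  assumes "poly_growth f" "poly_growth g"
  shows "poly_growth (\<lambda>x. f x + g x)"
proof -
  obtain C N where f: "\<And>x. cmod (f x) \<le> C * (1 + \<bar>x\<bar>) ^ N"
    using assms(1) unfolding poly_growth_def by blast
  obtain D M where g: "\<And>x. cmod (g x) \<le> D * (1 + \<bar>x\<bar>) ^ M"
    using assms(2) unfolding poly_growth_def by blast
  have "C \<ge> 0" "D \<ge> 0"
    using order_trans[OF norm_ge_zero f[of 0]] order_trans[OF norm_ge_zero g[of 0]] by simp_all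
  have "cmod (f x + g x) \<le> (C + D) * (1 + \<bar>x\<bar>) ^ (N + M)" for x
  proof -
    have "C * (1 + \<bar>x\<bar>) ^ N \<le> C * (1 + \<bar>x\<bar>) ^ (N + M)" "D * (1 + \<bar>x\<bar>) ^ M \<le> D * (1 + \<bar>x\<bar>) ^ (N + M)"
      using \<open>C \<ge> 0\<close> \<open>D \<ge> 0\<close> by (auto intro!: mult_left_mono power_increasing)
    then show ?thesis
      using norm_triangle_ineq[of "f x" "g x"] f[of x] g[of x] by (simp add: distrib_right)
  qed
  then show ?thesis unfolding poly_growth_def by blast
qed

lemma poly_growth_bounded: "(\<And>x. cmod (f x) \<le> C) \<Longrightarrow> poly_growth f"
  unfolding poly_growth_def by (rule exI[of _ C], rule exI[of _ 0]) simp

lemma poly_growth_power: "poly_growth f \<Longrightarrow> poly_growth (\<lambda>x. f x ^ k)"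
  by (induction k) (auto intro: poly_growth_mult poly_growth_bounded[of _ 1])

lemma poly_growth_id: "poly_growth (\<lambda>x. of_real x)"
  unfolding poly_growth_def by (rule exI[of _ 1], rule exI[of _ 1]) auto

lemma poly_growth_poly: "poly_growth f \<Longrightarrow> poly_growth (\<lambda>x. poly p (f x))"
  by (induction p) (auto intro!: poly_growth_add poly_growth_mult intro: poly_growth_bounded[OF order_refl])

text \<open>By the product rule the derivative of a product of a multiplier and a Schwartz function is a
  sum of two such products. Hence the coinduction rule applies to the set of
  such sums.\<close>

inductive_set multiplier_sums :: "(real \<Rightarrow> complex) set" where
  product: "f \<in> schwartz \<Longrightarrow> a \<in> moderate \<Longrightarrow> (\<lambda>x. a x * f x) \<in> multiplier_sums"
| add: "f \<in> multiplier_sums \<Longrightarrow> g \<in> multiplier_sums \<Longrightarrow> (\<lambda>x. f x + g x) \<in> multiplier_sums"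

lemma schwartz_mult_moderate:
  assumes "a \<in> moderate" "\<phi> \<in> schwartz"
  shows "(\<lambda>x. a x * \<phi> x) \<in> schwartz"
proof (rule schwartz_coinduct[of _ multiplier_sums])
  show "(\<lambda>x. a x * \<phi> x) \<in> multiplier_sums" using assms by (rule multiplier_sums.product[rotated])
  show "rapid_decay f" if "f \<in> multiplier_sums" for f
    using that by induction (auto intro: rapid_decay_add rapid_decay_mult_poly_growth
        schwartz_rapid_decay moderate_poly_growth)
  show "\<exists>f'\<in>multiplier_sums. \<forall>x. (f has_vector_derivative f' x) (at x)" if "f \<in> multiplier_sums" for f
    using that
  proof induction
    case (product f a)
    have "((\<lambda>x. a x * f x) has_vector_derivative
        (a x * vector_derivative f (at x) + vector_derivative a (at x) * f x)) (at x)" for x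
      using product by (intro has_vector_derivative_mult moderate_has_derivative schwartz_has_derivative)
    moreover have "(\<lambda>x. a x * vector_derivative f (at x) + vector_derivative a (at x) * f x) \<in> multiplier_sums"
      by (rule multiplier_sums.add; rule multiplier_sums.product)
        (use product in \<open>simp_all add: schwartz_deriv moderate_deriv\<close>)
    ultimately show ?case
      by (intro bexI[of _ "\<lambda>x. a x * vector_derivative f (at x) + vector_derivative a (at x) * f x"] allI)
  next
    case (add f g)
    then obtain f' g' where d: "f' \<in> multiplier_sums" "g' \<in> multiplier_sums"
      "\<And>x. (f has_vector_derivative f' x) (at x)" "\<And>x. (g has_vector_derivative g' x) (at x)"
      by blast
    have "((\<lambda>x. f x + g x) has_vector_derivative f' x + g' x) (at x)" for x
      by (intro has_vector_derivative_add d)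
    then show ?case
      by (intro bexI[OF _ multiplier_sums.add[OF d(1,2)]] allI)
  qed
qed

lemma schwartz_add:
  assumes "\<phi> \<in> schwartz" "\<psi> \<in> schwartz"
  shows "(\<lambda>x. \<phi> x + \<psi> x) \<in> schwartz"
proof -
  define S where "S = (\<lambda>(\<phi>, \<psi>) x. \<phi> x + \<psi> x :: complex) ` (schwartz \<times> schwartz)"
  have S: "(\<lambda>x. \<phi> x + \<psi> x) \<in> S" if "\<phi> \<in> schwartz" "\<psi> \<in> schwartz" for \<phi> \<psi>
    unfolding S_def by (rule image_eqI[of _ _ "(\<phi>, \<psi>)"]) (use that in simp_all)
  show ?thesis
  proof (rule schwartz_coinduct[of _ S])
    fix f assume "f \<in> S"
    then obtain \<phi> \<psi> where f: "f = (\<lambda>x. \<phi> x + \<psi> x)" "\<phi> \<in> schwartz" "\<psi> \<in> schwartz"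
      by (auto simp: S_def)
    then show "rapid_decay f" by (simp add: rapid_decay_add schwartz_rapid_decay)
    show "\<exists>f'\<in>S. \<forall>x. (f has_vector_derivative f' x) (at x)"
      using f by (intro bexI[OF _ S[OF schwartz_deriv[OF f(2)] schwartz_deriv[OF f(3)]]])
        (auto intro!: has_vector_derivative_add schwartz_has_derivative)
  qed (use assms in \<open>rule S\<close>)
qed

lemma schwartz_cnj:
  assumes "\<phi> \<in> schwartz"
  shows "(\<lambda>x. cnj (\<phi> x)) \<in> schwartz"
proof (rule schwartz_coinduct[of _ "(\<lambda>\<phi> x. cnj (\<phi> x)) ` schwartz"])
  show "(\<lambda>x. cnj (\<phi> x)) \<in> (\<lambda>\<phi> x. cnj (\<phi> x)) ` schwartz"
    by (rule imageI[OF assms])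
  fix f :: "real \<Rightarrow> complex" assume "f \<in> (\<lambda>\<phi> x. cnj (\<phi> x)) ` schwartz"
  then obtain \<phi> where f: "f = (\<lambda>x. cnj (\<phi> x))" "\<phi> \<in> schwartz" by auto
  then show "rapid_decay f" using schwartz_rapid_decay by (simp add: rapid_decay_def)
  show "\<exists>f'\<in>(\<lambda>\<phi> x. cnj (\<phi> x)) ` schwartz. \<forall>x. (f has_vector_derivative f' x) (at x)"
    by (rule bexI[OF _ imageI[OF schwartz_deriv[OF f(2)]]])
      (use f in \<open>auto intro!: has_vector_derivative_cnj schwartz_has_derivative\<close>)
qed

lemma schwartz_reflect:
  assumes "\<phi> \<in> schwartz"
  shows "(\<lambda>x. \<phi> (- x)) \<in> schwartz"
proof -
  define S where "S = (\<lambda>(c, \<phi>) x. c * \<phi> (- x) :: complex) ` (UNIV \<times> schwartz)"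
  have S: "(\<lambda>x. c * \<phi> (- x)) \<in> S" if "\<phi> \<in> schwartz" for c and \<phi> :: "real \<Rightarrow> complex"
    unfolding S_def by (rule image_eqI[of _ _ "(c, \<phi>)"]) (use that in simp_all)
  show ?thesis
  proof (rule schwartz_coinduct[of _ S])
    show "(\<lambda>x. \<phi> (- x)) \<in> S"
      using S[OF assms, of 1] by simp
    fix f assume "f \<in> S"
    then obtain c \<phi> where f: "f = (\<lambda>x. c * \<phi> (- x))" "\<phi> \<in> schwartz" by (auto simp: S_def)
    have "rapid_decay (\<lambda>x. \<phi> (- x))"
      using schwartz_rapid_decay[OF f(2)] unfolding rapid_decay_def by (metis abs_minus_cancel)
    then show "rapid_decay f" unfolding f
      by (intro rapid_decay_mult_poly_growth poly_growth_bounded[OF order_refl])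
    have "(f has_vector_derivative (- c) * vector_derivative \<phi> (at (- x))) (at x)" for x
    proof -
      have "((\<lambda>x. \<phi> (- x)) has_vector_derivative (-1) *\<^sub>R vector_derivative \<phi> (at (- x))) (at x)"
        using vector_diff_chain_at[OF has_vector_derivative_minus[OF has_vector_derivative_id]
            schwartz_has_derivative[OF f(2)], of x]
        by (simp add: o_def)
      from has_vector_derivative_mult_right[OF this, of c] show ?thesis by (simp add: f(1))
    qed
    then show "\<exists>f'\<in>S. \<forall>x. (f has_vector_derivative f' x) (at x)"
      by (intro bexI[OF _ S[OF schwartz_deriv[OF f(2)]]] allI)
  qed
qed

lemma schwartz_moderate: "\<phi> \<in> schwartz \<Longrightarrow> \<phi> \<in> moderate"
proof (erule moderate_coinduct)
  fix f assume f: "f \<in> schwartz"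
  show "poly_growth f"
  proof -
    obtain C where "\<And>x. (1 + \<bar>x\<bar>) ^ 0 * cmod (f x) \<le> C"
      using schwartz_rapid_decay[OF f] unfolding rapid_decay_def by blast
    then show ?thesis by (intro poly_growth_bounded[of _ C]) simp
  qed
  show "\<exists>f'\<in>schwartz. \<forall>x. (f has_vector_derivative f' x) (at x)"
    by (intro bexI[OF _ schwartz_deriv[OF f]] allI schwartz_has_derivative f)
qed

lemma schwartz_mult: "\<phi> \<in> schwartz \<Longrightarrow> \<psi> \<in> schwartz \<Longrightarrow> (\<lambda>x. \<phi> x * \<psi> x) \<in> schwartz"
  by (rule schwartz_mult_moderate[OF schwartz_moderate])

lemma has_vector_derivative_poly_of:
  fixes f :: "real \<Rightarrow> complex"
  assumes "(f has_vector_derivative f') (at x)"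
  shows "((\<lambda>x. poly p (f x)) has_vector_derivative poly (pderiv p) (f x) * f') (at x)"
  using field_vector_diff_chain_at[OF assms poly_DERIV] by (simp add: o_def mult.commute)

lemma moderate_poly: "(\<lambda>x. poly p (of_real x)) \<in> moderate"
proof (rule moderate_coinduct[of _ "range (\<lambda>p x. poly p (of_real x))"])
  fix f :: "real \<Rightarrow> complex" assume "f \<in> range (\<lambda>p x. poly p (of_real x))"
  then obtain p where f: "f = (\<lambda>x. poly p (of_real x))" by auto
  show "poly_growth f" unfolding f by (intro poly_growth_poly poly_growth_id)
  have "(f has_vector_derivative poly (pderiv p) (of_real x)) (at x)" for x
    unfolding f by (rule has_vector_derivative_real_field[OF poly_DERIV])
  then show "\<exists>f'\<in>range (\<lambda>p x. poly p (of_real x)). \<forall>x. (f has_vector_derivative f' x) (at x)"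
    by (intro bexI[OF _ rangeI] allI)
qed auto

lemma moderate_const: "(\<lambda>_. c) \<in> moderate"
  using moderate_poly[of "[:c:]"] by simp

lemma moderate_of_real: "(\<lambda>x. of_real x) \<in> moderate"
  using moderate_poly[of "[:0, 1:]"] by simp

lemma schwartz_scale: "\<phi> \<in> schwartz \<Longrightarrow> (\<lambda>x. c * \<phi> x) \<in> schwartz"
  by (rule schwartz_mult_moderate[OF moderate_const])

lemma moderate_exp: "(\<lambda>x. exp (- \<i> * of_real (\<xi> * x))) \<in> moderate"
proof (rule moderate_coinduct[of _ "range (\<lambda>c x. c * exp (- \<i> * of_real (\<xi> * x)))"])
  show "(\<lambda>x. exp (- \<i> * of_real (\<xi> * x))) \<in> range (\<lambda>c x. c * exp (- \<i> * of_real (\<xi> * x)))"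
    by (rule range_eqI[of _ _ 1]) simp
  fix f :: "real \<Rightarrow> complex" assume "f \<in> range (\<lambda>c x. c * exp (- \<i> * of_real (\<xi> * x)))"
  then obtain c where f: "f = (\<lambda>x. c * exp (- \<i> * of_real (\<xi> * x)))" by auto
  show "poly_growth f" unfolding f by (rule poly_growth_bounded[of _ "cmod c"]) (simp add: norm_mult)
  have "(f has_vector_derivative (c * (- \<i> * of_real \<xi>)) * exp (- \<i> * of_real (\<xi> * x))) (at x)" for x
  proof -
    have "((\<lambda>w. c * exp (- \<i> * (of_real \<xi> * w))) has_field_derivative
        (c * (- \<i> * of_real \<xi>)) * exp (- \<i> * (of_real \<xi> * of_real x))) (at (of_real x))"
      by (rule derivative_eq_intros refl | simp)+
    from has_vector_derivative_real_field[OF this] show ?thesis by (simp add: f)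
  qed
  then show "\<exists>f'\<in>range (\<lambda>c x. c * exp (- \<i> * of_real (\<xi> * x))). \<forall>x. (f has_vector_derivative f' x) (at x)"
    by (intro bexI[OF _ rangeI] allI)
qed

text \<open>Since \<open>tanh' = 1 - tanh\<^sup>2\<close>, all derivatives are polynomials in \<open>tanh\<close>. These functions will serve
  as smooth approximations of step functions.\<close>

lemma moderate_tanh: "(\<lambda>x. of_real (tanh (c * (x - a)))) \<in> moderate"
proof (rule moderate_coinduct[of _ "range (\<lambda>p x. poly p (of_real (tanh (c * (x - a)))))"])
  show "(\<lambda>x. of_real (tanh (c * (x - a)))) \<in> range (\<lambda>p x. poly p (of_real (tanh (c * (x - a)))))"
    by (rule range_eqI[of _ _ "[:0, 1:]"]) simp
  fix f :: "real \<Rightarrow> complex" assume "f \<in> range (\<lambda>p x. poly p (of_real (tanh (c * (x - a)))))"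
  then obtain p where f: "f = (\<lambda>x. poly p (of_real (tanh (c * (x - a)))))" by auto
  show "poly_growth f"
    unfolding f
  proof (intro poly_growth_poly poly_growth_bounded)
    show "cmod (of_real (tanh (c * (x - a)))) \<le> 1" for x
      using tanh_real_bounds[of "c * (x - a)"] by (simp add: abs_le_iff)
  qed
  have d: "((\<lambda>x. of_real (tanh (c * (x - a)))) has_vector_derivative
      (of_real (c * (1 - (tanh (c * (x - a)))\<^sup>2)) :: complex)) (at x)" for x
    by (rule has_vector_derivative_of_real)
      (rule derivative_eq_intros refl | simp)+
  have "(f has_vector_derivative poly (pderiv p * [:of_real c, 0, - of_real c:]) (of_real (tanh (c * (x - a))))) (at x)" for x
    using has_vector_derivative_poly_of[OF d, of p x] by (simp add: f algebra_simps power2_eq_square)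
  then show "\<exists>f'\<in>range (\<lambda>p x. poly p (of_real (tanh (c * (x - a))))). \<forall>x. (f has_vector_derivative f' x) (at x)"
    by (intro bexI[OF _ rangeI] allI)
qed

section \<open>The Gaussian and the symbols of the resolvents\<close>

lemma power_le_fact_exp: "0 \<le> y \<Longrightarrow> y ^ m \<le> fact m * exp (y::real)"
proof -
  assume y: "0 \<le> y"
  have "(\<Sum>n\<in>{m}. y ^ n /\<^sub>R fact n) \<le> (\<Sum>n. y ^ n /\<^sub>R fact n)"
    by (rule sum_le_suminf[OF summable_exp_generic]) (use y in auto)
  then show ?thesis
    by (simp add: exp_def field_simps)
qed

lemma rapid_decay_gaussian: "rapid_decay (\<lambda>x. of_real (exp (- (x\<^sup>2) / 2)))"
  unfolding rapid_decay_def
proof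
  fix m
  have "(1 + \<bar>x\<bar>) ^ m * cmod (of_real (exp (- (x\<^sup>2) / 2))) \<le> 2 ^ m * (2 + 2 ^ m * fact m)" for x :: real
  proof -
    have "\<bar>x\<bar> ^ m \<le> 1 + (x\<^sup>2) ^ m"
    proof (cases "\<bar>x\<bar> ^ m \<le> 1")
      case True
      then show ?thesis using zero_le_power[OF zero_le_power2, of x m] by linarith
    next
      case False
      then have "1 * \<bar>x\<bar> ^ m \<le> \<bar>x\<bar> ^ m * \<bar>x\<bar> ^ m" by (intro mult_right_mono) auto
      also have "\<dots> = (x\<^sup>2) ^ m" by (simp add: power_mult_distrib[symmetric] power2_eq_square)
      finally show ?thesis by simp
    qed
    also have "(x\<^sup>2) ^ m = 2 ^ m * (x\<^sup>2 / 2) ^ m"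
      by (simp add: power_mult_distrib[symmetric])
    also have "(x\<^sup>2 / 2) ^ m \<le> fact m * exp (x\<^sup>2 / 2)" by (rule power_le_fact_exp) simp
    finally have 1: "\<bar>x\<bar> ^ m \<le> 1 + 2 ^ m * (fact m * exp (x\<^sup>2 / 2))" by simp
    have "(1 + \<bar>x\<bar>) ^ m \<le> 2 ^ m * (1 + \<bar>x\<bar> ^ m)" by (rule one_plus_abs_power_le)
    also have "\<dots> \<le> 2 ^ m * (2 + 2 ^ m * (fact m * exp (x\<^sup>2 / 2)))"
      using 1 by (intro mult_left_mono) auto
    also have "\<dots> \<le> 2 ^ m * ((2 + 2 ^ m * fact m) * exp (x\<^sup>2 / 2))"
    proof -
      have "1 \<le> exp (x\<^sup>2 / 2)" by simp
      then show ?thesis by (intro mult_left_mono) (auto simp: distrib_right mult.assoc)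
    qed
    finally have "(1 + \<bar>x\<bar>) ^ m * exp (- (x\<^sup>2) / 2)
        \<le> 2 ^ m * ((2 + 2 ^ m * fact m) * exp (x\<^sup>2 / 2)) * exp (- (x\<^sup>2) / 2)"
      by (rule mult_right_mono) simp
    also have "\<dots> = 2 ^ m * (2 + 2 ^ m * fact m)"
      by (simp add: mult.assoc exp_add[symmetric])
    finally show ?thesis by simp
  qed
  then show "\<exists>C. \<forall>x. (1 + \<bar>x\<bar>) ^ m * cmod (of_real (exp (- (x\<^sup>2) / 2))) \<le> C" by blast
qed

lemma schwartz_gaussian: "(\<lambda>x. of_real (exp (- (x\<^sup>2) / 2))) \<in> schwartz"
proof (rule schwartz_coinduct[of _ "range (\<lambda>p x. poly p (of_real x) * of_real (exp (- (x\<^sup>2) / 2)))"])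
  show "(\<lambda>x. of_real (exp (- (x\<^sup>2) / 2)) :: complex) \<in> range (\<lambda>p x. poly p (of_real x) * of_real (exp (- (x\<^sup>2) / 2)))"
    by (rule range_eqI[of _ _ 1]) simp
  fix f :: "real \<Rightarrow> complex"
  assume "f \<in> range (\<lambda>p x. poly p (of_real x) * of_real (exp (- (x\<^sup>2) / 2)))"
  then obtain p where f: "f = (\<lambda>x. poly p (of_real x) * of_real (exp (- (x\<^sup>2) / 2)))" by auto
  show "rapid_decay f"
    unfolding f by (intro rapid_decay_mult_poly_growth rapid_decay_gaussian poly_growth_poly poly_growth_id)
  have "(f has_vector_derivative
      poly (pderiv p - [:0, 1:] * p) (of_real x) * of_real (exp (- (x\<^sup>2) / 2))) (at x)" for x
  proof -
    have "((\<lambda>x. exp (- (x\<^sup>2) / 2)) has_real_derivative - x * exp (- (x\<^sup>2) / 2)) (at x)"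
      by (rule derivative_eq_intros refl | simp)+
    from has_vector_derivative_mult[OF has_vector_derivative_real_field[OF poly_DERIV]
        has_vector_derivative_of_real[OF this], of p]
    show ?thesis by (simp add: f algebra_simps)
  qed
  then show "\<exists>f'\<in>range (\<lambda>p x. poly p (of_real x) * of_real (exp (- (x\<^sup>2) / 2))).
      \<forall>x. (f has_vector_derivative f' x) (at x)"
    by (intro bexI[OF _ rangeI] allI)
qed

text \<open>For small \<open>x\<close> the distance of \<open>z\<close> from the half-axis, and for large \<open>x\<close> the growth of
  \<open>x\<^sup>2\<close>, bounds \<open>x\<^sup>2 - z\<close> away from zero.\<close>

lemma symbol_lower_bound:
  assumes "z \<notin> \<real>\<^sub>\<ge>\<^sub>0"
  obtains c where "c > 0" "\<And>x::real. c * (1 + x\<^sup>2) \<le> cmod (of_real (x\<^sup>2) - z)"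
proof -
  obtain d where d: "d > 0" "\<And>y. y \<in> \<real>\<^sub>\<ge>\<^sub>0 \<Longrightarrow> d \<le> dist z y"
    using separate_point_closed[OF closed_nonneg_Reals_complex assms] by auto
  define c where "c = min (1/2) (d / (2 * cmod z + 2))"
  have pos: "2 * cmod z + 2 > 0" using norm_ge_zero[of z] by linarith
  have "c > 0" using d(1) pos by (simp add: c_def)
  moreover have "c * (1 + x\<^sup>2) \<le> cmod (of_real (x\<^sup>2) - z)" for x :: real
  proof (cases "x\<^sup>2 \<ge> 2 * cmod z + 1")
    case True
    have "c \<le> 1/2" unfolding c_def by (rule min.cobounded1)
    then have "c * (1 + x\<^sup>2) \<le> (1/2) * (1 + x\<^sup>2)" by (rule mult_right_mono) simp
    also have "\<dots> \<le> x\<^sup>2 - cmod z" using True by simp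
    also have "\<dots> \<le> cmod (of_real (x\<^sup>2) - z)"
      using norm_triangle_ineq2[of "of_real (x\<^sup>2)" z] by (simp add: norm_power)
    finally show ?thesis .
  next
    case False
    have "c * (1 + x\<^sup>2) \<le> d / (2 * cmod z + 2) * (2 * cmod z + 2)"
      using False d(1) pos by (intro mult_mono) (auto simp: c_def)
    also have "\<dots> = d" using pos by simp
    also have "\<dots> \<le> cmod (of_real (x\<^sup>2) - z)"
      using d(2)[of "of_real (x\<^sup>2)"] by (simp add: dist_norm norm_minus_commute del: of_real_power)
    finally show ?thesis .
  qed
  ultimately show ?thesis using that by blast
qed

lemma symbol_nonzero: "z \<notin> \<real>\<^sub>\<ge>\<^sub>0 \<Longrightarrow> of_real (x\<^sup>2) - z \<noteq> 0"
  by (metis eq_iff_diff_eq_0 nonneg_Reals_of_real_iff zero_le_power2)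

text \<open>Powers of \<open>x\<^sup>2 - z\<close>, fractional or conjugated, satisfy a differential equation of this
  form, so both the square roots of the resolvents and the Sobolev weights (\<open>z = -1\<close>) are
  covered. With \<open>r = 1 / (x\<^sup>2 - z)\<close> the functions \<open>p r\<^sup>k u\<close>, \<open>p\<close> a polynomial, are closed under
  differentiation.\<close>

lemma moderate_symbol_power:
  fixes u :: "real \<Rightarrow> complex"
  assumes z: "z \<notin> \<real>\<^sub>\<ge>\<^sub>0" and u: "poly_growth u"
    and du: "\<And>x. (u has_vector_derivative c * of_real x * inverse (of_real (x\<^sup>2) - z) * u x) (at x)"
  shows "u \<in> moderate"
proof -
  define r where "r x = inverse (of_real (x\<^sup>2) - z)" for x :: real
  define S where "S = (\<lambda>(p, k) x. poly p (of_real x) * r x ^ k * u x) ` (UNIV :: (complex poly \<times> nat) set)"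
  have S: "(\<lambda>x. poly p (of_real x) * r x ^ k * u x) \<in> S" for p k
    unfolding S_def by (rule image_eqI[of _ _ "(p, k)"]) simp_all
  have rg: "poly_growth r"
  proof -
    obtain d where d: "d > 0" "\<And>x::real. d * (1 + x\<^sup>2) \<le> cmod (of_real (x\<^sup>2) - z)"
      using symbol_lower_bound[OF z] by metis
    have "cmod (r x) \<le> inverse d" for x
    proof -
      have "d * 1 \<le> d * (1 + x\<^sup>2)" using d(1) by (intro mult_left_mono) auto
      then have "d \<le> cmod (of_real (x\<^sup>2) - z)" using d(2)[of x] by linarith
      then show ?thesis unfolding r_def norm_inverse using d(1) by (rule le_imp_inverse_le)
    qed
    then show ?thesis by (rule poly_growth_bounded)
  qed
  have dr: "(r has_vector_derivative - 2 * of_real x * r x * r x) (at x)" for x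
  proof -
    have nz: "(of_real x)\<^sup>2 - z \<noteq> 0" using symbol_nonzero[OF z, of x] by simp
    have "((\<lambda>w. inverse (w\<^sup>2 - z)) has_field_derivative
        - 2 * of_real x * inverse ((of_real x)\<^sup>2 - z) * inverse ((of_real x)\<^sup>2 - z)) (at (of_real x))"
      using nz by (auto intro!: derivative_eq_intros)
    from has_vector_derivative_real_field[OF this] show ?thesis by (simp add: r_def[abs_def])
  qed
  have drk: "((\<lambda>x. r x ^ k) has_vector_derivative - 2 * of_nat k * of_real x * r x ^ Suc k) (at x)" for k x
  proof (induction k)
    case (Suc k)
    from has_vector_derivative_mult[OF dr this] show ?case
      by (simp add: algebra_simps)
  qed (simp add: has_vector_derivative_const)
  show ?thesis
  proof (rule moderate_coinduct[of _ S])
    show "u \<in> S" using S[of 1 0] by simp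
    fix f assume "f \<in> S"
    then obtain p k where f: "f = (\<lambda>x. poly p (of_real x) * r x ^ k * u x)"
      by (auto simp: S_def)
    show "poly_growth f"
      unfolding f by (intro poly_growth_mult poly_growth_poly poly_growth_id poly_growth_power rg u)
    define q where "q = pderiv p * [:-z, 0, 1:] + smult (c - 2 * of_nat k) ([:0, 1:] * p)"
    have "(f has_vector_derivative poly q (of_real x) * r x ^ Suc k * u x) (at x)" for x
    proof -
      have "(of_real (x\<^sup>2) - z) * r x = 1"
        using symbol_nonzero[OF z, of x] by (simp add: r_def del: of_real_power)
      then have one: "poly (pderiv p) (of_real x) * r x ^ k
          = poly (pderiv p) (of_real x) * (of_real (x\<^sup>2) - z) * r x ^ Suc k"
        by (simp add: mult.assoc del: of_real_power)
      have "(f has_vector_derivative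
        poly p (of_real x) * r x ^ k * (c * of_real x * r x * u x) +
        (poly p (of_real x) * (- 2 * of_nat k * of_real x * r x ^ Suc k) +
         poly (pderiv p) (of_real x) * r x ^ k) * u x) (at x)"
        unfolding f
        by (intro has_vector_derivative_mult has_vector_derivative_real_field[OF poly_DERIV] drk
            du[unfolded r_def[symmetric]])
      also have "poly p (of_real x) * r x ^ k * (c * of_real x * r x * u x) +
        (poly p (of_real x) * (- 2 * of_nat k * of_real x * r x ^ Suc k) +
         poly (pderiv p) (of_real x) * r x ^ k) * u x = poly q (of_real x) * r x ^ Suc k * u x"
        unfolding one by (simp add: q_def algebra_simps power2_eq_square)
      finally show ?thesis .
    qed
    then show "\<exists>f'\<in>S. \<forall>x. (f has_vector_derivative f' x) (at x)"
      by (intro bexI[OF _ S] allI)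
  qed
qed

lemma csqrt_2pi_square: "csqrt_2pi z * csqrt_2pi z = z"
proof -
  have "csqrt_2pi z * csqrt_2pi z
      = of_real (sqrt (cmod z) * sqrt (cmod z)) * (exp (\<i> * of_real (Arg2pi z / 2)) * exp (\<i> * of_real (Arg2pi z / 2)))"
    unfolding csqrt_2pi_def of_real_mult by (simp only: mult_ac)
  also have "\<dots> = of_real (cmod z) * exp (\<i> * of_real (Arg2pi z))"
    by (simp add: exp_add[symmetric] distrib_left[symmetric] of_real_add[symmetric]
        del: of_real_add of_real_divide of_real_mult)
  finally show ?thesis using Arg2pi_eq[of z] by simp
qed

lemma cmod_csqrt_2pi: "cmod (csqrt_2pi z) = sqrt (cmod z)"
  by (simp add: csqrt_2pi_def norm_mult)

text \<open>Off the negative half-axis the two branches of the square root differ only by a sign that is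
  constant on each half-plane, so that the derivative of the principal branch can be used.\<close>

lemma csqrt_2pi_eq_csqrt:
  assumes "z \<notin> \<real>\<^sub>\<le>\<^sub>0"
  shows "csqrt_2pi z = (if Im z < 0 then - csqrt z else csqrt z)"
proof (cases "Im z < 0")
  case True
  have "pi < Arg2pi z" using True Arg2pi_le_pi[of z] by linarith
  moreover have "Arg2pi z < 2 * pi" by (rule Arg2pi_lt_2pi)
  ultimately have "cos (Arg2pi z / 2) < 0"
    using cos_monotone_0_pi[of "pi/2" "Arg2pi z / 2"] by simp
  moreover have "z \<noteq> 0" using True by auto
  ultimately have "0 < Re (- csqrt_2pi z)"
    by (simp add: csqrt_2pi_def Re_exp mult_less_0_iff)
  then have "csqrt z = - csqrt_2pi z"
    by (intro csqrt_unique) (simp_all add: power2_eq_square csqrt_2pi_square)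
  then show ?thesis using True by simp
next
  case False
  have "Arg2pi z \<noteq> pi"
    using assms by (auto simp: Arg2pi_eq_pi complex_nonpos_Reals_iff complex_is_Real_iff)
  then have "Arg2pi z < pi" using False Arg2pi_le_pi[of z] by linarith
  then have "cos (Arg2pi z / 2) > 0"
    using Arg2pi_ge_0[of z] by (intro cos_gt_zero_pi) auto
  moreover have "z \<noteq> 0" using assms by auto
  ultimately have "0 < Re (csqrt_2pi z)"
    by (simp add: csqrt_2pi_def Re_exp)
  then have "csqrt z = csqrt_2pi z"
    by (intro csqrt_unique) (simp_all add: power2_eq_square csqrt_2pi_square)
  then show ?thesis using False by simp
qed

definition res_symbol :: "complex \<Rightarrow> real \<Rightarrow> complex" where
  "res_symbol z = (\<lambda>\<xi>. inverse (csqrt_2pi (of_real (\<xi>\<^sup>2) - z)))"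

lemma res_symbol_square: "res_symbol z x * res_symbol z x = inverse (of_real (x\<^sup>2) - z)"
  unfolding res_symbol_def by (simp only: inverse_mult_distrib[symmetric] csqrt_2pi_square)

lemma res_symbol_nonzero: "z \<notin> \<real>\<^sub>\<ge>\<^sub>0 \<Longrightarrow> res_symbol z x \<noteq> 0"
  using res_symbol_square[of z x] symbol_nonzero[of z x] by auto

lemma cmod_res_symbol: "cmod (res_symbol z x) = 1 / sqrt (cmod (of_real (x\<^sup>2) - z))"
  by (simp only: res_symbol_def norm_inverse cmod_csqrt_2pi) (simp only: inverse_eq_divide)

text \<open>The branch of the square root is cut along the positive half-axis, which the half-line of the
  points \<open>x\<^sup>2 - z\<close> meets only if it lies in it (for \<open>z < 0\<close>); hence the symbol is smooth.\<close>

lemma res_symbol_derivative: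
  assumes z: "z \<notin> \<real>\<^sub>\<ge>\<^sub>0"
  shows "(res_symbol z has_vector_derivative
    (-1) * of_real x * inverse (of_real (x\<^sup>2) - z) * res_symbol z x) (at x)"
proof -
  have np: "of_real (y\<^sup>2) - z \<notin> \<real>\<^sub>\<le>\<^sub>0" for y :: real
    using z by (auto simp: complex_nonpos_Reals_iff complex_nonneg_Reals_iff simp del: of_real_power)
      (metis diff_le_0_iff_le order_trans zero_le_power2)
  define s :: complex where "s = (if Im z > 0 then -1 else 1)"
  have s: "s \<noteq> 0" "s * s = 1" by (auto simp: s_def)
  have eq: "res_symbol z = (\<lambda>x. inverse (s * csqrt ((of_real x)\<^sup>2 - z)))"
    using csqrt_2pi_eq_csqrt[OF np] by (auto simp: res_symbol_def s_def fun_eq_iff)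
  have cs: "(csqrt ((of_real x)\<^sup>2 - z))\<^sup>2 = (of_real x)\<^sup>2 - z" by simp
  have nz: "csqrt ((of_real x)\<^sup>2 - z) \<noteq> 0" using symbol_nonzero[OF z, of x] by simp
  have "((\<lambda>w. inverse (s * csqrt (w\<^sup>2 - z))) has_field_derivative
      - (inverse (s * csqrt ((of_real x)\<^sup>2 - z)) * (s * (2 * of_real x / (2 * csqrt ((of_real x)\<^sup>2 - z)))) *
        inverse (s * csqrt ((of_real x)\<^sup>2 - z)))) (at (of_real x))"
    using np[of x] nz s(1) by (auto intro!: derivative_eq_intros)
  also have "- (inverse (s * csqrt ((of_real x)\<^sup>2 - z)) * (s * (2 * of_real x / (2 * csqrt ((of_real x)\<^sup>2 - z)))) *
        inverse (s * csqrt ((of_real x)\<^sup>2 - z)))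
      = (-1) * of_real x * inverse ((csqrt ((of_real x)\<^sup>2 - z))\<^sup>2) * inverse (s * csqrt ((of_real x)\<^sup>2 - z))"
    using nz s(1) by (simp add: field_simps power2_eq_square)
  finally show ?thesis
    using has_vector_derivative_real_field unfolding cs eq by fastforce
qed

text \<open>The weight of the Sobolev space of order one.\<close>

definition weight :: "real \<Rightarrow> real" where
  "weight x = sqrt (1 + x\<^sup>2)"

lemma weight_pos [simp]: "weight x > 0" and weight_nonzero [simp]: "weight x \<noteq> 0"
  and weight_ge_1: "weight x \<ge> 1" and weight_sq: "weight x ^ 2 = 1 + x\<^sup>2"
proof -
  have p: "0 < 1 + x\<^sup>2" by (rule add_pos_nonneg) simp_all
  then show "weight x > 0" "weight x \<noteq> 0" by (auto simp: weight_def)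
  show "weight x \<ge> 1" "weight x ^ 2 = 1 + x\<^sup>2" using p by (auto simp: weight_def)
qed

lemma powr_half_weight: "(1 + x\<^sup>2) powr (1 / 2) = weight x"
  "(1 + x\<^sup>2) powr (- 1 / 2) = inverse (weight x)" "(1 + x\<^sup>2) powr (2 / 2) = 1 + x\<^sup>2"
proof -
  have p: "0 < 1 + x\<^sup>2" by (rule add_pos_nonneg) simp_all
  then show "(1 + x\<^sup>2) powr (1 / 2) = weight x" by (simp add: weight_def powr_half_sqrt)
  then show "(1 + x\<^sup>2) powr (- 1 / 2) = inverse (weight x)" by (simp add: powr_minus)
  show "(1 + x\<^sup>2) powr (2 / 2) = 1 + x\<^sup>2" using p by simp
qed

lemma cmod_res_symbol_le:
  assumes "z \<notin> \<real>\<^sub>\<ge>\<^sub>0"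
  obtains C where "C > 0" "\<And>x. cmod (res_symbol z x) \<le> C / weight x"
proof -
  obtain c where c: "c > 0" "\<And>x::real. c * (1 + x\<^sup>2) \<le> cmod (of_real (x\<^sup>2) - z)"
    using symbol_lower_bound[OF assms] by metis
  have "cmod (res_symbol z x) \<le> (1 / sqrt c) / weight x" for x
  proof -
    have "sqrt c * weight x \<le> sqrt (cmod (of_real (x\<^sup>2) - z))"
      unfolding weight_def real_sqrt_mult[symmetric] by (rule real_sqrt_le_mono[OF c(2)])
    moreover have pos: "0 < sqrt c * weight x" using c(1) by simp
    ultimately have "1 / sqrt (cmod (of_real (x\<^sup>2) - z)) \<le> 1 / (sqrt c * weight x)"
      by (intro frac_le) simp_all
    then show ?thesis by (simp add: cmod_res_symbol)
  qed
  then show ?thesis using that[of "1 / sqrt c"] c(1) by simp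
qed

lemma cmod_res_symbol_ge:
  assumes "z \<notin> \<real>\<^sub>\<ge>\<^sub>0"
  obtains C where "C > 0" "\<And>x. cmod (inverse (res_symbol z x)) \<le> C * weight x"
proof -
  have "cmod (inverse (res_symbol z x)) \<le> sqrt (1 + cmod z) * weight x" for x
  proof -
    have "cmod (of_real (x\<^sup>2) - z) \<le> x\<^sup>2 + cmod z"
      using norm_triangle_ineq4[of "of_real (x\<^sup>2)" z] by (simp add: norm_power)
    also have "\<dots> \<le> (1 + cmod z) * (1 + x\<^sup>2)"
      using mult_nonneg_nonneg[OF norm_ge_zero[of z] zero_le_power2[of x]]
      unfolding distrib_left distrib_right by linarith
    finally have "sqrt (cmod (of_real (x\<^sup>2) - z)) \<le> sqrt ((1 + cmod z) * (1 + x\<^sup>2))" by simp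
    then show ?thesis
      by (simp add: norm_inverse cmod_res_symbol weight_def real_sqrt_mult)
  qed
  moreover have "sqrt (1 + cmod z) > 0" using norm_ge_zero[of z] by (simp add: add_pos_nonneg)
  ultimately show ?thesis using that by blast
qed

lemma res_symbol_moderate:
  assumes z: "z \<notin> \<real>\<^sub>\<ge>\<^sub>0"
  shows "res_symbol z \<in> moderate"
proof (rule moderate_symbol_power[OF z _ res_symbol_derivative[OF z]])
  obtain C where C: "C > 0" "\<And>x. cmod (res_symbol z x) \<le> C / weight x"
    using cmod_res_symbol_le[OF z] by metis
  have "cmod (res_symbol z x) \<le> C" for x
  proof -
    have "C / weight x \<le> C / 1" using C(1) weight_ge_1[of x] by (intro divide_left_mono) auto
    with C(2)[of x] show ?thesis by simp
  qed
  then show "poly_growth (res_symbol z)" by (rule poly_growth_bounded)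
qed

lemma cnj_res_symbol_moderate:
  assumes z: "z \<notin> \<real>\<^sub>\<ge>\<^sub>0"
  shows "(\<lambda>x. cnj (res_symbol z x)) \<in> moderate"
proof (rule moderate_symbol_power[of "cnj z"])
  show "cnj z \<notin> \<real>\<^sub>\<ge>\<^sub>0" using z by (simp add: complex_nonneg_Reals_iff)
  show "poly_growth (\<lambda>x. cnj (res_symbol z x))"
    using moderate_poly_growth[OF res_symbol_moderate[OF z]] by (simp add: poly_growth_def)
  show "((\<lambda>x. cnj (res_symbol z x)) has_vector_derivative
      (-1) * of_real x * inverse (of_real (x\<^sup>2) - cnj z) * cnj (res_symbol z x)) (at x)" for x
    using has_vector_derivative_cnj[OF res_symbol_derivative[OF z], of x] by simp
qed

lemma minus_one_notin_nonneg_Reals: "(-1 :: complex) \<notin> \<real>\<^sub>\<ge>\<^sub>0"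
  by (simp add: complex_nonneg_Reals_iff)

lemma weight_powr_moderate: "(\<lambda>x. of_real ((1 + x\<^sup>2) powr s)) \<in> moderate"
proof (rule moderate_symbol_power[OF minus_one_notin_nonneg_Reals, of _ "of_real (2 * s)"])
  have p: "0 < 1 + x\<^sup>2" for x :: real by (rule add_pos_nonneg) simp_all
  show "poly_growth (\<lambda>x. of_real ((1 + x\<^sup>2) powr s))"
    unfolding poly_growth_def
  proof (intro exI allI)
    fix x :: real
    have le: "1 + x\<^sup>2 \<le> (1 + \<bar>x\<bar>)\<^sup>2" by (simp add: power2_sum)
    have "(1 + x\<^sup>2) powr s \<le> (1 + x\<^sup>2) powr (real (nat \<lceil>s\<rceil>))"
      by (intro powr_mono) (auto simp: of_nat_ceiling)
    also have "\<dots> = (1 + x\<^sup>2) ^ nat \<lceil>s\<rceil>" using p[of x] by (simp add: powr_realpow)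
    also have "\<dots> \<le> ((1 + \<bar>x\<bar>)\<^sup>2) ^ nat \<lceil>s\<rceil>" using p[of x] by (intro power_mono le) simp
    also have "\<dots> = 1 * (1 + \<bar>x\<bar>) ^ (2 * nat \<lceil>s\<rceil>)" by (simp add: power_mult)
    finally show "cmod (of_real ((1 + x\<^sup>2) powr s)) \<le> 1 * (1 + \<bar>x\<bar>) ^ (2 * nat \<lceil>s\<rceil>)" by simp
  qed
  fix x :: real
  have "((\<lambda>x. (1 + x\<^sup>2) powr s) has_real_derivative (2 * s) * x * inverse (1 + x\<^sup>2) * (1 + x\<^sup>2) powr s) (at x)"
  proof -
    have "(1 + x\<^sup>2) powr (s - 1) = inverse (1 + x\<^sup>2) * (1 + x\<^sup>2) powr s"
      using p[of x] by (simp add: powr_diff field_simps)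
    moreover have "((\<lambda>x. (1 + x\<^sup>2) powr s) has_real_derivative s * (1 + x\<^sup>2) powr (s - 1) * (2 * x)) (at x)"
    proof -
      have "((\<lambda>x. 1 + x\<^sup>2) has_real_derivative 2 * x) (at x)"
        by (rule derivative_eq_intros refl | simp)+
      from DERIV_fun_powr[OF this p, of s] show ?thesis by simp
    qed
    ultimately show ?thesis by (simp add: mult_ac)
  qed
  from has_vector_derivative_of_real[OF this, where 'a = complex]
  show "((\<lambda>x. of_real ((1 + x\<^sup>2) powr s) :: complex) has_vector_derivative of_real (2 * s) * of_real x *
      inverse (of_real (x\<^sup>2) - (-1)) * of_real ((1 + x\<^sup>2) powr s)) (at x)"
    by (simp add: add.commute)
qed

lemma weight_moderate: "(\<lambda>x. of_real (weight x)) \<in> moderate"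
  and inverse_weight_moderate: "(\<lambda>x. of_real (inverse (weight x))) \<in> moderate"
  using weight_powr_moderate[of "1/2"] weight_powr_moderate[of "-1/2"]
  by (simp_all only: powr_half_weight)

section \<open>The Fourier transform of Schwartz functions\<close>

lemma integrable_inverse_1_plus_sq: "integrable lborel (\<lambda>x::real. inverse (1 + x\<^sup>2))"
  using integrable_inverse_1_plus_square by (simp add: set_integrable_def)

lemma inverse_square_le: "inverse ((1 + \<bar>x\<bar>)\<^sup>2) \<le> inverse (1 + (x::real)\<^sup>2)"
proof -
  have "0 < 1 + x\<^sup>2" by (rule add_pos_nonneg) simp_all
  moreover have "1 + x\<^sup>2 \<le> (1 + \<bar>x\<bar>)\<^sup>2" by (simp add: power2_sum)
  ultimately show ?thesis by (rule le_imp_inverse_le[rotated])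
qed

lemma schwartz_bound:
  assumes "\<phi> \<in> schwartz"
  obtains C where "C \<ge> 0" "\<And>x. cmod (\<phi> x) \<le> C * inverse (1 + x\<^sup>2)"
proof -
  obtain C where C: "\<And>x. (1 + \<bar>x\<bar>)\<^sup>2 * cmod (\<phi> x) \<le> C"
    using schwartz_rapid_decay[OF assms] unfolding rapid_decay_def by meson
  have "0 \<le> C" using order_trans[OF _ C[of 0]] by simp
  have "cmod (\<phi> x) \<le> C * inverse (1 + x\<^sup>2)" for x
  proof -
    have "(1 + \<bar>x\<bar>)\<^sup>2 > 0" by (simp add: zero_less_power2)
    then have "cmod (\<phi> x) \<le> C * inverse ((1 + \<bar>x\<bar>)\<^sup>2)"
      using C[of x] by (simp only: inverse_eq_divide) (simp add: pos_le_divide_eq mult.commute)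
    also have "\<dots> \<le> C * inverse (1 + x\<^sup>2)"
      by (rule mult_left_mono[OF inverse_square_le \<open>0 \<le> C\<close>])
    finally show ?thesis .
  qed
  then show ?thesis using that \<open>0 \<le> C\<close> by blast
qed

lemma schwartz_bounded:
  assumes "\<phi> \<in> schwartz"
  obtains C where "C \<ge> 0" "\<And>x. cmod (\<phi> x) \<le> C"
proof -
  obtain C where C: "C \<ge> 0" "\<And>x. cmod (\<phi> x) \<le> C * inverse (1 + x\<^sup>2)"
    using schwartz_bound[OF assms] by metis
  have "C * inverse (1 + x\<^sup>2) \<le> C * 1" for x
    using C(1) by (intro mult_left_mono) (auto simp: inverse_le_1_iff)
  then show ?thesis using that C order_trans by (metis mult_1_right)
qed

lemma schwartz_integrable: 
  assumes "\<phi> \<in> schwartz"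
  shows "integrable lborel \<phi>"
proof -
  obtain C where C: "C \<ge> 0" "\<And>x. cmod (\<phi> x) \<le> C * inverse (1 + x\<^sup>2)"
    using schwartz_bound[OF assms] by metis
  show ?thesis
  proof (rule Bochner_Integration.integrable_bound)
    show "integrable lborel (\<lambda>x. C * inverse (1 + x\<^sup>2))"
      by (intro integrable_mult_right integrable_inverse_1_plus_sq)
    show "AE x in lborel. norm (\<phi> x) \<le> norm (C * inverse (1 + x\<^sup>2))"
      by (intro AE_I2) (use C in \<open>simp add: abs_mult\<close>)
  qed (use schwartz_measurable[OF assms] in simp)
qed

lemma schwartz_square_integrable:
  assumes "\<phi> \<in> schwartz"
  shows "square_integrable \<phi>"
proof -
  have "integrable lborel (\<lambda>x. cnj (\<phi> x) * \<phi> x)"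
    by (intro schwartz_integrable schwartz_mult schwartz_cnj assms)
  then have "integrable lborel (\<lambda>x. cmod (cnj (\<phi> x) * \<phi> x))" by (rule integrable_norm)
  then show ?thesis
    using schwartz_measurable[OF assms]
    by (simp add: square_integrable_def norm_mult power2_eq_square)
qed

definition fourier_const :: real where "fourier_const = (2 * pi) powr (-1/2)"

lemma fourier_const_pos [simp]: "fourier_const > 0"
  by (simp add: fourier_const_def)

lemma fourier_const_eq: "fourier_const = 1 / sqrt (2 * pi)"
  by (simp add: fourier_const_def powr_minus powr_half_sqrt inverse_eq_divide)

lemma fourier_eq: "fourier f \<xi> = of_real fourier_const * (\<integral>x. exp (- \<i> * of_real (\<xi> * x)) * f x \<partial>lborel)"
  and inv_fourier_eq: "inv_fourier f \<xi> = of_real fourier_const * (\<integral>x. exp (\<i> * of_real (x * \<xi>)) * f x \<partial>lborel)"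
  by (simp_all add: fourier_def inv_fourier_def fourier_const_def)

lemma inv_fourier_reflect: "inv_fourier f x = fourier f (- x)"
  by (simp add: fourier_eq inv_fourier_eq mult.commute)

lemma schwartz_character: "\<phi> \<in> schwartz \<Longrightarrow> (\<lambda>x. exp (- \<i> * of_real (\<xi> * x)) * \<phi> x) \<in> schwartz"
  by (rule schwartz_mult_moderate[OF moderate_exp])

text \<open>Integration by parts is this fact applied to the product with a character, which is
  again a Schwartz function.\<close>

lemma integral_deriv_zero:
  assumes "\<phi> \<in> schwartz"
  shows "(\<integral>x. vector_derivative \<phi> (at x) \<partial>lborel) = 0"
proof -
  obtain C where C: "\<And>x. (1 + \<bar>x\<bar>) ^ 1 * cmod (\<phi> x) \<le> C"
    using schwartz_rapid_decay[OF assms] unfolding rapid_decay_def by meson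
  have le: "norm (\<phi> x) \<le> C / (1 + \<bar>x\<bar>)" for x
    using C[of x] by (simp add: pos_le_divide_eq mult.commute)
  have "((\<lambda>x::real. C / (1 + norm x)) \<longlongrightarrow> 0) at_infinity"
    by (intro tendsto_divide_0[OF tendsto_const] filterlim_at_top_imp_at_infinity
        filterlim_tendsto_add_at_top[OF tendsto_const] filterlim_norm_at_top)
  then have "((\<lambda>x. C / (1 + \<bar>x\<bar>)) \<longlongrightarrow> 0) at_top" "((\<lambda>x. C / (1 + \<bar>x\<bar>)) \<longlongrightarrow> 0) at_bot"
    using at_top_le_at_infinity at_bot_le_at_infinity by (auto intro: filterlim_mono)
  then have lim: "(\<phi> \<longlongrightarrow> 0) at_top" "(\<phi> \<longlongrightarrow> 0) at_bot"
    by (auto intro: Lim_null_comparison[OF always_eventually[OF allI[OF le]]])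
  have "(LBINT x=-\<infinity>..\<infinity>. vector_derivative \<phi> (at x)) = 0 - 0"
  proof (rule interval_integral_FTC_integrable)
    show "(\<phi> has_vector_derivative vector_derivative \<phi> (at x)) (at x)" for x
      by (rule schwartz_has_derivative[OF assms])
    show "isCont (\<lambda>x. vector_derivative \<phi> (at x)) x" for x
      using schwartz_continuous[OF schwartz_deriv[OF assms], of UNIV]
      by (simp add: continuous_on_eq_continuous_at)
    show "set_integrable lborel (einterval (- \<infinity>) \<infinity>) (\<lambda>x. vector_derivative \<phi> (at x))"
      using schwartz_integrable[OF schwartz_deriv[OF assms]] by (simp add: set_integrable_def)
    show "((\<phi> \<circ> real_of_ereal) \<longlongrightarrow> 0) (at_right (- \<infinity>))"
      "((\<phi> \<circ> real_of_ereal) \<longlongrightarrow> 0) (at_left \<infinity>)"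
      using lim by (simp_all add: ereal_tendsto_simps)
  qed simp
  then show ?thesis
    by (simp add: interval_lebesgue_integral_def set_lebesgue_integral_def)
qed

lemma fourier_deriv:
  assumes "\<phi> \<in> schwartz"
  shows "fourier (\<lambda>x. vector_derivative \<phi> (at x)) \<xi> = \<i> * of_real \<xi> * fourier \<phi> \<xi>"
proof -
  define e where "e x = exp (- \<i> * of_real (\<xi> * x))" for x
  have es: "(\<lambda>x. e x * \<psi> x) \<in> schwartz" if "\<psi> \<in> schwartz" for \<psi>
    using schwartz_character[OF that] by (simp add: e_def)
  have de: "(e has_vector_derivative (- \<i> * of_real \<xi>) * e x) (at x)" for x
  proof -
    have "((\<lambda>w. exp (- \<i> * (of_real \<xi> * w))) has_field_derivative
        (- \<i> * of_real \<xi>) * exp (- \<i> * (of_real \<xi> * of_real x))) (at (of_real x))"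
      by (rule derivative_eq_intros refl | simp)+
    from has_vector_derivative_real_field[OF this] show ?thesis by (simp add: e_def[abs_def])
  qed
  have "vector_derivative (\<lambda>x. e x * \<phi> x) (at x)
      = e x * vector_derivative \<phi> (at x) + (- \<i> * of_real \<xi>) * (e x * \<phi> x)" for x
    using has_vector_derivative_mult[OF de schwartz_has_derivative[OF assms], of x]
    by (simp add: vector_derivative_at mult.assoc)
  then have "0 = (\<integral>x. e x * vector_derivative \<phi> (at x) + (- \<i> * of_real \<xi>) * (e x * \<phi> x) \<partial>lborel)"
    using integral_deriv_zero[OF es[OF assms]] by simp
  also have "\<dots> = (\<integral>x. e x * vector_derivative \<phi> (at x) \<partial>lborel) + (- \<i> * of_real \<xi>) * (\<integral>x. e x * \<phi> x \<partial>lborel)"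
    by (subst Bochner_Integration.integral_add)
      (use schwartz_integrable[OF es[OF schwartz_deriv[OF assms]]] schwartz_integrable[OF es[OF assms]]
        in simp_all)
  finally have "(\<integral>x. e x * vector_derivative \<phi> (at x) \<partial>lborel) = \<i> * of_real \<xi> * (\<integral>x. e x * \<phi> x \<partial>lborel)"
    by (simp add: algebra_simps add_eq_0_iff)
  then show ?thesis by (simp add: fourier_eq e_def)
qed

text \<open>For the Fourier transform such a bound of the remainder results from integrating the Taylor
  estimate of the exponential function.\<close>

lemma has_vector_derivative_quadratic:
  fixes f :: "real \<Rightarrow> complex"
  assumes "\<And>h. cmod (f (x + h) - f x - of_real h * d) \<le> C * h\<^sup>2"
  shows "(f has_vector_derivative d) (at x)"
  unfolding has_vector_derivative_def has_derivative_at
proof (intro conjI bounded_linear_scaleR_left)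
  have "((\<lambda>h. C * \<bar>h\<bar>) \<longlongrightarrow> C * \<bar>0\<bar>) (at 0)" by (intro tendsto_intros)
  then have lim: "((\<lambda>h. C * \<bar>h\<bar>) \<longlongrightarrow> 0) (at 0)" by simp
  show "(\<lambda>h. norm (f (x + h) - f x - h *\<^sub>R d) / norm h) \<midarrow>0\<rightarrow> 0"
  proof (rule Lim_null_comparison[OF _ lim])
    have "norm (norm (f (x + h) - f x - h *\<^sub>R d) / norm h) \<le> C * \<bar>h\<bar>" if "h \<noteq> 0" for h
    proof -
      have "norm (f (x + h) - f x - h *\<^sub>R d) / norm h \<le> (C * h\<^sup>2) / \<bar>h\<bar>"
        using divide_right_mono[OF assms[of h], of "\<bar>h\<bar>"] by (simp add: scaleR_conv_of_real)
      also have "\<dots> = C * \<bar>h\<bar>"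
        using that by (simp add: field_simps power2_eq_square)
      finally show ?thesis by simp
    qed
    then show "\<forall>\<^sub>F h in at 0. norm (norm (f (x + h) - f x - h *\<^sub>R d) / norm h) \<le> C * \<bar>h\<bar>"
      by (simp add: eventually_at_filter)
  qed
qed

lemma exp_taylor_bound: "cmod (exp (- \<i> * of_real t) - 1 + \<i> * of_real t) \<le> t\<^sup>2"
proof -
  have "exp (- \<i> * of_real t) - 1 + \<i> * of_real t
      = iexp (- t) - (\<Sum>k\<le>1. (\<i> * of_real (- t)) ^ k / fact k)"
    by simp
  then have "cmod (exp (- \<i> * of_real t) - 1 + \<i> * of_real t) \<le> \<bar>- t\<bar> ^ Suc 1 / fact (Suc 1)"
    using iexp_approx1[of "- t" 1] by (simp only:)
  also have "\<dots> \<le> t\<^sup>2" by (simp add: power2_eq_square)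
  finally show ?thesis .
qed

lemma fourier_has_derivative:
  assumes "\<phi> \<in> schwartz"
  shows "(fourier \<phi> has_vector_derivative fourier (\<lambda>x. (- \<i> * of_real x) * \<phi> x) \<xi>) (at \<xi>)"
proof (rule has_vector_derivative_quadratic)
  fix h
  define e where "e \<xi> x = exp (- \<i> * of_real (\<xi> * x))" for \<xi> x
  have xs: "(\<lambda>x. of_real x * \<psi> x) \<in> schwartz" if "\<psi> \<in> schwartz" for \<psi>
    using schwartz_mult_moderate[OF moderate_of_real that] .
  have xphi: "(\<lambda>x. (- \<i> * of_real x) * \<phi> x) \<in> schwartz"
    using schwartz_scale[OF xs[OF assms], of "- \<i>"] by (simp add: mult.assoc)
  have es: "integrable lborel (\<lambda>x. e \<xi> x * \<psi> x)" if "\<psi> \<in> schwartz" for \<xi> \<psi>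
    using schwartz_integrable[OF schwartz_character[OF that]] by (simp add: e_def)
  have "fourier \<phi> (\<xi> + h) - fourier \<phi> \<xi> - of_real h * fourier (\<lambda>x. (- \<i> * of_real x) * \<phi> x) \<xi>
    = of_real fourier_const * ((\<integral>x. e (\<xi> + h) x * \<phi> x \<partial>lborel) - (\<integral>x. e \<xi> x * \<phi> x \<partial>lborel)
        - of_real h * (\<integral>x. e \<xi> x * ((- \<i> * of_real x) * \<phi> x) \<partial>lborel))"
    by (simp only: fourier_eq e_def right_diff_distrib mult.left_commute)
  also have "\<dots> = of_real fourier_const * (\<integral>x. e (\<xi> + h) x * \<phi> x - e \<xi> x * \<phi> x
        - of_real h * (e \<xi> x * ((- \<i> * of_real x) * \<phi> x)) \<partial>lborel)"
    using es[OF assms] es[OF xphi] by simp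
  also have "cmod \<dots> \<le> fourier_const * (\<integral>x. cmod (of_real x * (of_real x * \<phi> x)) * h\<^sup>2 \<partial>lborel)"
    unfolding norm_mult
  proof (rule mult_mono)
    show "cmod (\<integral>x. e (\<xi> + h) x * \<phi> x - e \<xi> x * \<phi> x - of_real h * (e \<xi> x * ((- \<i> * of_real x) * \<phi> x)) \<partial>lborel)
       \<le> (\<integral>x. cmod (of_real x) * (cmod (of_real x) * cmod (\<phi> x)) * h\<^sup>2 \<partial>lborel)"
    proof (rule order_trans[OF integral_norm_bound integral_mono])
      show "integrable lborel (\<lambda>x. cmod (e (\<xi> + h) x * \<phi> x - e \<xi> x * \<phi> x
          - of_real h * (e \<xi> x * ((- \<i> * of_real x) * \<phi> x))))"
        using es[OF assms] es[OF xphi] by (intro integrable_norm) simp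
      show "integrable lborel (\<lambda>x. cmod (of_real x) * (cmod (of_real x) * cmod (\<phi> x)) * h\<^sup>2)"
        using integrable_norm[OF schwartz_integrable[OF xs[OF xs[OF assms]]]]
        by (simp add: norm_mult)
      show "cmod (e (\<xi> + h) x * \<phi> x - e \<xi> x * \<phi> x - of_real h * (e \<xi> x * ((- \<i> * of_real x) * \<phi> x)))
          \<le> cmod (of_real x) * (cmod (of_real x) * cmod (\<phi> x)) * h\<^sup>2" for x
      proof -
        have "e (\<xi> + h) x = e \<xi> x * exp (- \<i> * of_real (h * x))"
          by (simp add: e_def exp_add[symmetric] algebra_simps)
        then have "e (\<xi> + h) x * \<phi> x - e \<xi> x * \<phi> x - of_real h * (e \<xi> x * ((- \<i> * of_real x) * \<phi> x))
          = e \<xi> x * \<phi> x * (exp (- \<i> * of_real (h * x)) - 1 + \<i> * of_real (h * x))"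
          by (simp add: algebra_simps)
        then have "cmod (e (\<xi> + h) x * \<phi> x - e \<xi> x * \<phi> x - of_real h * (e \<xi> x * ((- \<i> * of_real x) * \<phi> x)))
          = cmod (\<phi> x) * cmod (exp (- \<i> * of_real (h * x)) - 1 + \<i> * of_real (h * x))"
          by (simp add: norm_mult e_def)
        also have "\<dots> \<le> cmod (\<phi> x) * (h * x)\<^sup>2"
          by (intro mult_left_mono exp_taylor_bound) simp
        also have "\<dots> = cmod (of_real x) * (cmod (of_real x) * cmod (\<phi> x)) * h\<^sup>2"
          by (simp add: power2_eq_square)
        finally show ?thesis .
      qed
    qed
  qed (auto intro!: less_imp_le[OF fourier_const_pos] simp: less_imp_le[OF fourier_const_pos])
  also have "\<dots> = fourier_const * (\<integral>x. cmod (of_real x * (of_real x * \<phi> x)) \<partial>lborel) * h\<^sup>2"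
    by simp
  finally show "cmod (fourier \<phi> (\<xi> + h) - fourier \<phi> \<xi> - of_real h * fourier (\<lambda>x. (- \<i> * of_real x) * \<phi> x) \<xi>)
    \<le> fourier_const * (\<integral>x. cmod (of_real x * (of_real x * \<phi> x)) \<partial>lborel) * h\<^sup>2" .
qed

lemma fourier_bounded: "cmod (fourier f \<xi>) \<le> fourier_const * (\<integral>x. cmod (f x) \<partial>lborel)"
proof -
  have "cmod (\<integral>x. exp (- \<i> * of_real (\<xi> * x)) * f x \<partial>lborel) \<le> (\<integral>x. cmod (f x) \<partial>lborel)"
    using integral_norm_bound[of lborel "\<lambda>x. exp (- \<i> * of_real (\<xi> * x)) * f x"] by (simp add: norm_mult)
  then have "fourier_const * cmod (\<integral>x. exp (- \<i> * of_real (\<xi> * x)) * f x \<partial>lborel)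
      \<le> fourier_const * (\<integral>x. cmod (f x) \<partial>lborel)"
    by (rule mult_left_mono) (rule less_imp_le[OF fourier_const_pos])
  then show ?thesis
    unfolding fourier_eq norm_mult by (simp only: norm_of_real abs_of_pos[OF fourier_const_pos])
qed

lemma fourier_power:
  assumes "\<phi> \<in> schwartz"
  shows "\<exists>\<psi>\<in>schwartz. \<forall>\<xi>. of_real (\<xi> ^ m) * fourier \<phi> \<xi> = (- \<i>) ^ m * fourier \<psi> \<xi>"
  using assms
proof (induction m arbitrary: \<phi>)
  case 0
  then show ?case by (intro bexI[of _ \<phi>]) auto
next
  case (Suc m)
  from Suc.IH[OF schwartz_deriv[OF Suc.prems]] obtain \<psi> where \<psi>: "\<psi> \<in> schwartz"
    "\<And>\<xi>. of_real (\<xi> ^ m) * fourier (\<lambda>x. vector_derivative \<phi> (at x)) \<xi> = (- \<i>) ^ m * fourier \<psi> \<xi>"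
    by blast
  have "of_real (\<xi> ^ Suc m) * fourier \<phi> \<xi> = (- \<i>) ^ Suc m * fourier \<psi> \<xi>" for \<xi>
  proof -
    have "of_real (\<xi> ^ Suc m) * fourier \<phi> \<xi> = (- \<i>) * (of_real (\<xi> ^ m) * (\<i> * of_real \<xi> * fourier \<phi> \<xi>))"
    proof -
      have "q * p * F = (- \<i>) * (p * (\<i> * q * F))" for p q F
        using i_squared by algebra
      then show ?thesis by simp
    qed
    also have "\<dots> = (- \<i>) * ((- \<i>) ^ m * fourier \<psi> \<xi>)"
      by (simp only: fourier_deriv[OF Suc.prems, symmetric] \<psi>(2))
    finally show ?thesis by simp
  qed
  with \<psi>(1) show ?case by blast
qed

text \<open>The set of all Fourier transforms of Schwartz functions is closed under
  differentiation, and its members decay rapidly because powers of \<open>\<xi>\<close> turn into derivatives.\<close>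

lemma fourier_schwartz:
  assumes "\<phi> \<in> schwartz"
  shows "fourier \<phi> \<in> schwartz"
proof (rule schwartz_coinduct[of _ "fourier ` schwartz"])
  fix f assume "f \<in> fourier ` schwartz"
  then obtain \<phi> where f: "f = fourier \<phi>" "\<phi> \<in> schwartz" by auto
  show "rapid_decay f"
    unfolding rapid_decay_iff
  proof
    fix m
    obtain \<psi> where "\<psi> \<in> schwartz" "\<And>\<xi>. of_real (\<xi> ^ m) * fourier \<phi> \<xi> = (- \<i>) ^ m * fourier \<psi> \<xi>"
      using fourier_power[OF f(2)] by blast
    then show "bounded (range (\<lambda>x. of_real (x ^ m) * f x))"
      by (intro boundedI[of _ "fourier_const * (\<integral>x. cmod (\<psi> x) \<partial>lborel)"])
        (auto simp: f norm_mult norm_power intro: fourier_bounded simp del: of_real_power)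
  qed
  have "(\<lambda>x. (- \<i> * of_real x) * \<phi> x) \<in> schwartz"
    using schwartz_scale[OF schwartz_mult_moderate[OF moderate_of_real f(2)], of "- \<i>"]
    by (simp add: mult.assoc)
  moreover have "\<forall>\<xi>. (f has_vector_derivative fourier (\<lambda>x. (- \<i> * of_real x) * \<phi> x) \<xi>) (at \<xi>)"
    unfolding f using fourier_has_derivative[OF f(2)] by (rule allI)
  ultimately show "\<exists>f'\<in>fourier ` schwartz. \<forall>x. (f has_vector_derivative f' x) (at x)"
    by (intro bexI[OF _ imageI])
qed (use assms in simp)

lemma inv_fourier_schwartz: "\<phi> \<in> schwartz \<Longrightarrow> inv_fourier \<phi> \<in> schwartz"
  using schwartz_reflect[OF fourier_schwartz] inv_fourier_reflect[of \<phi>] by (metis ext)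

section \<open>Inversion formula, Parseval identity and products\<close>

lemma integrable_prod:
  fixes f g :: "real \<Rightarrow> complex"
  assumes "integrable lborel f" "integrable lborel g"
  shows "integrable (lborel \<Otimes>\<^sub>M lborel) (\<lambda>(x, y). f x * g y)"
proof (rule lborel_pair.Fubini_integrable)
  note [measurable] = borel_measurable_integrable[OF assms(1)] borel_measurable_integrable[OF assms(2)]
  show "(\<lambda>(x, y). f x * g y) \<in> borel_measurable (lborel \<Otimes>\<^sub>M lborel)" by measurable
  show "integrable lborel (\<lambda>x. \<integral>y. norm (case (x, y) of (x, y) \<Rightarrow> f x * g y) \<partial>lborel)"
    using integrable_mult_left[OF integrable_norm[OF assms(1)], of "\<integral>y. norm (g y) \<partial>lborel"]
    by (simp add: norm_mult)
  show "AE x in lborel. integrable lborel (\<lambda>y. case (x, y) of (x, y) \<Rightarrow> f x * g y)"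
    using assms(2) by simp
qed

lemma fubini_bounded_kernel:
  fixes f g :: "real \<Rightarrow> complex"
  assumes "integrable lborel f" "integrable lborel g"
    and e: "case_prod e \<in> borel_measurable (lborel \<Otimes>\<^sub>M lborel)" "\<And>x y. cmod (e x y) \<le> 1"
  shows "(\<integral>y. (\<integral>x. f x * g y * e x y \<partial>lborel) \<partial>lborel) = (\<integral>x. (\<integral>y. f x * g y * e x y \<partial>lborel) \<partial>lborel)"
proof (rule lborel_pair.Fubini_integral)
  note [measurable] = borel_measurable_integrable[OF assms(1)] borel_measurable_integrable[OF assms(2)] e(1)
  show "integrable (lborel \<Otimes>\<^sub>M lborel) (\<lambda>(x, y). f x * g y * e x y)"
  proof (rule Bochner_Integration.integrable_bound[OF integrable_prod[OF assms(1,2)]])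
    show "(\<lambda>(x, y). f x * g y * e x y) \<in> borel_measurable (lborel \<Otimes>\<^sub>M lborel)" by measurable
    show "AE p in lborel \<Otimes>\<^sub>M lborel. norm (case p of (x, y) \<Rightarrow> f x * g y * e x y)
        \<le> norm (case p of (x, y) \<Rightarrow> f x * g y)"
      using e(2) by (auto simp: norm_mult mult_left_le)
  qed
qed

lemma character_measurable:
  fixes f :: "real \<Rightarrow> real \<Rightarrow> real"
  assumes "continuous_on UNIV (case_prod f)"
  shows "(\<lambda>(x, y). exp (\<i> * of_real (f x y))) \<in> borel_measurable (lborel \<Otimes>\<^sub>M lborel)"
proof -
  have "continuous_on UNIV (\<lambda>p. exp (\<i> * of_real (case_prod f p)))"
    by (intro continuous_intros assms)
  then have "(\<lambda>p. exp (\<i> * of_real (case_prod f p))) \<in> borel_measurable (borel :: (real \<times> real) measure)"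
    by (rule borel_measurable_continuous_onI)
  then show ?thesis by (simp add: lborel_prod case_prod_beta')
qed

lemma character_measurable1: "(\<lambda>x. exp (\<i> * of_real (x * a))) \<in> borel_measurable borel"
  by (intro borel_measurable_continuous_onI continuous_intros)

text \<open>The density of the normal distribution without its constant; its Fourier transform is
  known as the characteristic function of that distribution.\<close>

definition gaussian :: "real \<Rightarrow> complex" where
  "gaussian x = of_real (exp (- (x\<^sup>2) / 2))"

lemma gaussian_schwartz: "gaussian \<in> schwartz"
  using schwartz_gaussian by (simp add: gaussian_def[abs_def])

lemma gaussian_even: "gaussian (- x) = gaussian x" and gaussian_zero: "gaussian 0 = 1"
  and cmod_gaussian_le: "cmod (gaussian x) \<le> 1"
  by (simp_all add: gaussian_def)

lemma gaussian_integral: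
  "(\<integral>t. exp (\<i> * of_real (s * t)) * gaussian t \<partial>lborel) = of_real (sqrt (2 * pi)) * gaussian s"
proof -
  have "char std_normal_distribution s
      = (\<integral>t. std_normal_density t *\<^sub>R exp (\<i> * of_real (s * t)) \<partial>lborel)"
    unfolding char_def by (rule integral_density) (auto simp: normal_density_nonneg)
  also have "\<dots> = (\<integral>t. of_real (1 / sqrt (2 * pi)) * (exp (\<i> * of_real (s * t)) * gaussian t) \<partial>lborel)"
    by (simp add: std_normal_density_def gaussian_def scaleR_conv_of_real mult_ac)
  also have "\<dots> = of_real (1 / sqrt (2 * pi)) * (\<integral>t. exp (\<i> * of_real (s * t)) * gaussian t \<partial>lborel)"
    by (rule integral_mult_right_zero)
  finally have "gaussian s = of_real (1 / sqrt (2 * pi)) * (\<integral>t. exp (\<i> * of_real (s * t)) * gaussian t \<partial>lborel)"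
    by (simp add: char_std_normal_distribution gaussian_def)
  then show ?thesis by (simp add: of_real_divide)
qed

lemma gaussian_total: "(\<integral>t. gaussian t \<partial>lborel) = of_real (sqrt (2 * pi))"
  using gaussian_integral[of 0] by (simp add: gaussian_zero)

lemma isCont_gaussian: "isCont gaussian x"
  by (metis continuous_on_eq_continuous_at gaussian_schwartz open_UNIV schwartz_continuous UNIV_I)

lemma gaussian_scaled_integral:
  assumes "n > 0"
  shows "(\<integral>\<xi>. exp (\<i> * of_real (\<xi> * d)) * gaussian (\<xi> / n) \<partial>lborel)
    = of_real (n * sqrt (2 * pi)) * gaussian (n * d)"
proof -
  have "(\<integral>\<xi>. exp (\<i> * of_real (\<xi> * d)) * gaussian (\<xi> / n) \<partial>lborel)
     = \<bar>n\<bar> *\<^sub>R (\<integral>t. exp (\<i> * of_real ((0 + n * t) * d)) * gaussian ((0 + n * t) / n) \<partial>lborel)"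
    by (rule lborel_integral_real_affine) (use assms in simp)
  also have "(\<lambda>t. exp (\<i> * of_real ((0 + n * t) * d)) * gaussian ((0 + n * t) / n))
      = (\<lambda>t. exp (\<i> * of_real ((n * d) * t)) * gaussian t)"
    using assms by (auto simp: fun_eq_iff mult_ac)
  finally show ?thesis
    using assms by (simp only: gaussian_integral) (simp add: scaleR_conv_of_real)
qed

text \<open>Inserting a Gaussian cut-off into the inversion integral turns it, by Fubini, into
  the convolution of the function with an approximate identity.\<close>

lemma inversion_regularized:
  assumes \<phi>: "\<phi> \<in> schwartz" and n: "n > 0"
  shows "(\<integral>\<xi>. exp (\<i> * of_real (\<xi> * x)) * fourier \<phi> \<xi> * gaussian (\<xi> / n) \<partial>lborel)
    = of_real (fourier_const * sqrt (2 * pi)) * (\<integral>s. \<phi> (x + s / n) * gaussian s \<partial>lborel)"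
proof -
  have gn: "integrable lborel (\<lambda>\<xi>. gaussian (\<xi> / n))"
    using lborel_integrable_real_affine[OF schwartz_integrable[OF gaussian_schwartz], of "1/n" 0] n
    by simp
  have [measurable]: "gaussian \<in> borel_measurable borel" "\<phi> \<in> borel_measurable borel"
    using schwartz_measurable gaussian_schwartz \<phi> by auto
  have "(\<integral>\<xi>. exp (\<i> * of_real (\<xi> * x)) * fourier \<phi> \<xi> * gaussian (\<xi> / n) \<partial>lborel)
    = of_real fourier_const * (\<integral>\<xi>. (\<integral>y. \<phi> y * gaussian (\<xi> / n) * exp (\<i> * of_real (\<xi> * (x - y))) \<partial>lborel) \<partial>lborel)"
  proof (subst integral_mult_right_zero[symmetric], rule Bochner_Integration.integral_cong[OF refl])
    fix \<xi> :: real
    have "exp (\<i> * of_real (\<xi> * (x - y))) = exp (\<i> * of_real (\<xi> * x)) * exp (- \<i> * of_real (\<xi> * y))" for y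
      by (simp add: exp_add[symmetric] algebra_simps)
    then have "(\<integral>y. \<phi> y * gaussian (\<xi> / n) * exp (\<i> * of_real (\<xi> * (x - y))) \<partial>lborel)
      = (\<integral>y. (gaussian (\<xi> / n) * exp (\<i> * of_real (\<xi> * x))) * (exp (- \<i> * of_real (\<xi> * y)) * \<phi> y) \<partial>lborel)"
      by (simp only: mult_ac)
    also have "\<dots> = (gaussian (\<xi> / n) * exp (\<i> * of_real (\<xi> * x))) * (\<integral>y. exp (- \<i> * of_real (\<xi> * y)) * \<phi> y \<partial>lborel)"
      by (rule integral_mult_right_zero)
    finally show "exp (\<i> * of_real (\<xi> * x)) * fourier \<phi> \<xi> * gaussian (\<xi> / n)
      = of_real fourier_const * (\<integral>y. \<phi> y * gaussian (\<xi> / n) * exp (\<i> * of_real (\<xi> * (x - y))) \<partial>lborel)"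
      by (simp only: fourier_eq mult_ac)
  qed
  also have "(\<integral>\<xi>. (\<integral>y. \<phi> y * gaussian (\<xi> / n) * exp (\<i> * of_real (\<xi> * (x - y))) \<partial>lborel) \<partial>lborel)
    = (\<integral>y. (\<integral>\<xi>. \<phi> y * gaussian (\<xi> / n) * exp (\<i> * of_real (\<xi> * (x - y))) \<partial>lborel) \<partial>lborel)"
    by (rule fubini_bounded_kernel[OF schwartz_integrable[OF \<phi>] gn character_measurable])
      (auto simp: case_prod_beta' intro!: continuous_intros)
  also have "\<dots> = (\<integral>y. of_real (n * sqrt (2 * pi)) * (\<phi> y * gaussian (n * (x - y))) \<partial>lborel)"
  proof (rule Bochner_Integration.integral_cong[OF refl])
    fix y
    have "(\<integral>\<xi>. \<phi> y * gaussian (\<xi> / n) * exp (\<i> * of_real (\<xi> * (x - y))) \<partial>lborel)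
      = (\<integral>\<xi>. \<phi> y * (exp (\<i> * of_real (\<xi> * (x - y))) * gaussian (\<xi> / n)) \<partial>lborel)"
      by (simp only: mult_ac)
    also have "\<dots> = \<phi> y * (of_real (n * sqrt (2 * pi)) * gaussian (n * (x - y)))"
      by (simp only: integral_mult_right_zero gaussian_scaled_integral[OF n])
    finally show "(\<integral>\<xi>. \<phi> y * gaussian (\<xi> / n) * exp (\<i> * of_real (\<xi> * (x - y))) \<partial>lborel)
      = of_real (n * sqrt (2 * pi)) * (\<phi> y * gaussian (n * (x - y)))"
      by (simp only: mult_ac)
  qed
  also have "\<dots> = \<bar>1 / n\<bar> *\<^sub>R (\<integral>s. of_real (n * sqrt (2 * pi)) *
      (\<phi> (x + 1 / n * s) * gaussian (n * (x - (x + 1 / n * s)))) \<partial>lborel)"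
    by (rule lborel_integral_real_affine) (use n in simp)
  also have "\<dots> = of_real (sqrt (2 * pi)) * (\<integral>s. \<phi> (x + s / n) * gaussian s \<partial>lborel)"
    using n by (simp add: gaussian_even scaleR_conv_of_real)
  finally show ?thesis by (simp only: of_real_mult mult.assoc)
qed

lemma fourier_const_sq: "fourier_const * fourier_const * (2 * pi) = 1"
  by (simp add: fourier_const_eq)

text \<open>Both sides of the regularized formula converge by dominated convergence.\<close>

theorem fourier_inversion:
  assumes \<phi>: "\<phi> \<in> schwartz"
  shows "inv_fourier (fourier \<phi>) x = \<phi> x"
proof -
  have [measurable]: "gaussian \<in> borel_measurable borel" "\<phi> \<in> borel_measurable borel"
    "fourier \<phi> \<in> borel_measurable borel" "(\<lambda>\<xi>. exp (\<i> * of_real (\<xi> * x))) \<in> borel_measurable borel"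
    using character_measurable1 schwartz_measurable gaussian_schwartz \<phi> fourier_schwartz by auto
  define n where "n k = real (Suc k)" for k
  have n: "n k > 0" for k by (simp add: n_def)
  have lim: "(\<lambda>k. s / n k) \<longlonglongrightarrow> 0" for s
    using LIMSEQ_Suc[OF lim_const_over_n[of s]] by (simp add: n_def)
  have "(\<lambda>k. \<integral>\<xi>. exp (\<i> * of_real (\<xi> * x)) * fourier \<phi> \<xi> * gaussian (\<xi> / n k) \<partial>lborel)
    \<longlonglongrightarrow> (\<integral>\<xi>. exp (\<i> * of_real (\<xi> * x)) * fourier \<phi> \<xi> \<partial>lborel)"
  proof (rule integral_dominated_convergence[where w = "\<lambda>\<xi>. cmod (fourier \<phi> \<xi>)"])
    show "integrable lborel (\<lambda>\<xi>. cmod (fourier \<phi> \<xi>))"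
      by (intro integrable_norm schwartz_integrable fourier_schwartz \<phi>)
    show "AE \<xi> in lborel. (\<lambda>k. exp (\<i> * of_real (\<xi> * x)) * fourier \<phi> \<xi> * gaussian (\<xi> / n k))
        \<longlonglongrightarrow> exp (\<i> * of_real (\<xi> * x)) * fourier \<phi> \<xi>"
    proof (rule AE_I2)
      fix \<xi>
      have "(\<lambda>k. gaussian (\<xi> / n k)) \<longlonglongrightarrow> gaussian 0"
        by (rule isCont_tendsto_compose[OF isCont_gaussian lim])
      from tendsto_mult_left[OF this]
      show "(\<lambda>k. exp (\<i> * of_real (\<xi> * x)) * fourier \<phi> \<xi> * gaussian (\<xi> / n k))
        \<longlonglongrightarrow> exp (\<i> * of_real (\<xi> * x)) * fourier \<phi> \<xi>"
        by (metis gaussian_zero mult_1_right)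
    qed
    show "AE \<xi> in lborel. norm (exp (\<i> * of_real (\<xi> * x)) * fourier \<phi> \<xi> * gaussian (\<xi> / n k))
        \<le> cmod (fourier \<phi> \<xi>)" for k
      using cmod_gaussian_le by (intro AE_I2) (simp add: norm_mult mult_left_le)
  qed measurable
  moreover have "(\<lambda>k. \<integral>\<xi>. exp (\<i> * of_real (\<xi> * x)) * fourier \<phi> \<xi> * gaussian (\<xi> / n k) \<partial>lborel)
    \<longlonglongrightarrow> of_real (fourier_const * sqrt (2 * pi)) * (\<integral>s. \<phi> x * gaussian s \<partial>lborel)"
    unfolding inversion_regularized[OF \<phi> n]
  proof (rule tendsto_mult_left)
    obtain C where C: "C \<ge> 0" "\<And>x. cmod (\<phi> x) \<le> C" using schwartz_bounded[OF \<phi>] by metis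
    show "(\<lambda>k. \<integral>s. \<phi> (x + s / n k) * gaussian s \<partial>lborel) \<longlonglongrightarrow> (\<integral>s. \<phi> x * gaussian s \<partial>lborel)"
    proof (rule integral_dominated_convergence[where w = "\<lambda>s. C * cmod (gaussian s)"])
      show "integrable lborel (\<lambda>s. C * cmod (gaussian s))"
        by (intro integrable_mult_right integrable_norm schwartz_integrable gaussian_schwartz)
      show "AE s in lborel. (\<lambda>k. \<phi> (x + s / n k) * gaussian s) \<longlonglongrightarrow> \<phi> x * gaussian s"
      proof (rule AE_I2)
        fix s
        have "isCont \<phi> x"
          using schwartz_continuous[OF \<phi>, of UNIV] by (simp add: continuous_on_eq_continuous_at)
        moreover have "(\<lambda>k. x + s / n k) \<longlonglongrightarrow> x"
        proof -
          have "(\<lambda>k. x + s / n k) \<longlonglongrightarrow> x + 0" by (intro tendsto_add tendsto_const lim)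
          then show ?thesis by simp
        qed
        ultimately have "(\<lambda>k. \<phi> (x + s / n k)) \<longlonglongrightarrow> \<phi> x"
          by (rule isCont_tendsto_compose)
        then show "(\<lambda>k. \<phi> (x + s / n k) * gaussian s) \<longlonglongrightarrow> \<phi> x * gaussian s"
          by (rule tendsto_mult_right)
      qed
      show "AE s in lborel. norm (\<phi> (x + s / n k) * gaussian s) \<le> C * cmod (gaussian s)" for k
        using C(2) by (intro AE_I2) (simp add: norm_mult mult_right_mono)
    qed measurable
  qed
  ultimately have "(\<integral>\<xi>. exp (\<i> * of_real (\<xi> * x)) * fourier \<phi> \<xi> \<partial>lborel)
      = of_real (fourier_const * sqrt (2 * pi)) * (\<integral>s. \<phi> x * gaussian s \<partial>lborel)"
    by (rule LIMSEQ_unique)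
  then have "inv_fourier (fourier \<phi>) x
      = of_real fourier_const * (of_real (fourier_const * sqrt (2 * pi)) * (\<phi> x * of_real (sqrt (2 * pi))))"
    by (simp only: inv_fourier_eq integral_mult_right_zero gaussian_total)
  also have "\<dots> = of_real (fourier_const * fourier_const * (sqrt (2 * pi) * sqrt (2 * pi))) * \<phi> x"
    by (simp only: of_real_mult mult_ac)
  also have "fourier_const * fourier_const * (sqrt (2 * pi) * sqrt (2 * pi)) = 1"
    using fourier_const_sq by simp
  finally show ?thesis by simp
qed

lemma inv_fourier_eq_fourier_reflect: "inv_fourier f x = fourier (\<lambda>x. f (- x)) x"
proof -
  have "(\<integral>y. exp (\<i> * of_real (y * x)) * f y \<partial>lborel)
      = \<bar>-1\<bar> *\<^sub>R (\<integral>y. exp (\<i> * of_real ((0 + (-1) * y) * x)) * f (0 + (-1) * y) \<partial>lborel)"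
    by (rule lborel_integral_real_affine) simp
  then show ?thesis by (simp add: fourier_eq inv_fourier_eq mult.commute)
qed

theorem fourier_inv_fourier:
  assumes \<phi>: "\<phi> \<in> schwartz"
  shows "fourier (inv_fourier \<phi>) x = \<phi> x"
proof -
  have "fourier (inv_fourier \<phi>) x = fourier (\<lambda>x. fourier \<phi> (- x)) x"
    by (simp add: inv_fourier_reflect[abs_def])
  also have "\<dots> = inv_fourier (fourier \<phi>) x"
    by (simp add: inv_fourier_eq_fourier_reflect)
  finally show ?thesis using fourier_inversion[OF \<phi>] by simp
qed

lemma fourier_adjoint:
  assumes \<phi>: "\<phi> \<in> schwartz" and \<psi>: "\<psi> \<in> schwartz"
  shows "(\<integral>x. cnj (\<phi> x) * inv_fourier \<psi> x \<partial>lborel) = (\<integral>\<xi>. cnj (fourier \<phi> \<xi>) * \<psi> \<xi> \<partial>lborel)"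
proof -
  have "(\<integral>x. cnj (\<phi> x) * inv_fourier \<psi> x \<partial>lborel)
    = of_real fourier_const * (\<integral>x. (\<integral>\<xi>. \<psi> \<xi> * cnj (\<phi> x) * exp (\<i> * of_real (\<xi> * x)) \<partial>lborel) \<partial>lborel)"
  proof (subst integral_mult_right_zero[symmetric], rule Bochner_Integration.integral_cong[OF refl])
    fix x
    have "(\<integral>\<xi>. \<psi> \<xi> * cnj (\<phi> x) * exp (\<i> * of_real (\<xi> * x)) \<partial>lborel)
      = (\<integral>\<xi>. cnj (\<phi> x) * (exp (\<i> * of_real (\<xi> * x)) * \<psi> \<xi>) \<partial>lborel)"
      by (simp only: mult_ac)
    also have "\<dots> = cnj (\<phi> x) * (\<integral>\<xi>. exp (\<i> * of_real (\<xi> * x)) * \<psi> \<xi> \<partial>lborel)"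
      by (rule integral_mult_right_zero)
    finally show "cnj (\<phi> x) * inv_fourier \<psi> x
      = of_real fourier_const * (\<integral>\<xi>. \<psi> \<xi> * cnj (\<phi> x) * exp (\<i> * of_real (\<xi> * x)) \<partial>lborel)"
      unfolding inv_fourier_eq by (simp only: mult_ac)
  qed
  also have "(\<integral>x. (\<integral>\<xi>. \<psi> \<xi> * cnj (\<phi> x) * exp (\<i> * of_real (\<xi> * x)) \<partial>lborel) \<partial>lborel)
    = (\<integral>\<xi>. (\<integral>x. \<psi> \<xi> * cnj (\<phi> x) * exp (\<i> * of_real (\<xi> * x)) \<partial>lborel) \<partial>lborel)"
    by (rule fubini_bounded_kernel[OF schwartz_integrable[OF \<psi>] schwartz_integrable[OF schwartz_cnj[OF \<phi>]]
          character_measurable])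
      (auto simp: case_prod_beta' intro!: continuous_intros)
  also have "of_real fourier_const * \<dots> = (\<integral>\<xi>. cnj (fourier \<phi> \<xi>) * \<psi> \<xi> \<partial>lborel)"
  proof (subst integral_mult_right_zero[symmetric], rule Bochner_Integration.integral_cong[OF refl])
    fix \<xi>
    have "cnj (fourier \<phi> \<xi>) = of_real fourier_const * (\<integral>x. cnj (exp (- \<i> * of_real (\<xi> * x)) * \<phi> x) \<partial>lborel)"
      unfolding fourier_eq Bochner_Integration.integral_cnj by simp
    also have "(\<lambda>x. cnj (exp (- \<i> * of_real (\<xi> * x)) * \<phi> x)) = (\<lambda>x. exp (\<i> * of_real (\<xi> * x)) * cnj (\<phi> x))"
      by (simp add: exp_cnj)
    finally have c: "cnj (fourier \<phi> \<xi>) = of_real fourier_const * (\<integral>x. exp (\<i> * of_real (\<xi> * x)) * cnj (\<phi> x) \<partial>lborel)" .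
    have "(\<integral>x. \<psi> \<xi> * cnj (\<phi> x) * exp (\<i> * of_real (\<xi> * x)) \<partial>lborel)
      = (\<integral>x. \<psi> \<xi> * (exp (\<i> * of_real (\<xi> * x)) * cnj (\<phi> x)) \<partial>lborel)"
      by (simp only: mult_ac)
    also have "\<dots> = \<psi> \<xi> * (\<integral>x. exp (\<i> * of_real (\<xi> * x)) * cnj (\<phi> x) \<partial>lborel)"
      by (rule integral_mult_right_zero)
    finally show "of_real fourier_const * (\<integral>x. \<psi> \<xi> * cnj (\<phi> x) * exp (\<i> * of_real (\<xi> * x)) \<partial>lborel)
        = cnj (fourier \<phi> \<xi>) * \<psi> \<xi>"
      unfolding c by (simp only: mult_ac)
  qed
  finally show ?thesis .
qed

lemma fourier_parseval:
  assumes "\<phi> \<in> schwartz" "\<psi> \<in> schwartz"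
  shows "(\<integral>x. cnj (fourier \<phi> x) * fourier \<psi> x \<partial>lborel) = (\<integral>x. cnj (\<phi> x) * \<psi> x \<partial>lborel)"
  using fourier_adjoint[OF assms(1) fourier_schwartz[OF assms(2)]]
  by (simp add: fourier_inversion[OF assms(2)])

text \<open>At a fixed \<open>\<xi>\<close> this is the Parseval identity for \<open>\<phi>\<close> and \<open>\<psi>\<close> times the character of \<open>\<xi>\<close>, whose
  transform is a translate of that of \<open>\<psi>\<close>.\<close>

lemma fourier_product:
  assumes \<phi>: "\<phi> \<in> schwartz" and \<psi>: "\<psi> \<in> schwartz"
  shows "fourier (\<lambda>x. cnj (\<phi> x) * \<psi> x) \<xi>
    = of_real fourier_const * (\<integral>\<eta>. cnj (fourier \<phi> (\<eta> - \<xi>)) * fourier \<psi> \<eta> \<partial>lborel)"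
proof -
  have chi: "(\<lambda>x. exp (\<i> * of_real (\<xi> * x)) * cnj (\<psi> x)) \<in> schwartz"
    using schwartz_character[OF schwartz_cnj[OF \<psi>], of "- \<xi>"] by simp
  define u where "u x = exp (\<i> * of_real (\<xi> * x)) * cnj (\<psi> x)" for x
  have u: "(\<lambda>x. cnj (u x)) \<in> schwartz" "u \<in> schwartz"
    using chi schwartz_cnj[OF chi] by (simp_all add: u_def[abs_def])
  have cchi: "cnj (u x) = exp (- \<i> * of_real (\<xi> * x)) * \<psi> x" for x
    by (simp add: u_def exp_cnj)
  have ft: "fourier (\<lambda>x. cnj (u x)) \<eta> = fourier \<psi> (\<xi> + \<eta>)" for \<eta>
  proof -
    have "exp (- \<i> * of_real (\<eta> * x)) * (exp (- \<i> * of_real (\<xi> * x)) * \<psi> x)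
        = exp (- \<i> * of_real ((\<xi> + \<eta>) * x)) * \<psi> x" for x
    proof -
      have "exp (- \<i> * of_real (\<eta> * x)) * exp (- \<i> * of_real (\<xi> * x)) = exp (- \<i> * of_real ((\<xi> + \<eta>) * x))"
        unfolding exp_add[symmetric] by (simp add: algebra_simps)
      then show ?thesis by (simp only: mult.assoc[symmetric])
    qed
    then show ?thesis by (simp only: cchi fourier_eq)
  qed
  have "fourier (\<lambda>x. cnj (\<phi> x) * \<psi> x) \<xi> = of_real fourier_const * (\<integral>x. cnj (\<phi> x) * cnj (u x) \<partial>lborel)"
    by (simp add: fourier_eq cchi mult_ac)
  also have "(\<integral>x. cnj (\<phi> x) * cnj (u x) \<partial>lborel)
      = (\<integral>\<eta>. cnj (fourier \<phi> \<eta>) * fourier \<psi> (\<xi> + \<eta>) \<partial>lborel)"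
    using fourier_parseval[OF \<phi> u(1)] by (simp add: ft)
  also have "\<dots> = \<bar>1\<bar> *\<^sub>R (\<integral>\<eta>. cnj (fourier \<phi> (- \<xi> + 1 * \<eta>)) * fourier \<psi> (\<xi> + (- \<xi> + 1 * \<eta>)) \<partial>lborel)"
    by (rule lborel_integral_real_affine) simp
  also have "\<dots> = (\<integral>\<eta>. cnj (fourier \<phi> (\<eta> - \<xi>)) * fourier \<psi> \<eta> \<partial>lborel)"
    by simp
  finally show ?thesis .
qed

section \<open>Density of the Schwartz functions\<close>

text \<open>The positive and the negative part of the function are densities of two measures that agree on
  half-lines, hence are equal.\<close>

lemma AE_zero_if_halfline_integrals_zero:
  fixes k :: "real \<Rightarrow> real"
  assumes k: "integrable lborel k"
    and zero: "\<And>a. (\<integral>x. k x * indicator {a<..} x \<partial>lborel) = 0"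
  shows "AE x in lborel. k x = 0"
proof -
  note [measurable] = borel_measurable_integrable[OF k]
  define P where "P = density lborel (\<lambda>x. ennreal (max 0 (k x)))"
  define N where "N = density lborel (\<lambda>x. ennreal (max 0 (- k x)))"
  have ip: "integrable lborel (\<lambda>x. max 0 (k x))" and "integrable lborel (\<lambda>x. max 0 (- k x))"
    using k by (auto intro: integrable_max)
  have ind: "integrable lborel (\<lambda>x. f x * indicator {a<..} x)" if "integrable lborel f" for f :: "real \<Rightarrow> real" and a
    by (rule integrable_real_mult_indicator[OF _ that]) simp
  have em: "emeasure (density lborel (\<lambda>x. ennreal (f x))) {a<..} = ennreal (\<integral>x. f x * indicator {a<..} x \<partial>lborel)"
    if f: "integrable lborel f" "\<And>x. 0 \<le> f x" for f :: "real \<Rightarrow> real" and a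
  proof -
    have [measurable]: "f \<in> borel_measurable lborel" using f(1) by simp
    have "emeasure (density lborel (\<lambda>x. ennreal (f x))) {a<..}
        = (\<integral>\<^sup>+x. ennreal (f x) * indicator {a<..} x \<partial>lborel)"
      by (rule emeasure_density) auto
    also have "\<dots> = (\<integral>\<^sup>+x. ennreal (f x * indicator {a<..} x) \<partial>lborel)"
      by (intro nn_integral_cong) (auto simp: indicator_def)
    also have "\<dots> = ennreal (\<integral>x. f x * indicator {a<..} x \<partial>lborel)"
      using f by (intro nn_integral_eq_integral ind) auto
    finally show ?thesis .
  qed
  have eqm: "emeasure P {a<..} = emeasure N {a<..}" for a
  proof -
    have "(\<integral>x. max 0 (k x) * indicator {a<..} x \<partial>lborel) - (\<integral>x. max 0 (- k x) * indicator {a<..} x \<partial>lborel)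
      = (\<integral>x. max 0 (k x) * indicator {a<..} x - max 0 (- k x) * indicator {a<..} x \<partial>lborel)"
      by (intro Bochner_Integration.integral_diff[symmetric] ind) (use k in \<open>auto intro: integrable_max\<close>)
    also have "\<dots> = (\<integral>x. k x * indicator {a<..} x \<partial>lborel)"
      by (intro Bochner_Integration.integral_cong) (auto simp: max_def)
    finally have "(\<integral>x. max 0 (k x) * indicator {a<..} x \<partial>lborel) = (\<integral>x. max 0 (- k x) * indicator {a<..} x \<partial>lborel)"
      using zero[of a] by simp
    then show ?thesis
      unfolding P_def N_def by (subst (1 2) em) (use k in \<open>auto intro: integrable_max\<close>)
  qed
  have "P = N"
  proof (rule measure_eqI_generator_eq[where E = "range greaterThan" and \<Omega> = UNIV and A = "\<lambda>n. {- real n<..}"])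
    show "Int_stable (range greaterThan :: real set set)"
    proof (rule Int_stableI)
      fix A B :: "real set" assume "A \<in> range greaterThan" "B \<in> range greaterThan"
      then obtain a b where "A = {a<..}" "B = {b<..}" by auto
      then have "A \<inter> B = {max a b<..}" by auto
      then show "A \<inter> B \<in> range greaterThan" by simp
    qed
    show "sets P = sigma_sets UNIV (range greaterThan)" "sets N = sigma_sets UNIV (range greaterThan)"
      by (simp_all add: P_def N_def) (simp_all add: borel_Ioi)
    show "(\<Union>i. {- real i<..}) = UNIV"
    proof (intro equalityI subsetI UNIV_I)
      fix x :: real
      obtain n where "- x < real n" using reals_Archimedean2 by blast
      then show "x \<in> (\<Union>i. {- real i<..})" by (auto intro!: exI[of _ n])
    qed
    show "emeasure P {- real i<..} \<noteq> \<infinity>" for i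
      unfolding P_def by (subst em) (use ip in auto)
  qed (auto simp: eqm)
  then have "AE x in lborel. ennreal (max 0 (k x)) = ennreal (max 0 (- k x))"
    unfolding P_def N_def by (subst (asm) sigma_finite_measure.density_unique_iff[OF sigma_finite_lborel]) auto
  then show ?thesis
    by eventually_elim (auto simp: max_def split: if_splits)
qed

lemma AE_zero_if_halfline_integrals_zero_complex:
  fixes h :: "real \<Rightarrow> complex"
  assumes h: "integrable lborel h"
    and zero: "\<And>a. (\<integral>x. h x * of_real (indicator {a<..} x) \<partial>lborel) = 0"
  shows "AE x in lborel. h x = 0"
proof -
  have ind: "integrable lborel (\<lambda>x. h x * of_real (indicator {a<..} x))" for a
  proof (rule Bochner_Integration.integrable_bound[OF h])
    show "(\<lambda>x. h x * of_real (indicator {a<..} x)) \<in> borel_measurable lborel"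
      using borel_measurable_integrable[OF h] by measurable
  qed (auto simp: indicator_def)
  have "AE x in lborel. Re (h x) = 0"
  proof (rule AE_zero_if_halfline_integrals_zero)
    show "integrable lborel (\<lambda>x. Re (h x))" using h by simp
    show "(\<integral>x. Re (h x) * indicator {a<..} x \<partial>lborel) = 0" for a
      using arg_cong[OF zero[of a], of Re] integral_Re[OF ind[of a]] by simp
  qed
  moreover have "AE x in lborel. Im (h x) = 0"
  proof (rule AE_zero_if_halfline_integrals_zero)
    show "integrable lborel (\<lambda>x. Im (h x))" using h by simp
    show "(\<integral>x. Im (h x) * indicator {a<..} x \<partial>lborel) = 0" for a
      using arg_cong[OF zero[of a], of Im] integral_Im[OF ind[of a]] by simp
  qed
  ultimately show ?thesis
    by eventually_elim (simp add: complex_eq_iff)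
qed

text \<open>The test functions \<open>(1 + tanh (n (x - a))) / 2\<close> times a Gaussian converge to the Gaussian
  cut off at the left of \<open>a\<close>. In the limit the integral of \<open>f\<close> times the Gaussian vanishes over every
  half-line. The Gaussian makes the product integrable.\<close>

lemma schwartz_annihilator_trivial:
  assumes f: "\<And>\<psi>. \<psi> \<in> schwartz \<Longrightarrow> cinner (abs_l2 \<psi>) f = 0"
  shows "f = 0"
proof -
  define h where "h x = gaussian x * rep_l2 f x" for x
  have cg: "cnj (gaussian x) = gaussian x" for x by (simp add: gaussian_def)
  have h: "integrable lborel h"
    using square_integrable_mult[OF schwartz_square_integrable[OF gaussian_schwartz] square_integrable_rep[of f]]
    by (simp add: cg h_def[abs_def])
  note [measurable] = borel_measurable_integrable[OF h]
  have hl: "(\<integral>x. h x * of_real (indicator {a<..} x) \<partial>lborel) = 0" for a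
  proof -
    define t where "t n x = (1 + tanh (real n * (x - a))) / 2" for n x
    have t_bound: "\<bar>t n x\<bar> \<le> 1" for n x
      using tanh_real_bounds[of "real n * (x - a)"] by (simp add: t_def abs_le_iff)
    have [measurable]: "t n \<in> borel_measurable borel" for n
      unfolding t_def[abs_def] by (intro borel_measurable_continuous_onI continuous_intros) simp_all
    have "(\<integral>x. h x * of_real (t n x) \<partial>lborel) = 0" for n
    proof -
      have "(\<lambda>x. of_real (tanh (real n * (x - a))) * gaussian x) \<in> schwartz"
        by (rule schwartz_mult_moderate[OF moderate_tanh gaussian_schwartz])
      from schwartz_scale[OF schwartz_add[OF gaussian_schwartz this], of "1/2"]
      have s: "(\<lambda>x. of_real (t n x) * gaussian x) \<in> schwartz"
        by (simp add: t_def algebra_simps add_divide_distrib)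
      have "(\<integral>x. h x * of_real (t n x) \<partial>lborel) = cinner (abs_l2 (\<lambda>x. of_real (t n x) * gaussian x)) f"
        unfolding cinner_abs_left[OF schwartz_square_integrable[OF s]]
        by (intro Bochner_Integration.integral_cong) (auto simp: h_def cg)
      then show ?thesis using f[OF s] by simp
    qed
    moreover have "(\<lambda>n. \<integral>x. h x * of_real (t n x) \<partial>lborel)
        \<longlonglongrightarrow> (\<integral>x. h x * of_real (indicator {a<..} x) \<partial>lborel)"
    proof (rule integral_dominated_convergence[where w = "\<lambda>x. cmod (h x)"])
      show "integrable lborel (\<lambda>x. cmod (h x))" using h by (rule integrable_norm)
      have "AE x in lborel. x \<noteq> a" by (rule AE_lborel_singleton)
      then show "AE x in lborel. (\<lambda>n. h x * of_real (t n x)) \<longlonglongrightarrow> h x * of_real (indicator {a<..} x)"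
      proof eventually_elim
        case (elim x)
        have "(\<lambda>n. t n x) \<longlonglongrightarrow> indicator {a<..} x"
        proof (cases "x > a")
          case True
          have "filterlim (\<lambda>n. real n * (x - a)) at_top sequentially"
            using True by (intro filterlim_at_top_mult_tendsto_pos[OF tendsto_const _ filterlim_real_sequentially]) auto
          then have "(\<lambda>n. tanh (real n * (x - a))) \<longlonglongrightarrow> 1"
            by (rule filterlim_compose[OF tanh_real_at_top])
          then have "(\<lambda>n. (1 + tanh (real n * (x - a))) / 2) \<longlonglongrightarrow> (1 + 1) / 2"
            by (intro tendsto_intros) auto
          then show ?thesis using True by (simp add: t_def)
        next
          case False
          have "filterlim (\<lambda>n. real n * (a - x)) at_top sequentially"
            using False elim by (intro filterlim_at_top_mult_tendsto_pos[OF tendsto_const _ filterlim_real_sequentially]) auto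
          then have "(\<lambda>n. tanh (real n * (a - x))) \<longlonglongrightarrow> 1"
            by (rule filterlim_compose[OF tanh_real_at_top])
          then have "(\<lambda>n. (1 - tanh (real n * (a - x))) / 2) \<longlonglongrightarrow> (1 - 1) / 2"
            by (intro tendsto_intros) auto
          moreover have "tanh (real n * (x - a)) = - tanh (real n * (a - x))" for n
            unfolding tanh_minus[symmetric] by (simp add: algebra_simps)
          ultimately show ?thesis using False by (simp add: t_def)
        qed
        then show ?case by (intro tendsto_mult_left tendsto_of_real)
      qed
      show "AE x in lborel. norm (h x * of_real (t n x)) \<le> cmod (h x)" for n
        using t_bound by (intro AE_I2) (simp add: norm_mult mult_left_le)
    qed measurable
    ultimately show ?thesis using LIMSEQ_unique[OF _ tendsto_const] by fastforce
  qed
  have "AE x in lborel. h x = 0"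
    by (rule AE_zero_if_halfline_integrals_zero_complex[OF h hl])
  then have "AE x in lborel. rep_l2 f x = 0"
    by eventually_elim (simp add: h_def gaussian_def)
  then have "AE x in lborel. rep_l2 f x = rep_l2 0 x"
    using rep_zero by eventually_elim simp
  then show ?thesis by (rule l2_eqI)
qed

lemma abs_l2_add: "square_integrable f \<Longrightarrow> square_integrable g \<Longrightarrow> abs_l2 f + abs_l2 g = abs_l2 (\<lambda>x. f x + g x)"
  by (simp add: plus_l2.abs_eq l2_rel_refl)

lemma abs_l2_scale: "square_integrable f \<Longrightarrow> c *\<^sub>C abs_l2 f = abs_l2 (\<lambda>x. c * f x)"
  by (simp add: scaleC.abs_eq l2_rel_refl)

lemma schwartz_subspace: "l2.subspace (abs_l2 ` schwartz)"
  unfolding l2.subspace_def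
proof (intro conjI ballI allI)
  have "(\<lambda>x. 0 * gaussian x) \<in> schwartz" by (rule schwartz_scale[OF gaussian_schwartz])
  then show "0 \<in> abs_l2 ` schwartz"
    by (intro image_eqI[of _ _ "\<lambda>x. 0"]) (simp_all add: zero_l2.abs_eq)
next
  fix f g assume "f \<in> abs_l2 ` schwartz" "g \<in> abs_l2 ` schwartz"
  then obtain \<phi> \<psi> where "f = abs_l2 \<phi>" "g = abs_l2 \<psi>" "\<phi> \<in> schwartz" "\<psi> \<in> schwartz" by auto
  then show "f + g \<in> abs_l2 ` schwartz"
    by (simp add: abs_l2_add schwartz_square_integrable schwartz_add)
next
  fix c f assume "f \<in> abs_l2 ` schwartz"
  then obtain \<phi> where "f = abs_l2 \<phi>" "\<phi> \<in> schwartz" by auto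
  then show "c *\<^sub>C f \<in> abs_l2 ` schwartz"
    by (simp add: abs_l2_scale schwartz_square_integrable schwartz_scale)
qed

theorem schwartz_dense: "closure (abs_l2 ` schwartz) = UNIV"
  by (rule dense_if_annihilator_trivial[OF schwartz_subspace])
    (rule schwartz_annihilator_trivial, blast)

lemma schwartz_approximation:
  obtains \<phi> where "\<And>n. \<phi> n \<in> schwartz" "(\<lambda>n. abs_l2 (\<phi> n)) \<longlonglongrightarrow> f"
proof -
  have "f \<in> closure (abs_l2 ` schwartz)" by (simp add: schwartz_dense)
  then obtain a where a: "\<And>n. a n \<in> abs_l2 ` schwartz" "a \<longlonglongrightarrow> f"
    unfolding closure_sequential by blast
  then have "\<forall>n. \<exists>\<phi>. \<phi> \<in> schwartz \<and> a n = abs_l2 \<phi>" by (auto simp: image_iff)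
  from choice[OF this] obtain \<phi> where \<phi>: "\<forall>n. \<phi> n \<in> schwartz \<and> a n = abs_l2 (\<phi> n)" by (rule exE)
  then have "a = (\<lambda>n. abs_l2 (\<phi> n))" by auto
  with a(2) \<phi> show ?thesis by (intro that[of \<phi>]) auto
qed

lemma l2_eq_if_schwartz_pairings_eq:
  assumes "\<And>\<psi>. \<psi> \<in> schwartz \<Longrightarrow> cinner (abs_l2 \<psi>) f = cinner (abs_l2 \<psi>) g"
  shows "f = g"
  using schwartz_annihilator_trivial[of "f - g"] assms by (simp add: cinner_diff_right)

section \<open>The Fourier transform on the space of square integrable functions\<close>

lemma norm_diff_eq_of_cinner_eq:
  assumes "cinner a a = cinner a' a'" "cinner a b = cinner a' b'" "cinner b b = cinner b' b'"
  shows "norm (a - b) = norm (a' - b')"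
proof -
  have "cinner b a = cinner b' a'"
    using assms(2) cinner_commute[of b a] cinner_commute[of b' a'] by simp
  then have "cinner (a - b) (a - b) = cinner (a' - b') (a' - b')"
    using assms by (simp add: cinner_diff_left cinner_diff_right)
  then have "(norm (a - b))\<^sup>2 = (norm (a' - b'))\<^sup>2"
    unfolding cinner_self of_real_eq_iff .
  then show ?thesis by (simp add: power2_eq_iff_nonneg)
qed

text \<open>An isometry of the Schwartz functions extends to the whole space by density and
  completeness.\<close>

lemma isometry_extension:
  assumes T: "\<And>\<phi>. \<phi> \<in> schwartz \<Longrightarrow> T \<phi> \<in> schwartz"
    and iso: "\<And>\<phi> \<psi>. \<phi> \<in> schwartz \<Longrightarrow> \<psi> \<in> schwartz \<Longrightarrow>
      cinner (abs_l2 (T \<phi>)) (abs_l2 (T \<psi>)) = cinner (abs_l2 \<phi>) (abs_l2 \<psi>)"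
  shows "\<exists>g. norm g = norm f \<and> (\<forall>\<phi>\<in>schwartz. cinner (abs_l2 (T \<phi>)) g = cinner (abs_l2 \<phi>) f)"
proof -
  obtain \<phi> where \<phi>: "\<And>n. \<phi> n \<in> schwartz" "(\<lambda>n. abs_l2 (\<phi> n)) \<longlonglongrightarrow> f"
    using schwartz_approximation[of f] by metis
  have nd: "norm (abs_l2 (T (\<phi> m)) - abs_l2 (T (\<phi> n))) = norm (abs_l2 (\<phi> m) - abs_l2 (\<phi> n))" for m n
    by (rule norm_diff_eq_of_cinner_eq) (simp_all add: iso \<phi>)
  have "Cauchy (\<lambda>n. abs_l2 (\<phi> n))" using \<phi>(2) by (simp add: LIMSEQ_imp_Cauchy)
  then have "Cauchy (\<lambda>n. abs_l2 (T (\<phi> n)))"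
    unfolding Cauchy_def dist_norm nd .
  then obtain g where g: "(\<lambda>n. abs_l2 (T (\<phi> n))) \<longlonglongrightarrow> g"
    by (auto simp: Cauchy_convergent_iff convergent_def)
  have nn: "norm (abs_l2 (T (\<phi> n))) = norm (abs_l2 (\<phi> n))" for n
    using norm_diff_eq_of_cinner_eq[of "abs_l2 (T (\<phi> n))" "abs_l2 (\<phi> n)" 0 0] by (simp add: iso \<phi>)
  have "(\<lambda>n. norm (abs_l2 (\<phi> n))) \<longlonglongrightarrow> norm g"
    using tendsto_norm[OF g] by (simp add: nn)
  then have "norm g = norm f" using tendsto_norm[OF \<phi>(2)] by (rule LIMSEQ_unique)
  moreover have "cinner (abs_l2 (T \<psi>)) g = cinner (abs_l2 \<psi>) f" if "\<psi> \<in> schwartz" for \<psi>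
  proof -
    have "(\<lambda>n. cinner (abs_l2 \<psi>) (abs_l2 (\<phi> n))) \<longlonglongrightarrow> cinner (abs_l2 (T \<psi>)) g"
      using tendsto_cinner[OF tendsto_const g, of "abs_l2 (T \<psi>)"] by (simp add: iso that \<phi>)
    then show ?thesis
      using tendsto_cinner[OF tendsto_const \<phi>(2), of "abs_l2 \<psi>"] by (rule LIMSEQ_unique)
  qed
  ultimately show ?thesis by blast
qed

lemma fourier_inv_fourier': "\<phi> \<in> schwartz \<Longrightarrow> fourier (inv_fourier \<phi>) = \<phi>"
  and fourier_inversion': "\<phi> \<in> schwartz \<Longrightarrow> inv_fourier (fourier \<phi>) = \<phi>"
  by (auto simp: fourier_inv_fourier fourier_inversion)

lemma cinner_fourier:
  assumes "\<phi> \<in> schwartz" "\<psi> \<in> schwartz"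
  shows "cinner (abs_l2 (fourier \<phi>)) (abs_l2 (fourier \<psi>)) = cinner (abs_l2 \<phi>) (abs_l2 \<psi>)"
  using fourier_parseval[OF assms]
  by (simp add: cinner_abs schwartz_square_integrable fourier_schwartz assms)

lemma cinner_inv_fourier:
  assumes "\<phi> \<in> schwartz" "\<psi> \<in> schwartz"
  shows "cinner (abs_l2 (inv_fourier \<phi>)) (abs_l2 (inv_fourier \<psi>)) = cinner (abs_l2 \<phi>) (abs_l2 \<psi>)"
  using cinner_fourier[of "inv_fourier \<phi>" "inv_fourier \<psi>"]
  by (simp add: fourier_inv_fourier' inv_fourier_schwartz assms)

text \<open>By density of the Schwartz functions the choice is unique.\<close>

definition fourier_l2 :: "l2 \<Rightarrow> l2" where
  "fourier_l2 f = (SOME g. norm g = norm f \<and>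
     (\<forall>\<phi>\<in>schwartz. cinner (abs_l2 (fourier \<phi>)) g = cinner (abs_l2 \<phi>) f))"

lemma norm_fourier_l2 [simp]: "norm (fourier_l2 f) = norm f"
  and cinner_fourier_l2: "\<phi> \<in> schwartz \<Longrightarrow> cinner (abs_l2 (fourier \<phi>)) (fourier_l2 f) = cinner (abs_l2 \<phi>) f"
  using someI_ex[OF isometry_extension[OF fourier_schwartz cinner_fourier, of f]]
  unfolding fourier_l2_def[symmetric] by auto

lemma cinner_inv_fourier_schwartz:
  "\<psi> \<in> schwartz \<Longrightarrow> cinner (abs_l2 (inv_fourier \<psi>)) f = cinner (abs_l2 \<psi>) (fourier_l2 f)"
  using cinner_fourier_l2[OF inv_fourier_schwartz, of \<psi> f] by (simp add: fourier_inv_fourier')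

lemma fourier_l2_eqI:
  assumes "\<And>\<phi>. \<phi> \<in> schwartz \<Longrightarrow> cinner (abs_l2 (fourier \<phi>)) g = cinner (abs_l2 \<phi>) f"
  shows "fourier_l2 f = g"
proof (rule l2_eq_if_schwartz_pairings_eq)
  fix \<psi> assume \<psi>: "\<psi> \<in> schwartz"
  show "cinner (abs_l2 \<psi>) (fourier_l2 f) = cinner (abs_l2 \<psi>) g"
    using assms[OF inv_fourier_schwartz[OF \<psi>]]
    by (simp add: cinner_inv_fourier_schwartz \<psi> fourier_inv_fourier')
qed

lemma fourier_l2_schwartz: "\<phi> \<in> schwartz \<Longrightarrow> fourier_l2 (abs_l2 \<phi>) = abs_l2 (fourier \<phi>)"
  by (rule fourier_l2_eqI) (simp add: cinner_fourier)

lemma bounded_clinear_fourier_l2: "bounded_clinear fourier_l2"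
proof (rule bounded_clinearI)
  show "fourier_l2 (f + g) = fourier_l2 f + fourier_l2 g" for f g
    by (rule fourier_l2_eqI) (simp add: cinner_add_right cinner_fourier_l2)
  show "fourier_l2 (c *\<^sub>C f) = c *\<^sub>C fourier_l2 f" for c f
    by (rule fourier_l2_eqI) (simp add: cinner_scale_right cinner_fourier_l2)
  show "norm (fourier_l2 f) \<le> 1 * norm f" for f by simp
qed

lemmas fourier_l2_add = bounded_clinear_add[OF bounded_clinear_fourier_l2]
  and fourier_l2_scale = bounded_clinear_scale[OF bounded_clinear_fourier_l2]
  and fourier_l2_diff = bounded_clinear_diff[OF bounded_clinear_fourier_l2]

lemma bij_fourier_l2: "bij fourier_l2"
proof (rule bijI)
  show "inj fourier_l2"
  proof (rule injI)
    fix f g assume "fourier_l2 f = fourier_l2 g"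
    then have "norm (f - g) = 0" by (metis fourier_l2_diff norm_fourier_l2 right_minus_eq norm_zero)
    then show "f = g" by simp
  qed
  show "surj fourier_l2"
  proof (rule surjI)
    fix g
    obtain f where f: "\<And>\<phi>. \<phi> \<in> schwartz \<Longrightarrow> cinner (abs_l2 (inv_fourier \<phi>)) f = cinner (abs_l2 \<phi>) g"
      using isometry_extension[OF inv_fourier_schwartz cinner_inv_fourier, of g] by blast
    have "\<exists>f. fourier_l2 f = g"
    proof (intro exI fourier_l2_eqI)
      fix \<phi> assume "\<phi> \<in> schwartz"
      then show "cinner (abs_l2 (fourier \<phi>)) g = cinner (abs_l2 \<phi>) f"
        using f[OF fourier_schwartz] by (simp add: fourier_inversion')
    qed
    then show "fourier_l2 (SOME f. fourier_l2 f = g) = g" by (rule someI_ex)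
  qed
qed

definition inv_fourier_l2 :: "l2 \<Rightarrow> l2" where
  "inv_fourier_l2 = inv fourier_l2"

lemma fourier_inv_l2 [simp]: "fourier_l2 (inv_fourier_l2 f) = f"
  and inv_fourier_l2 [simp]: "inv_fourier_l2 (fourier_l2 f) = f"
  using bij_fourier_l2 by (simp_all add: inv_fourier_l2_def bij_is_surj surj_f_inv_f bij_is_inj)

lemma fourier_l2_eq_iff: "fourier_l2 f = fourier_l2 g \<longleftrightarrow> f = g"
  by (metis inv_fourier_l2)

lemma norm_inv_fourier_l2 [simp]: "norm (inv_fourier_l2 f) = norm f"
  by (metis fourier_inv_l2 norm_fourier_l2)

lemma bounded_clinear_inv_fourier_l2: "bounded_clinear inv_fourier_l2"
proof (rule bounded_clinearI)
  show "inv_fourier_l2 (f + g) = inv_fourier_l2 f + inv_fourier_l2 g" for f g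
    by (metis fourier_inv_l2 fourier_l2_add inv_fourier_l2)
  show "inv_fourier_l2 (c *\<^sub>C f) = c *\<^sub>C inv_fourier_l2 f" for c f
    by (metis fourier_inv_l2 fourier_l2_scale inv_fourier_l2)
  show "norm (inv_fourier_l2 f) \<le> 1 * norm f" for f by simp
qed

lemma cinner_inv_fourier_l2:
  "\<psi> \<in> schwartz \<Longrightarrow> cinner (abs_l2 \<psi>) (inv_fourier_l2 g) = cinner (abs_l2 (fourier \<psi>)) g"
  using cinner_fourier_l2[of \<psi> "inv_fourier_l2 g"] by simp

section \<open>Multiplication operators and operators with square integrable kernel\<close>

definition bounded_symbol :: "(real \<Rightarrow> complex) \<Rightarrow> bool" where
  "bounded_symbol a \<longleftrightarrow> a \<in> borel_measurable borel \<and> (\<exists>C. \<forall>x. cmod (a x) \<le> C)"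

definition mul_l2 :: "(real \<Rightarrow> complex) \<Rightarrow> l2 \<Rightarrow> l2" where
  "mul_l2 a f = abs_l2 (\<lambda>x. a x * rep_l2 f x)"

lemma square_integrable_mult_bounded:
  assumes "bounded_symbol a" "square_integrable f"
  shows "square_integrable (\<lambda>x. a x * f x)"
proof -
  obtain C where C: "\<And>x. cmod (a x) \<le> C" and [measurable]: "a \<in> borel_measurable borel"
    using assms(1) by (auto simp: bounded_symbol_def)
  have [measurable]: "f \<in> borel_measurable borel" using assms(2) by (simp add: square_integrable_def)
  show ?thesis
    by (rule square_integrable_bound[OF assms(2), of _ C])
      (use C in \<open>auto simp: norm_mult intro!: AE_I2 mult_right_mono\<close>)
qed

lemma rep_mul_l2:
  "bounded_symbol a \<Longrightarrow> AE x in lborel. rep_l2 (mul_l2 a f) x = a x * rep_l2 f x"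
  unfolding mul_l2_def by (intro rep_abs_l2 square_integrable_mult_bounded) auto

lemma bounded_clinear_mul_l2:
  assumes a: "bounded_symbol a"
  shows "bounded_clinear (mul_l2 a)"
proof -
  obtain C where C: "\<And>x. cmod (a x) \<le> C" and [measurable]: "a \<in> borel_measurable borel"
    using a by (auto simp: bounded_symbol_def)
  have "0 \<le> C" using order_trans[OF norm_ge_zero C] .
  show ?thesis
  proof (rule bounded_clinearI)
    show "mul_l2 a (f + g) = mul_l2 a f + mul_l2 a g" for f g
      by (rule l2_eqI) (use rep_mul_l2[OF a, of "f + g"] rep_mul_l2[OF a, of f] rep_mul_l2[OF a, of g]
          rep_plus[of f g] rep_plus[of "mul_l2 a f" "mul_l2 a g"] in eventually_elim, simp add: distrib_left)
    show "mul_l2 a (c *\<^sub>C f) = c *\<^sub>C mul_l2 a f" for c f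
      by (rule l2_eqI) (use rep_mul_l2[OF a, of "c *\<^sub>C f"] rep_mul_l2[OF a, of f]
          rep_scaleC[of c f] rep_scaleC[of c "mul_l2 a f"] in eventually_elim, simp)
    show "norm (mul_l2 a f) \<le> C * norm f" for f
    proof (rule power2_le_imp_le)
      have "(norm (mul_l2 a f))\<^sup>2 = (\<integral>x. (cmod (a x * rep_l2 f x))\<^sup>2 \<partial>lborel)"
        unfolding mul_l2_def by (intro norm_abs_l2_sq square_integrable_mult_bounded a square_integrable_rep)
      also have "\<dots> \<le> (\<integral>x. C\<^sup>2 * (cmod (rep_l2 f x))\<^sup>2 \<partial>lborel)"
      proof (rule integral_mono)
        show "integrable lborel (\<lambda>x. (cmod (a x * rep_l2 f x))\<^sup>2)"
          using square_integrable_mult_bounded[OF a square_integrable_rep[of f]]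
          by (simp add: square_integrable_def)
        show "integrable lborel (\<lambda>x. C\<^sup>2 * (cmod (rep_l2 f x))\<^sup>2)"
          using square_integrable_rep[of f] by (simp add: square_integrable_def)
        show "(cmod (a x * rep_l2 f x))\<^sup>2 \<le> C\<^sup>2 * (cmod (rep_l2 f x))\<^sup>2" for x
          using C[of x] by (auto simp: norm_mult power_mult_distrib intro!: mult_right_mono power_mono)
      qed
      also have "\<dots> = (C * norm f)\<^sup>2" by (simp add: norm_l2_sq power_mult_distrib)
      finally show "(norm (mul_l2 a f))\<^sup>2 \<le> (C * norm f)\<^sup>2" .
    qed (use \<open>0 \<le> C\<close> in simp)
  qed
qed

definition l2_kernel :: "(real \<Rightarrow> real \<Rightarrow> complex) \<Rightarrow> bool" where
  "l2_kernel k \<longleftrightarrow> case_prod k \<in> borel_measurable (lborel \<Otimes>\<^sub>M lborel) \<and>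
     integrable (lborel \<Otimes>\<^sub>M lborel) (\<lambda>(x, y). (cmod (k x y))\<^sup>2)"

definition kernel_norm :: "(real \<Rightarrow> real \<Rightarrow> complex) \<Rightarrow> real" where
  "kernel_norm k = sqrt (\<integral>(x, y). (cmod (k x y))\<^sup>2 \<partial>(lborel \<Otimes>\<^sub>M lborel))"

definition kernel_op :: "(real \<Rightarrow> real \<Rightarrow> complex) \<Rightarrow> l2 \<Rightarrow> l2" where
  "kernel_op k f = abs_l2 (\<lambda>x. \<integral>y. k x y * rep_l2 f y \<partial>lborel)"

lemma l2_kernel_measurable1: "l2_kernel k \<Longrightarrow> k x \<in> borel_measurable lborel"
  unfolding l2_kernel_def using measurable_Pair2[of "case_prod k" lborel lborel borel x] by simp

lemma l2_kernel_section:
  assumes "l2_kernel k"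
  shows "AE x in lborel. square_integrable (k x)"
proof -
  have "AE x in lborel. integrable lborel (\<lambda>y. (cmod (k x y))\<^sup>2)"
    using assms by (intro lborel_pair.AE_integrable_fst) (simp add: l2_kernel_def)
  then show ?thesis
    by eventually_elim (use l2_kernel_measurable1[OF assms] in \<open>simp add: square_integrable_def\<close>)
qed

lemma l2_kernel_sq_integral:
  assumes "l2_kernel k"
  shows "integrable lborel (\<lambda>x. \<integral>y. (cmod (k x y))\<^sup>2 \<partial>lborel)"
    and "(\<integral>x. (\<integral>y. (cmod (k x y))\<^sup>2 \<partial>lborel) \<partial>lborel) = (kernel_norm k)\<^sup>2"
proof -
  have i: "integrable (lborel \<Otimes>\<^sub>M lborel) (\<lambda>(x, y). (cmod (k x y))\<^sup>2)"
    using assms by (simp add: l2_kernel_def)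
  show "integrable lborel (\<lambda>x. \<integral>y. (cmod (k x y))\<^sup>2 \<partial>lborel)"
    by (rule lborel_pair.integrable_fst[OF i])
  have "0 \<le> (\<integral>(x, y). (cmod (k x y))\<^sup>2 \<partial>(lborel \<Otimes>\<^sub>M lborel))"
    by (rule Bochner_Integration.integral_nonneg) auto
  then show "(\<integral>x. (\<integral>y. (cmod (k x y))\<^sup>2 \<partial>lborel) \<partial>lborel) = (kernel_norm k)\<^sup>2"
    using lborel_pair.integral_fst[OF i] by (simp add: kernel_norm_def)
qed

text \<open>By the Cauchy-Schwarz inequality a square integrable section of a kernel acts as a bounded functional.\<close>

lemma kernel_functional_linear:
  assumes "square_integrable k"
  shows "(\<integral>y. k y * rep_l2 (f + g) y \<partial>lborel) = (\<integral>y. k y * rep_l2 f y \<partial>lborel) + (\<integral>y. k y * rep_l2 g y \<partial>lborel)"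
    "(\<integral>y. k y * rep_l2 (c *\<^sub>C f) y \<partial>lborel) = c * (\<integral>y. k y * rep_l2 f y \<partial>lborel)"
    "cmod (\<integral>y. k y * rep_l2 f y \<partial>lborel) \<le> sqrt (\<integral>y. (cmod (k y))\<^sup>2 \<partial>lborel) * norm f"
proof -
  have si: "square_integrable (\<lambda>y. cnj (k y))"
    using assms cnj_measurable by (auto simp: square_integrable_def)
  have *: "(\<integral>y. k y * rep_l2 f y \<partial>lborel) = cinner (abs_l2 (\<lambda>y. cnj (k y))) f" for f
    using cinner_abs_left[OF si, of f] by simp
  have n: "norm (abs_l2 (\<lambda>y. cnj (k y))) = sqrt (\<integral>y. (cmod (k y))\<^sup>2 \<partial>lborel)"
    using norm_abs_l2_sq[OF si] by (simp add: real_sqrt_unique)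
  show "(\<integral>y. k y * rep_l2 (f + g) y \<partial>lborel) = (\<integral>y. k y * rep_l2 f y \<partial>lborel) + (\<integral>y. k y * rep_l2 g y \<partial>lborel)"
    "(\<integral>y. k y * rep_l2 (c *\<^sub>C f) y \<partial>lborel) = c * (\<integral>y. k y * rep_l2 f y \<partial>lborel)"
    "cmod (\<integral>y. k y * rep_l2 f y \<partial>lborel) \<le> sqrt (\<integral>y. (cmod (k y))\<^sup>2 \<partial>lborel) * norm f"
    unfolding * by (simp_all add: cinner_add_right cinner_scale_right cauchy_schwarz_l2 flip: n)
qed

lemma kernel_function_measurable:
  assumes "l2_kernel k"
  shows "(\<lambda>x. \<integral>y. k x y * rep_l2 f y \<partial>lborel) \<in> borel_measurable lborel"
proof -
  have [measurable]: "case_prod k \<in> borel_measurable (lborel \<Otimes>\<^sub>M lborel)"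
    using assms by (simp add: l2_kernel_def)
  show ?thesis by measurable
qed

lemma kernel_function_sq_le:
  assumes "l2_kernel k"
  shows "AE x in lborel. (cmod (\<integral>y. k x y * rep_l2 f y \<partial>lborel))\<^sup>2
    \<le> (\<integral>y. (cmod (k x y))\<^sup>2 \<partial>lborel) * (norm f)\<^sup>2"
  using l2_kernel_section[OF assms]
proof eventually_elim
  case (elim x)
  have "0 \<le> (\<integral>y. (cmod (k x y))\<^sup>2 \<partial>lborel)" by (rule Bochner_Integration.integral_nonneg) simp
  then show ?case
    using power_mono[OF kernel_functional_linear(3)[OF elim, of f] norm_ge_zero, of 2]
    by (simp add: power_mult_distrib)
qed

lemma square_integrable_kernel_function:
  assumes k: "l2_kernel k"
  shows "square_integrable (\<lambda>x. \<integral>y. k x y * rep_l2 f y \<partial>lborel)"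
proof -
  have "integrable lborel (\<lambda>x. (cmod (\<integral>y. k x y * rep_l2 f y \<partial>lborel))\<^sup>2)"
  proof (rule Bochner_Integration.integrable_bound)
    show "integrable lborel (\<lambda>x. (\<integral>y. (cmod (k x y))\<^sup>2 \<partial>lborel) * (norm f)\<^sup>2)"
      by (intro integrable_mult_left l2_kernel_sq_integral(1) k)
    show "AE x in lborel. norm ((cmod (\<integral>y. k x y * rep_l2 f y \<partial>lborel))\<^sup>2)
        \<le> norm ((\<integral>y. (cmod (k x y))\<^sup>2 \<partial>lborel) * (norm f)\<^sup>2)"
      using kernel_function_sq_le[OF k] by eventually_elim simp
  qed (use kernel_function_measurable[OF k] in measurable)
  then show ?thesis using kernel_function_measurable[OF k] by (simp add: square_integrable_def)
qed

lemma rep_kernel_op: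
  "l2_kernel k \<Longrightarrow> AE x in lborel. rep_l2 (kernel_op k f) x = (\<integral>y. k x y * rep_l2 f y \<partial>lborel)"
  unfolding kernel_op_def by (intro rep_abs_l2 square_integrable_kernel_function)

lemma norm_kernel_op_sq:
  "l2_kernel k \<Longrightarrow> (norm (kernel_op k f))\<^sup>2 = (\<integral>x. (cmod (\<integral>y. k x y * rep_l2 f y \<partial>lborel))\<^sup>2 \<partial>lborel)"
  unfolding kernel_op_def by (intro norm_abs_l2_sq square_integrable_kernel_function)

lemma kernel_norm_nonneg [simp]: "0 \<le> kernel_norm k"
  unfolding kernel_norm_def by (intro real_sqrt_ge_zero Bochner_Integration.integral_nonneg) auto

lemma norm_kernel_op_le:
  assumes k: "l2_kernel k"
  shows "norm (kernel_op k f) \<le> kernel_norm k * norm f"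
proof (rule power2_le_imp_le)
  have "(norm (kernel_op k f))\<^sup>2 \<le> (\<integral>x. (\<integral>y. (cmod (k x y))\<^sup>2 \<partial>lborel) * (norm f)\<^sup>2 \<partial>lborel)"
    unfolding norm_kernel_op_sq[OF k]
    using square_integrable_kernel_function[OF k, of f]
    by (intro integral_mono_AE kernel_function_sq_le k integrable_mult_left l2_kernel_sq_integral(1))
      (simp add: square_integrable_def)
  then show "(norm (kernel_op k f))\<^sup>2 \<le> (kernel_norm k * norm f)\<^sup>2"
    by (simp add: l2_kernel_sq_integral(2)[OF k] power_mult_distrib)
qed simp

lemma bounded_clinear_kernel_op:
  assumes k: "l2_kernel k"
  shows "bounded_clinear (kernel_op k)"
proof (rule bounded_clinearI)
  show "kernel_op k (f + g) = kernel_op k f + kernel_op k g" for f g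
    by (rule l2_eqI) (use rep_kernel_op[OF k, of "f + g"] rep_kernel_op[OF k, of f] rep_kernel_op[OF k, of g]
        rep_plus[of "kernel_op k f" "kernel_op k g"] l2_kernel_section[OF k]
        in eventually_elim, simp add: kernel_functional_linear)
  show "kernel_op k (c *\<^sub>C f) = c *\<^sub>C kernel_op k f" for c f
    by (rule l2_eqI) (use rep_kernel_op[OF k, of "c *\<^sub>C f"] rep_kernel_op[OF k, of f]
        rep_scaleC[of c "kernel_op k f"] l2_kernel_section[OF k]
        in eventually_elim, simp add: kernel_functional_linear)
qed (rule norm_kernel_op_le[OF k])

text \<open>The sum of \<open>\<parallel>K D e\<parallel>\<^sup>2\<close> over orthonormal vectors is the integral, over \<open>x\<close>, of the sum of the
  squares of the values at \<open>e\<close> of the functional \<open>f \<mapsto> \<integral> k x y (D f) y dy\<close>; Bessel's inequality bounds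
  the latter sum.\<close>

lemma hilbert_schmidt_kernel_op:
  assumes k: "l2_kernel k" and C: "bounded_clinear C" and D: "bounded_clinear D"
  shows "hilbert_schmidt (\<lambda>f. C (kernel_op k (D f)))"
proof -
  obtain c where c: "c > 0" "\<And>f. norm (C f) \<le> c * norm f" using bounded_clinear_bound[OF C] by metis
  obtain d where d: "d > 0" "\<And>f. norm (D f) \<le> d * norm f" using bounded_clinear_bound[OF D] by metis
  define l where "l x f = (\<integral>y. k x y * rep_l2 (D f) y \<partial>lborel)" for x f
  show ?thesis
  proof (rule hilbert_schmidtI)
    show "bounded_clinear (\<lambda>f. C (kernel_op k (D f)))"
      using bounded_clinear_compose[OF C bounded_clinear_compose[OF bounded_clinear_kernel_op[OF k] D]] .
    fix F assume F: "finite F" "orthonormal F"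
    have int: "integrable lborel (\<lambda>x. (cmod (l x e))\<^sup>2)" for e
      using square_integrable_kernel_function[OF k, of "D e"] by (simp add: square_integrable_def l_def)
    have "(\<Sum>e\<in>F. (norm (kernel_op k (D e)))\<^sup>2) = (\<integral>x. (\<Sum>e\<in>F. (cmod (l x e))\<^sup>2) \<partial>lborel)"
      unfolding norm_kernel_op_sq[OF k] l_def[symmetric]
      by (rule Bochner_Integration.integral_sum[symmetric]) (rule int)
    also have "\<dots> \<le> (\<integral>x. (\<integral>y. (cmod (k x y))\<^sup>2 \<partial>lborel) * d\<^sup>2 \<partial>lborel)"
    proof (rule integral_mono_AE)
      show "integrable lborel (\<lambda>x. \<Sum>e\<in>F. (cmod (l x e))\<^sup>2)"
        by (rule Bochner_Integration.integrable_sum) (rule int)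
      show "integrable lborel (\<lambda>x. (\<integral>y. (cmod (k x y))\<^sup>2 \<partial>lborel) * d\<^sup>2)"
        by (intro integrable_mult_left l2_kernel_sq_integral(1) k)
      show "AE x in lborel. (\<Sum>e\<in>F. (cmod (l x e))\<^sup>2) \<le> (\<integral>y. (cmod (k x y))\<^sup>2 \<partial>lborel) * d\<^sup>2"
        using l2_kernel_section[OF k]
      proof eventually_elim
        case (elim x)
        define N where "N = (\<integral>y. (cmod (k x y))\<^sup>2 \<partial>lborel)"
        have N: "0 \<le> N" unfolding N_def by (rule Bochner_Integration.integral_nonneg) simp
        have "(\<Sum>e\<in>F. (cmod (l x e))\<^sup>2) \<le> (sqrt N * d)\<^sup>2"
        proof (rule bessel_functional[OF F])
          show "l x (f + g) = l x f + l x g" "l x (a *\<^sub>C f) = a * l x f" for f g a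
            by (simp_all add: l_def bounded_clinear_add[OF D] bounded_clinear_scale[OF D]
                kernel_functional_linear[OF elim])
          have "cmod (l x f) \<le> sqrt N * norm (D f)" for f
            unfolding l_def N_def by (rule kernel_functional_linear(3)[OF elim])
          also have "sqrt N * norm (D f) \<le> sqrt N * (d * norm f)" for f
            by (rule mult_left_mono[OF d(2)]) (use N in simp)
          finally show "cmod (l x f) \<le> sqrt N * d * norm f" for f by (simp add: mult.assoc)
        qed
        then show ?case using N by (simp add: power_mult_distrib N_def)
      qed
    qed
    finally have le: "(\<Sum>e\<in>F. (norm (kernel_op k (D e)))\<^sup>2) \<le> (kernel_norm k)\<^sup>2 * d\<^sup>2"
      by (simp add: l2_kernel_sq_integral(2)[OF k])
    have "(\<Sum>e\<in>F. (norm (C (kernel_op k (D e))))\<^sup>2) \<le> (\<Sum>e\<in>F. c\<^sup>2 * (norm (kernel_op k (D e)))\<^sup>2)"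
      unfolding power_mult_distrib[symmetric] by (intro sum_mono power_mono c(2)) simp
    also have "\<dots> \<le> c\<^sup>2 * ((kernel_norm k)\<^sup>2 * d\<^sup>2)"
      unfolding sum_distrib_left[symmetric] by (rule mult_left_mono[OF le]) simp
    finally show "(\<Sum>e\<in>F. (norm (C (kernel_op k (D e))))\<^sup>2) \<le> c\<^sup>2 * ((kernel_norm k)\<^sup>2 * d\<^sup>2)" .
  qed
qed

section \<open>Kernels of potentials in the momentum representation\<close>

lemma integrable_prod_shift:
  fixes f h :: "real \<Rightarrow> real"
  assumes f: "integrable lborel f" and h: "integrable lborel h"
  shows "integrable (lborel \<Otimes>\<^sub>M lborel) (\<lambda>(x, y). f x * h (x - y))"
proof (rule lborel_pair.Fubini_integrable)
  note [measurable] = borel_measurable_integrable[OF f] borel_measurable_integrable[OF h]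
  show "(\<lambda>(x, y). f x * h (x - y)) \<in> borel_measurable (lborel \<Otimes>\<^sub>M lborel)" by measurable
  have i: "integrable lborel (\<lambda>y. h (x - y))" for x
    using lborel_integrable_real_affine[OF h, of "-1" x] by simp
  have e: "(\<integral>y. \<bar>h (x - y)\<bar> \<partial>lborel) = (\<integral>y. \<bar>h y\<bar> \<partial>lborel)" for x
    using lborel_integral_real_affine[of "-1" "\<lambda>y. \<bar>h y\<bar>" x] by simp
  have "integrable lborel (\<lambda>x. \<bar>f x\<bar> * (\<integral>y. \<bar>h y\<bar> \<partial>lborel))"
    using f by (intro integrable_mult_left integrable_abs)
  then show "integrable lborel (\<lambda>x. \<integral>y. norm (case (x, y) of (x, y) \<Rightarrow> f x * h (x - y)) \<partial>lborel)"
    by (simp add: abs_mult e)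
  show "AE x in lborel. integrable lborel (\<lambda>y. case (x, y) of (x, y) \<Rightarrow> f x * h (x - y))"
    using i by simp
qed

lemma integrable_prod_shift':
  fixes f h :: "real \<Rightarrow> real"
  assumes f: "integrable lborel f" and h: "integrable lborel h"
  shows "integrable (lborel \<Otimes>\<^sub>M lborel) (\<lambda>(x, y). f y * h (x - y))"
proof -
  have "integrable lborel (\<lambda>x. h (- x))"
    using lborel_integrable_real_affine[OF h, of "-1" 0] by simp
  from lborel_pair.integrable_product_swap[OF integrable_prod_shift[OF f this]]
  show ?thesis by (simp add: case_prod_beta')
qed

lemma weight_shift_sq: "(weight (x - y))\<^sup>2 \<le> 2 * ((weight x)\<^sup>2 + (weight y)\<^sup>2)"
proof -
  have "(x - y)\<^sup>2 \<le> 2 * x\<^sup>2 + 2 * y\<^sup>2"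
    using zero_le_power2[of "x + y"] by (simp add: power2_sum power2_diff)
  then show ?thesis unfolding weight_sq by (simp add: distrib_left)
qed

text \<open>Peetre's inequality. It distributes the growth of \<open>V\<close> in momentum space over the two
  Schwartz functions with which it is paired.\<close>

lemma weight_peetre: "weight y \<le> 2 * (weight x * weight (x - y))"
proof (rule power2_le_imp_le)
  have "(weight y)\<^sup>2 = (weight (x - (x - y)))\<^sup>2" by simp
  also have "\<dots> \<le> 2 * ((weight x)\<^sup>2 + (weight (x - y))\<^sup>2)" by (rule weight_shift_sq)
  also have "\<dots> \<le> 4 * ((weight x)\<^sup>2 * (weight (x - y))\<^sup>2)"
  proof -
    have "1 \<le> (weight x)\<^sup>2" "1 \<le> (weight (x - y))\<^sup>2" by (simp_all add: weight_sq)
    moreover have "2 * (a + b) \<le> 4 * (a * b)" if "1 \<le> a" "1 \<le> b" for a b :: real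
    proof -
      have "a * 1 \<le> a * b" "1 * b \<le> a * b"
        using that by (auto intro!: mult_left_mono mult_right_mono)
      then show ?thesis by simp
    qed
    ultimately show ?thesis by blast
  qed
  also have "\<dots> = (2 * (weight x * weight (x - y)))\<^sup>2" by (simp add: power_mult_distrib)
  finally show "(weight y)\<^sup>2 \<le> (2 * (weight x * weight (x - y)))\<^sup>2" .
qed (simp add: less_imp_le)

lemma weight_measurable [measurable]: "weight \<in> borel_measurable borel"
  unfolding weight_def[abs_def] by measurable

text \<open>The Fourier transform of the distribution \<open>V\<close> whose weighted transform is \<open>g\<close>.\<close>

definition potential :: "l2 \<Rightarrow> real \<Rightarrow> complex" where
  "potential g \<xi> = of_real (weight \<xi>) * rep_l2 g \<xi>"

lemma potential_measurable [measurable]: "potential g \<in> borel_measurable borel"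
  unfolding potential_def[abs_def] using measurable_rep[of g] by measurable

definition potential_kernel :: "l2 \<Rightarrow> (real \<Rightarrow> complex) \<Rightarrow> (real \<Rightarrow> complex) \<Rightarrow> real \<Rightarrow> real \<Rightarrow> complex" where
  "potential_kernel g a b x y = of_real fourier_const * a x * potential g (x - y) * b y"

text \<open>The symbols of the operators that gain one derivative.\<close>

definition order_one :: "(real \<Rightarrow> complex) \<Rightarrow> bool" where
  "order_one a \<longleftrightarrow> a \<in> borel_measurable borel \<and> (\<exists>C. \<forall>x. cmod (a x) \<le> C / weight x)"

text \<open>The square of the weight at \<open>x - y\<close> is at most twice the sum of those at \<open>x\<close> and at \<open>y\<close>. Each
  term cancels one of the two factors \<open>1 / (1 + x\<^sup>2)\<close> and \<open>1 / (1 + y\<^sup>2)\<close>; what remains is an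
  integrable function times the square of a translate of \<open>g\<close>.\<close>

lemma l2_kernel_potential:
  assumes a: "order_one a" and b: "order_one b"
  shows "l2_kernel (potential_kernel g a b)"
proof -
  obtain C where C: "\<And>x. cmod (a x) \<le> C / weight x" and [measurable]: "a \<in> borel_measurable borel"
    using a by (auto simp: order_one_def)
  obtain D where D: "\<And>x. cmod (b x) \<le> D / weight x" and [measurable]: "b \<in> borel_measurable borel"
    using b by (auto simp: order_one_def)
  have m: "case_prod (potential_kernel g a b) \<in> borel_measurable (lborel \<Otimes>\<^sub>M lborel)"
    unfolding potential_kernel_def[abs_def] by measurable
  define G where "G x = (cmod (rep_l2 g x))\<^sup>2" for x
  have G: "integrable lborel G"
    using square_integrable_rep[of g] by (simp add: square_integrable_def G_def[abs_def])
  have C0: "0 \<le> C"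
  proof -
    have "0 \<le> C / weight 0" by (rule order_trans[OF norm_ge_zero C])
    then show ?thesis by (simp add: weight_def)
  qed
  define E where "E = 2 * (fourier_const * C * D)\<^sup>2"
  have "integrable (lborel \<Otimes>\<^sub>M lborel)
     (\<lambda>p. E * ((case p of (x, y) \<Rightarrow> inverse (1 + x\<^sup>2) * G (x - y)) + (case p of (x, y) \<Rightarrow> inverse (1 + y\<^sup>2) * G (x - y))))"
    by (intro integrable_mult_right Bochner_Integration.integrable_add integrable_prod_shift
        integrable_prod_shift' integrable_inverse_1_plus_sq G)
  then have "integrable (lborel \<Otimes>\<^sub>M lborel) (\<lambda>(x, y). (cmod (potential_kernel g a b x y))\<^sup>2)"
  proof (rule Bochner_Integration.integrable_bound)
    show "(\<lambda>(x, y). (cmod (potential_kernel g a b x y))\<^sup>2) \<in> borel_measurable (lborel \<Otimes>\<^sub>M lborel)"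
      using m by measurable
    have "(cmod (potential_kernel g a b x y))\<^sup>2
        \<le> E * (inverse (1 + x\<^sup>2) * G (x - y) + inverse (1 + y\<^sup>2) * G (x - y))" for x y
    proof -
      have "cmod (potential_kernel g a b x y)
        = fourier_const * cmod (a x) * (weight (x - y) * cmod (rep_l2 g (x - y))) * cmod (b y)"
        by (simp add: potential_kernel_def potential_def norm_mult abs_of_pos)
      also have "\<dots> \<le> fourier_const * (C / weight x) * (weight (x - y) * cmod (rep_l2 g (x - y))) * (D / weight y)"
        using C[of x] D[of y] C0
        by (intro mult_mono) (auto simp: less_imp_le intro!: mult_nonneg_nonneg divide_nonneg_nonneg)
      finally have "(cmod (potential_kernel g a b x y))\<^sup>2
        \<le> (fourier_const * (C / weight x) * (weight (x - y) * cmod (rep_l2 g (x - y))) * (D / weight y))\<^sup>2"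
        by (rule power_mono) simp
      also have "\<dots> = (fourier_const * C * D)\<^sup>2 * ((weight (x - y))\<^sup>2 * G (x - y)) / ((weight x)\<^sup>2 * (weight y)\<^sup>2)"
        by (simp add: power_mult_distrib power_divide G_def)
      also have "\<dots> \<le> (fourier_const * C * D)\<^sup>2 * (2 * ((weight x)\<^sup>2 + (weight y)\<^sup>2) * G (x - y)) / ((weight x)\<^sup>2 * (weight y)\<^sup>2)"
        by (intro divide_right_mono mult_left_mono mult_right_mono weight_shift_sq) (auto simp: G_def)
      also have "\<dots> = E * (inverse ((weight x)\<^sup>2) * G (x - y) + inverse ((weight y)\<^sup>2) * G (x - y))"
        by (simp add: E_def field_simps)
      finally show ?thesis unfolding weight_sq .
    qed
    then show "AE p in lborel \<Otimes>\<^sub>M lborel. norm (case p of (x, y) \<Rightarrow> (cmod (potential_kernel g a b x y))\<^sup>2)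
       \<le> norm (E * ((case p of (x, y) \<Rightarrow> inverse (1 + x\<^sup>2) * G (x - y)) + (case p of (x, y) \<Rightarrow> inverse (1 + y\<^sup>2) * G (x - y))))"
      by (intro AE_I2) (auto intro: order_trans[OF _ abs_ge_self])
  qed
  with m show ?thesis by (simp add: l2_kernel_def)
qed

definition inverse_weight :: "real \<Rightarrow> complex" where
  "inverse_weight x = of_real (inverse (weight x))"

lemma order_one_inverse_weight: "order_one inverse_weight"
  unfolding order_one_def inverse_weight_def[abs_def]
  by (intro conjI exI[of _ 1]) (measurable, auto simp: norm_inverse abs_of_pos norm_divide divide_inverse)

lemma order_one_res_symbol:
  assumes "z \<notin> \<real>\<^sub>\<ge>\<^sub>0"
  shows "order_one (res_symbol z)"
  using cmod_res_symbol_le[OF assms] moderate_measurable[OF res_symbol_moderate[OF assms]]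
  unfolding order_one_def by metis

lemma schwartz_weight: "\<phi> \<in> schwartz \<Longrightarrow> (\<lambda>x. of_real (weight x) * \<phi> x) \<in> schwartz"
  and schwartz_inverse_weight: "\<phi> \<in> schwartz \<Longrightarrow> (\<lambda>x. inverse_weight x * \<phi> x) \<in> schwartz"
  unfolding inverse_weight_def
  by (rule schwartz_mult_moderate[OF weight_moderate], assumption)
    (rule schwartz_mult_moderate[OF inverse_weight_moderate])

lemma inverse_weight_cancel [simp]:
  "inverse_weight x * (of_real (weight x) * c) = c" "of_real (weight x) * (inverse_weight x * c) = c"
  by (simp_all add: inverse_weight_def)

text \<open>For distributions in the Sobolev space of order \<open>-1\<close>: \<open>g\<close> is the Fourier transform of \<open>V\<close>
  divided by the weight.\<close>

definition potential_density :: "distribution \<Rightarrow> l2 \<Rightarrow> bool" where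
  "potential_density V g \<longleftrightarrow>
     (\<forall>\<psi>\<in>schwartz. V \<psi> = cinner (abs_l2 (\<lambda>\<xi>. of_real (weight \<xi>) * fourier \<psi> \<xi>)) g)"

text \<open>In the momentum representation multiplication by \<open>V\<close> is convolution with its Fourier
  transform. Distributing the weights turns the form into that of an operator with square integrable
  kernel, which shows its continuity with respect to the norms of the Sobolev space of
  order one.\<close>

lemma potential_form:
  assumes V: "potential_density V g"
    and \<phi>: "\<phi> \<in> schwartz" and \<psi>: "\<psi> \<in> schwartz"
  shows "V (\<lambda>x. cnj (\<phi> x) * \<psi> x) = cinner (abs_l2 (\<lambda>\<xi>. of_real (weight \<xi>) * fourier \<psi> \<xi>))
    (kernel_op (potential_kernel g inverse_weight inverse_weight) (abs_l2 (\<lambda>\<xi>. of_real (weight \<xi>) * fourier \<phi> \<xi>)))"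
proof -
  define p where "p = fourier \<phi>"
  define q where "q = fourier \<psi>"
  have p: "p \<in> schwartz" and q: "q \<in> schwartz" using fourier_schwartz \<phi> \<psi> by (auto simp: p_def q_def)
  have [measurable]: "p \<in> borel_measurable borel" "q \<in> borel_measurable borel"
    "(\<lambda>x. cnj (q x)) \<in> borel_measurable borel"
    using schwartz_measurable p q schwartz_cnj[OF q] by auto
  have [measurable]: "rep_l2 g \<in> borel_measurable borel" using measurable_rep[of g] by simp
  define K where "K = potential_kernel g inverse_weight inverse_weight"
  have K: "l2_kernel K" unfolding K_def by (intro l2_kernel_potential order_one_inverse_weight)
  have pq: "(\<lambda>x. cnj (\<phi> x) * \<psi> x) \<in> schwartz" by (intro schwartz_mult schwartz_cnj \<phi> \<psi>)
  have siwp: "square_integrable (\<lambda>\<xi>. of_real (weight \<xi>) * p \<xi>)"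
    and siwq: "square_integrable (\<lambda>\<xi>. of_real (weight \<xi>) * q \<xi>)"
    by (intro schwartz_square_integrable schwartz_weight p q)+
  \<comment> \<open>the common integrand of both sides, for the exchange of the integrals\<close>
  define h where "h \<eta> \<xi> = cnj (q \<eta>) * potential g \<xi> * p (\<eta> - \<xi>)" for \<eta> \<xi>
  have h_int: "integrable (lborel \<Otimes>\<^sub>M lborel) (case_prod h)"
  proof (rule Bochner_Integration.integrable_bound)
    define Q where "Q x = 2 * cmod (of_real (weight x) * q x)" for x
    define P where "P x = (cmod (of_real (weight x) * p x))\<^sup>2" for x
    define G where "G x = (cmod (rep_l2 g x))\<^sup>2" for x
    have Q: "integrable lborel Q" unfolding Q_def
      by (intro integrable_mult_right integrable_norm schwartz_integrable schwartz_weight q)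
    have P: "integrable lborel P" using siwp by (simp add: square_integrable_def P_def[abs_def])
    have G: "integrable lborel G" using square_integrable_rep[of g] by (simp add: square_integrable_def G_def[abs_def])
    have "integrable (lborel \<Otimes>\<^sub>M lborel) (\<lambda>(x, y). complex_of_real (Q x) * of_real (G y))"
      by (rule integrable_prod) (use Q G in simp_all)
    from integrable_norm[OF this] have "integrable (lborel \<Otimes>\<^sub>M lborel) (\<lambda>(x, y). Q x * G y)"
      by (simp add: norm_mult norm_power Q_def G_def case_prod_beta')
    then show "integrable (lborel \<Otimes>\<^sub>M lborel)
        (\<lambda>r. (case r of (x, y) \<Rightarrow> Q x * G y) + (case r of (x, y) \<Rightarrow> Q x * P (x - y)))"
      by (intro Bochner_Integration.integrable_add integrable_prod_shift Q P)
    show "case_prod h \<in> borel_measurable (lborel \<Otimes>\<^sub>M lborel)"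
      unfolding h_def[abs_def] by measurable
    have "cmod (h x y) \<le> Q x * G y + Q x * P (x - y)" for x y
    proof -
      have "cmod (h x y) = weight y * (cmod (q x) * cmod (rep_l2 g y) * cmod (p (x - y)))"
        by (simp add: h_def potential_def norm_mult abs_of_pos)
      also have "\<dots> \<le> (2 * (weight x * weight (x - y))) * (cmod (q x) * cmod (rep_l2 g y) * cmod (p (x - y)))"
        by (intro mult_right_mono weight_peetre) simp
      also have "\<dots> = Q x * (cmod (rep_l2 g y) * cmod (of_real (weight (x - y)) * p (x - y)))"
        by (simp add: Q_def norm_mult abs_of_pos)
      also have "\<dots> \<le> Q x * ((cmod (rep_l2 g y))\<^sup>2 + (cmod (of_real (weight (x - y)) * p (x - y)))\<^sup>2)"
      proof (rule mult_left_mono)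
        have "a * b \<le> a\<^sup>2 + b\<^sup>2" if "0 \<le> a" "0 \<le> b" for a b :: real
          using sum_squares_bound[of a b] mult_nonneg_nonneg[OF that] by linarith
        then show "cmod (rep_l2 g y) * cmod (of_real (weight (x - y)) * p (x - y))
          \<le> (cmod (rep_l2 g y))\<^sup>2 + (cmod (of_real (weight (x - y)) * p (x - y)))\<^sup>2" by simp
      qed (simp add: Q_def)
      finally show ?thesis by (simp add: G_def P_def distrib_left)
    qed
    then show "AE r in lborel \<Otimes>\<^sub>M lborel. norm (case_prod h r)
        \<le> norm ((case r of (x, y) \<Rightarrow> Q x * G y) + (case r of (x, y) \<Rightarrow> Q x * P (x - y)))"
      by (intro AE_I2) (auto intro: order_trans[OF _ abs_ge_self])
  qed
  have "V (\<lambda>x. cnj (\<phi> x) * \<psi> x)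
      = (\<integral>\<xi>. cnj (of_real (weight \<xi>) * fourier (\<lambda>x. cnj (\<phi> x) * \<psi> x) \<xi>) * rep_l2 g \<xi> \<partial>lborel)"
    unfolding V[unfolded potential_density_def, rule_format, OF pq]
    by (intro cinner_abs_left schwartz_square_integrable schwartz_weight fourier_schwartz pq)
  also have "\<dots> = (\<integral>\<xi>. of_real fourier_const * (\<integral>\<eta>. h \<eta> \<xi> \<partial>lborel) \<partial>lborel)"
  proof (rule Bochner_Integration.integral_cong[OF refl])
    fix \<xi>
    have "cnj (\<integral>\<eta>. cnj (p (\<eta> - \<xi>)) * q \<eta> \<partial>lborel) = (\<integral>\<eta>. p (\<eta> - \<xi>) * cnj (q \<eta>) \<partial>lborel)"
      unfolding Bochner_Integration.integral_cnj[symmetric] by simp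
    then have "cnj (of_real (weight \<xi>) * fourier (\<lambda>x. cnj (\<phi> x) * \<psi> x) \<xi>) * rep_l2 g \<xi>
      = of_real fourier_const * (potential g \<xi> * (\<integral>\<eta>. p (\<eta> - \<xi>) * cnj (q \<eta>) \<partial>lborel))"
      unfolding fourier_product[OF \<phi> \<psi>] p_def[symmetric] q_def[symmetric] by (simp add: potential_def)
    also have "potential g \<xi> * (\<integral>\<eta>. p (\<eta> - \<xi>) * cnj (q \<eta>) \<partial>lborel) = (\<integral>\<eta>. h \<eta> \<xi> \<partial>lborel)"
      unfolding integral_mult_right_zero[symmetric] by (simp add: h_def mult_ac)
    finally show "cnj (of_real (weight \<xi>) * fourier (\<lambda>x. cnj (\<phi> x) * \<psi> x) \<xi>) * rep_l2 g \<xi>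
      = of_real fourier_const * (\<integral>\<eta>. h \<eta> \<xi> \<partial>lborel)" .
  qed
  also have "\<dots> = of_real fourier_const * (\<integral>\<xi>. (\<integral>\<eta>. h \<eta> \<xi> \<partial>lborel) \<partial>lborel)"
    by (rule integral_mult_right_zero)
  also have "(\<integral>\<xi>. (\<integral>\<eta>. h \<eta> \<xi> \<partial>lborel) \<partial>lborel) = (\<integral>\<eta>. (\<integral>\<xi>. h \<eta> \<xi> \<partial>lborel) \<partial>lborel)"
    by (rule lborel_pair.Fubini_integral[OF h_int])
  also have "of_real fourier_const * \<dots> = (\<integral>\<eta>. of_real fourier_const * (\<integral>\<xi>. h \<eta> \<xi> \<partial>lborel) \<partial>lborel)"
    by (rule integral_mult_right_zero[symmetric])
  also have "\<dots> = (\<integral>\<eta>. cnj (of_real (weight \<eta>) * q \<eta>) *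
      (\<integral>\<zeta>. K \<eta> \<zeta> * (of_real (weight \<zeta>) * p \<zeta>) \<partial>lborel) \<partial>lborel)"
  proof (rule Bochner_Integration.integral_cong[OF refl])
    fix \<eta>
    have "(\<integral>\<zeta>. K \<eta> \<zeta> * (of_real (weight \<zeta>) * p \<zeta>) \<partial>lborel)
      = (\<integral>\<zeta>. (of_real fourier_const * inverse_weight \<eta>) * (potential g (\<eta> - \<zeta>) * p \<zeta>) \<partial>lborel)"
      by (simp add: K_def potential_kernel_def mult.assoc)
    also have "\<dots> = (of_real fourier_const * inverse_weight \<eta>) * (\<integral>\<zeta>. potential g (\<eta> - \<zeta>) * p \<zeta> \<partial>lborel)"
      by (rule integral_mult_right_zero)
    also have "(\<integral>\<zeta>. potential g (\<eta> - \<zeta>) * p \<zeta> \<partial>lborel)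
      = \<bar>-1\<bar> *\<^sub>R (\<integral>\<xi>. potential g (\<eta> - (\<eta> + (-1) * \<xi>)) * p (\<eta> + (-1) * \<xi>) \<partial>lborel)"
      by (rule lborel_integral_real_affine) simp
    also have "\<dots> = (\<integral>\<xi>. potential g \<xi> * p (\<eta> - \<xi>) \<partial>lborel)" by simp
    finally have fin: "cnj (of_real (weight \<eta>) * q \<eta>) * (\<integral>\<zeta>. K \<eta> \<zeta> * (of_real (weight \<zeta>) * p \<zeta>) \<partial>lborel)
      = of_real fourier_const * (cnj (q \<eta>) * (\<integral>\<xi>. potential g \<xi> * p (\<eta> - \<xi>) \<partial>lborel))"
      by (simp add: inverse_weight_def)
    have "(\<integral>\<xi>. h \<eta> \<xi> \<partial>lborel) = cnj (q \<eta>) * (\<integral>\<xi>. potential g \<xi> * p (\<eta> - \<xi>) \<partial>lborel)"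
      unfolding integral_mult_right_zero[symmetric] by (simp only: h_def mult.assoc)
    then show "of_real fourier_const * (\<integral>\<xi>. h \<eta> \<xi> \<partial>lborel)
      = cnj (of_real (weight \<eta>) * q \<eta>) * (\<integral>\<zeta>. K \<eta> \<zeta> * (of_real (weight \<zeta>) * p \<zeta>) \<partial>lborel)"
      using fin by (simp only:)
  qed
  also have "\<dots> = (\<integral>\<eta>. cnj (of_real (weight \<eta>) * q \<eta>) *
      rep_l2 (kernel_op K (abs_l2 (\<lambda>\<xi>. of_real (weight \<xi>) * p \<xi>))) \<eta> \<partial>lborel)"
  proof (rule integral_cong_AE)
    have [measurable]: "case_prod K \<in> borel_measurable (lborel \<Otimes>\<^sub>M lborel)"
      using K by (simp add: l2_kernel_def)
    have [measurable]: "(\<lambda>\<eta>. cnj (of_real (weight \<eta>) * q \<eta>)) \<in> borel_measurable borel"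
      by (intro schwartz_measurable schwartz_cnj schwartz_weight q)
    show "(\<lambda>\<eta>. cnj (of_real (weight \<eta>) * q \<eta>) * (\<integral>\<zeta>. K \<eta> \<zeta> * (of_real (weight \<zeta>) * p \<zeta>) \<partial>lborel)) \<in> borel_measurable lborel"
      "(\<lambda>\<eta>. cnj (of_real (weight \<eta>) * q \<eta>) * rep_l2 (kernel_op K (abs_l2 (\<lambda>\<xi>. of_real (weight \<xi>) * p \<xi>))) \<eta>) \<in> borel_measurable lborel"
      by measurable
    have "(\<integral>\<zeta>. K \<eta> \<zeta> * rep_l2 (abs_l2 (\<lambda>\<xi>. of_real (weight \<xi>) * p \<xi>)) \<zeta> \<partial>lborel)
        = (\<integral>\<zeta>. K \<eta> \<zeta> * (of_real (weight \<zeta>) * p \<zeta>) \<partial>lborel)" for \<eta>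
    proof (rule integral_cong_AE)
      have [measurable]: "K \<eta> \<in> borel_measurable lborel" by (rule l2_kernel_measurable1[OF K])
      show "(\<lambda>\<zeta>. K \<eta> \<zeta> * rep_l2 (abs_l2 (\<lambda>\<xi>. of_real (weight \<xi>) * p \<xi>)) \<zeta>) \<in> borel_measurable lborel"
        "(\<lambda>\<zeta>. K \<eta> \<zeta> * (of_real (weight \<zeta>) * p \<zeta>)) \<in> borel_measurable lborel"
        by measurable
    qed (use rep_abs_l2[OF siwp] in auto)
    then show "AE \<eta> in lborel. cnj (of_real (weight \<eta>) * q \<eta>) * (\<integral>\<zeta>. K \<eta> \<zeta> * (of_real (weight \<zeta>) * p \<zeta>) \<partial>lborel)
      = cnj (of_real (weight \<eta>) * q \<eta>) * rep_l2 (kernel_op K (abs_l2 (\<lambda>\<xi>. of_real (weight \<xi>) * p \<xi>))) \<eta>"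
      using rep_kernel_op[OF K, of "abs_l2 (\<lambda>\<xi>. of_real (weight \<xi>) * p \<xi>)"] by auto
  qed
  also have "\<dots> = cinner (abs_l2 (\<lambda>\<xi>. of_real (weight \<xi>) * q \<xi>)) (kernel_op K (abs_l2 (\<lambda>\<xi>. of_real (weight \<xi>) * p \<xi>)))"
    by (rule cinner_abs_left[OF siwq, symmetric])
  finally show ?thesis by (simp only: K_def p_def q_def)
qed

section \<open>The operators of the theorem in the momentum representation\<close>

lemma l2_dist_schwartz: "\<psi> \<in> schwartz \<Longrightarrow> l2_dist f \<psi> = cinner (abs_l2 \<psi>) f"
  by (simp add: l2_dist_def fun_dist_def cinner_abs_left schwartz_square_integrable)

lemma representsI: "(\<And>\<psi>. \<psi> \<in> schwartz \<Longrightarrow> T \<psi> = cinner (abs_l2 \<psi>) f) \<Longrightarrow> represents f T"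
  by (simp add: represents_def l2_dist_schwartz)

lemma representsD: "represents f T \<Longrightarrow> \<psi> \<in> schwartz \<Longrightarrow> T \<psi> = cinner (abs_l2 \<psi>) f"
  by (simp add: represents_def l2_dist_schwartz)

lemma represents_unique: "represents f T \<Longrightarrow> represents g T \<Longrightarrow> f = g"
  by (rule l2_eq_if_schwartz_pairings_eq) (metis representsD)

lemma l2_of_dist_eq: "represents f T \<Longrightarrow> l2_of_dist T = f"
  unfolding l2_of_dist_def by (blast intro: represents_unique)

lemma cinner_mul_l2:
  assumes "bounded_symbol a" "square_integrable \<psi>"
  shows "cinner (abs_l2 (\<lambda>x. cnj (a x) * \<psi> x)) f = cinner (abs_l2 \<psi>) (mul_l2 a f)"
proof -
  have "bounded_symbol (\<lambda>x. cnj (a x))"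
    using assms(1) cnj_measurable by (auto simp: bounded_symbol_def)
  from square_integrable_mult_bounded[OF this assms(2)]
  have si: "square_integrable (\<lambda>x. cnj (a x) * \<psi> x)" .
  have m: "(\<lambda>x. cnj (a x) * \<psi> x) \<in> borel_measurable lborel" "\<psi> \<in> borel_measurable lborel"
    using si assms(2) by (simp_all add: square_integrable_def)
  show ?thesis
    unfolding cinner_abs_left[OF si] cinner_abs_left[OF assms(2)]
  proof (rule integral_cong_AE)
    show "(\<lambda>x. cnj (cnj (a x) * \<psi> x) * rep_l2 f x) \<in> borel_measurable lborel"
      "(\<lambda>x. cnj (\<psi> x) * rep_l2 (mul_l2 a f) x) \<in> borel_measurable lborel"
      by (intro borel_measurable_times cnj_measurable m measurable_rep)+
    show "AE x in lborel. cnj (cnj (a x) * \<psi> x) * rep_l2 f x = cnj (\<psi> x) * rep_l2 (mul_l2 a f) x"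
      using rep_mul_l2[OF assms(1), of f] by eventually_elim simp
  qed
qed

lemma bounded_symbol_order_one: 
  assumes "order_one a"
  shows "bounded_symbol a" "bounded_symbol (\<lambda>x. of_real (weight x) * a x)"
proof -
  obtain C where C: "\<And>x. cmod (a x) \<le> C / weight x" and [measurable]: "a \<in> borel_measurable borel"
    using assms by (auto simp: order_one_def)
  have C0: "0 \<le> C"
  proof -
    have "0 \<le> C / weight 0" by (rule order_trans[OF norm_ge_zero C])
    then show ?thesis by (simp add: weight_def)
  qed
  have "cmod (a x) \<le> C" for x
  proof -
    have "C / weight x \<le> C / 1" using C0 weight_ge_1[of x] by (intro divide_left_mono) auto
    then show ?thesis using C[of x] by simp
  qed
  then show "bounded_symbol a" by (auto simp: bounded_symbol_def)
  have "cmod (of_real (weight x) * a x) \<le> C" for x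
    using C[of x] by (simp add: norm_mult abs_of_pos pos_le_divide_eq mult.commute)
  then show "bounded_symbol (\<lambda>x. of_real (weight x) * a x)" by (auto simp: bounded_symbol_def)
qed

definition res_half_op :: "complex \<Rightarrow> l2 \<Rightarrow> l2" where
  "res_half_op z f = inv_fourier_l2 (mul_l2 (res_symbol z) (fourier_l2 f))"

lemma fourier_res_half_op [simp]: "fourier_l2 (res_half_op z f) = mul_l2 (res_symbol z) (fourier_l2 f)"
  by (simp add: res_half_op_def)

lemma bounded_symbol_res: "z \<notin> \<real>\<^sub>\<ge>\<^sub>0 \<Longrightarrow> bounded_symbol (res_symbol z)"
  by (rule bounded_symbol_order_one(1)[OF order_one_res_symbol])

lemma bounded_clinear_res_half_op:
  assumes "z \<notin> \<real>\<^sub>\<ge>\<^sub>0"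
  shows "bounded_clinear (res_half_op z)"
  unfolding res_half_op_def[abs_def]
  by (rule bounded_clinear_compose[OF bounded_clinear_inv_fourier_l2 bounded_clinear_compose[OF
        bounded_clinear_mul_l2[OF bounded_symbol_res[OF assms]] bounded_clinear_fourier_l2]])

lemma res_half_unfold: "res_half z T \<psi> = T (inv_fourier (\<lambda>x. cnj (res_symbol z x) * fourier \<psi> x))"
  by (simp add: res_half_def fourier_multiplier_def inv_fourier_dist_def mult_dist_def fourier_dist_def res_symbol_def)

lemma schwartz_cnj_res:
  "z \<notin> \<real>\<^sub>\<ge>\<^sub>0 \<Longrightarrow> \<psi> \<in> schwartz \<Longrightarrow> (\<lambda>x. cnj (res_symbol z x) * fourier \<psi> x) \<in> schwartz"
  by (intro schwartz_mult_moderate cnj_res_symbol_moderate fourier_schwartz)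

lemma res_half_l2_dist:
  assumes z: "z \<notin> \<real>\<^sub>\<ge>\<^sub>0" and \<psi>: "\<psi> \<in> schwartz"
  shows "res_half z (l2_dist f) \<psi> = cinner (abs_l2 \<psi>) (res_half_op z f)"
proof -
  note s = schwartz_cnj_res[OF z \<psi>]
  have "res_half z (l2_dist f) \<psi> = cinner (abs_l2 (\<lambda>x. cnj (res_symbol z x) * fourier \<psi> x)) (fourier_l2 f)"
    by (simp add: res_half_unfold l2_dist_schwartz inv_fourier_schwartz s cinner_inv_fourier_schwartz)
  also have "\<dots> = cinner (abs_l2 (fourier \<psi>)) (mul_l2 (res_symbol z) (fourier_l2 f))"
    by (intro cinner_mul_l2 bounded_symbol_res z schwartz_square_integrable fourier_schwartz \<psi>)
  also have "\<dots> = cinner (abs_l2 \<psi>) (res_half_op z f)"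
    by (simp add: res_half_op_def cinner_inv_fourier_l2 \<psi>)
  finally show ?thesis .
qed

lemma res_half_l2_eq: "z \<notin> \<real>\<^sub>\<ge>\<^sub>0 \<Longrightarrow> res_half_l2 z = res_half_op z"
  unfolding res_half_l2_def by (intro ext l2_of_dist_eq representsI res_half_l2_dist)

lemma sobolev_minus_one_density:
  assumes "V \<in> sobolev (-1)"
  obtains g where "potential_density V g"
proof -
  obtain g where g: "represents g (weighted_fourier (-1) V)"
    using assms by (auto simp: sobolev_def)
  have "V \<psi> = cinner (abs_l2 (\<lambda>\<xi>. of_real (weight \<xi>) * fourier \<psi> \<xi>)) g" if \<psi>: "\<psi> \<in> schwartz" for \<psi>
  proof -
    note s = schwartz_weight[OF fourier_schwartz[OF \<psi>]]
    have "weighted_fourier (-1) V (\<lambda>\<xi>. of_real (weight \<xi>) * fourier \<psi> \<xi>) = V (inv_fourier (fourier \<psi>))"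
    proof -
      have "cnj (of_real ((1 + \<xi>\<^sup>2) powr (- 1 / 2))) * (of_real (weight \<xi>) * fourier \<psi> \<xi>) = fourier \<psi> \<xi>" for \<xi>
        unfolding powr_half_weight(2) complex_cnj_complex_of_real
        by (rule inverse_weight_cancel(1)[unfolded inverse_weight_def])
      then show ?thesis
        by (simp only: weighted_fourier_def mult_dist_def fourier_dist_def)
    qed
    then show ?thesis using representsD[OF g s] by (simp add: fourier_inversion' \<psi>)
  qed
  then have "potential_density V g" unfolding potential_density_def by blast
  then show ?thesis by (rule that)
qed

text \<open>In the weighted momentum representation, convergence in the Sobolev space of order one is
  convergence of square integrable functions. Hence approximating sequences exist by the density of the
  Schwartz functions, and along all of them the form converges to the value of the bounded
  operator at the limit.\<close>

lemma mult_op_eq: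
  assumes V: "potential_density V g"
    and T: "\<And>\<psi>. \<psi> \<in> schwartz \<Longrightarrow> T \<psi> = cinner (abs_l2 \<psi>) f"
    and u: "AE \<xi> in lborel. rep_l2 u \<xi> = of_real (weight \<xi>) * rep_l2 (fourier_l2 f) \<xi>"
    and \<psi>: "\<psi> \<in> schwartz"
  shows "mult_op V T \<psi> = cinner (abs_l2 (\<lambda>\<xi>. of_real (weight \<xi>) * fourier \<psi> \<xi>))
    (kernel_op (potential_kernel g inverse_weight inverse_weight) u)"
proof -
  define K where "K = potential_kernel g inverse_weight inverse_weight"
  have K: "l2_kernel K" unfolding K_def by (intro l2_kernel_potential order_one_inverse_weight)
  have norm_eq: "sobolev_norm 1 (\<lambda>\<psi>. fun_dist \<phi> \<psi> - T \<psi>)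
      = norm (abs_l2 (\<lambda>\<xi>. of_real (weight \<xi>) * fourier \<phi> \<xi>) - u)" if \<phi>: "\<phi> \<in> schwartz" for \<phi>
  proof -
    have "represents (abs_l2 (\<lambda>\<xi>. of_real (weight \<xi>) * fourier \<phi> \<xi>) - u)
        (weighted_fourier 1 (\<lambda>\<psi>. fun_dist \<phi> \<psi> - T \<psi>))"
    proof (rule representsI)
      fix v assume c: "v \<in> schwartz"
      note w = schwartz_weight[OF c]
      note iw = inv_fourier_schwartz[OF w]
      have "fun_dist \<phi> (inv_fourier (\<lambda>\<xi>. of_real (weight \<xi>) * v \<xi>))
        = cinner (abs_l2 (inv_fourier (\<lambda>\<xi>. of_real (weight \<xi>) * v \<xi>))) (abs_l2 \<phi>)"
        by (simp add: fun_dist_def cinner_abs schwartz_square_integrable iw \<phi>)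
      also have "\<dots> = cinner (abs_l2 (\<lambda>\<xi>. of_real (weight \<xi>) * v \<xi>)) (abs_l2 (fourier \<phi>))"
        by (simp add: cinner_inv_fourier_schwartz w fourier_l2_schwartz \<phi>)
      also have "\<dots> = cinner (abs_l2 v) (abs_l2 (\<lambda>\<xi>. of_real (weight \<xi>) * fourier \<phi> \<xi>))"
        unfolding cinner_abs[OF schwartz_square_integrable[OF w] schwartz_square_integrable[OF fourier_schwartz[OF \<phi>]]]
          cinner_abs[OF schwartz_square_integrable[OF c] schwartz_square_integrable[OF schwartz_weight[OF fourier_schwartz[OF \<phi>]]]]
        by (simp add: mult_ac)
      finally have 1: "fun_dist \<phi> (inv_fourier (\<lambda>\<xi>. of_real (weight \<xi>) * v \<xi>))
        = cinner (abs_l2 v) (abs_l2 (\<lambda>\<xi>. of_real (weight \<xi>) * fourier \<phi> \<xi>))" .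
      have "T (inv_fourier (\<lambda>\<xi>. of_real (weight \<xi>) * v \<xi>))
        = cinner (abs_l2 (\<lambda>\<xi>. of_real (weight \<xi>) * v \<xi>)) (fourier_l2 f)"
        by (simp add: T iw cinner_inv_fourier_schwartz w)
      also have "\<dots> = cinner (abs_l2 v) u"
        unfolding cinner_abs_left[OF schwartz_square_integrable[OF w]]
          cinner_abs_left[OF schwartz_square_integrable[OF c]]
      proof (rule integral_cong_AE)
        show "(\<lambda>x. cnj (of_real (weight x) * v x) * rep_l2 (fourier_l2 f) x) \<in> borel_measurable lborel"
          "(\<lambda>x. cnj (v x) * rep_l2 u x) \<in> borel_measurable lborel"
          using schwartz_measurable[OF schwartz_cnj[OF w]] schwartz_measurable[OF schwartz_cnj[OF c]]
          by (auto intro!: borel_measurable_times measurable_rep[simplified])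
        show "AE x in lborel. cnj (of_real (weight x) * v x) * rep_l2 (fourier_l2 f) x = cnj (v x) * rep_l2 u x"
          using u by eventually_elim simp
      qed
      finally show "weighted_fourier 1 (\<lambda>\<psi>. fun_dist \<phi> \<psi> - T \<psi>) v
        = cinner (abs_l2 v) (abs_l2 (\<lambda>\<xi>. of_real (weight \<xi>) * fourier \<phi> \<xi>) - u)"
        using 1 by (simp add: weighted_fourier_def mult_dist_def fourier_dist_def powr_half_weight(1)
            cinner_diff_right)
    qed
    then show ?thesis by (simp add: sobolev_norm_def l2_of_dist_eq)
  qed
  have lim: "(\<lambda>n. V (\<lambda>x. cnj (\<phi> n x) * \<psi> x)) \<longlonglongrightarrow>
      cinner (abs_l2 (\<lambda>\<xi>. of_real (weight \<xi>) * fourier \<psi> \<xi>)) (kernel_op K u)"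
    if \<phi>: "\<forall>n. \<phi> n \<in> schwartz" and t: "sobolev_tendsto 1 \<phi> T" for \<phi>
  proof -
    have "(\<lambda>n. norm (abs_l2 (\<lambda>\<xi>. of_real (weight \<xi>) * fourier (\<phi> n) \<xi>) - u)) \<longlonglongrightarrow> 0"
      using t \<phi> by (simp add: sobolev_tendsto_def norm_eq)
    then have "(\<lambda>n. abs_l2 (\<lambda>\<xi>. of_real (weight \<xi>) * fourier (\<phi> n) \<xi>)) \<longlonglongrightarrow> u"
      by (simp add: tendsto_norm_zero_iff LIM_zero_iff)
    from tendsto_cinner[OF tendsto_const bounded_clinear_tendsto[OF bounded_clinear_kernel_op[OF K] this],
        of "abs_l2 (\<lambda>\<xi>. of_real (weight \<xi>) * fourier \<psi> \<xi>)"]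
    show ?thesis
      unfolding K_def by (simp only: potential_form[of V g, OF V spec[OF \<phi>] \<psi>])
  qed
  have ex: "\<exists>\<phi>. (\<forall>n. \<phi> n \<in> schwartz) \<and> sobolev_tendsto 1 \<phi> T"
  proof -
    obtain \<theta> where \<theta>: "\<And>n. \<theta> n \<in> schwartz" "(\<lambda>n. abs_l2 (\<theta> n)) \<longlonglongrightarrow> u"
      using schwartz_approximation[of u] by metis
    define \<phi> where "\<phi> n = inv_fourier (\<lambda>\<xi>. inverse_weight \<xi> * \<theta> n \<xi>)" for n
    have \<phi>: "\<phi> n \<in> schwartz" for n
      unfolding \<phi>_def by (intro inv_fourier_schwartz schwartz_inverse_weight \<theta>)
    have "(\<lambda>\<xi>. of_real (weight \<xi>) * fourier (\<phi> n) \<xi>) = \<theta> n" for n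
      unfolding \<phi>_def by (simp add: fourier_inv_fourier' schwartz_inverse_weight \<theta>)
    then have "sobolev_norm 1 (\<lambda>\<psi>. fun_dist (\<phi> n) \<psi> - T \<psi>) = norm (abs_l2 (\<theta> n) - u)" for n
      using norm_eq[OF \<phi>] by simp
    then have "sobolev_tendsto 1 \<phi> T"
      unfolding sobolev_tendsto_def using \<theta>(2) by (simp add: tendsto_norm_zero_iff LIM_zero_iff)
    with \<phi> show ?thesis by blast
  qed
  have "mult_op V T \<psi> = cinner (abs_l2 (\<lambda>\<xi>. of_real (weight \<xi>) * fourier \<psi> \<xi>)) (kernel_op K u)"
    unfolding mult_op_def
  proof (rule the_equality)
    show "\<forall>\<phi>. (\<forall>n. \<phi> n \<in> schwartz) \<longrightarrow> sobolev_tendsto 1 \<phi> T \<longrightarrow>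
       (\<lambda>n. V (\<lambda>x. cnj (\<phi> n x) * \<psi> x)) \<longlonglongrightarrow>
         cinner (abs_l2 (\<lambda>\<xi>. of_real (weight \<xi>) * fourier \<psi> \<xi>)) (kernel_op K u)"
      using lim by blast
    fix l assume "\<forall>\<phi>. (\<forall>n. \<phi> n \<in> schwartz) \<longrightarrow> sobolev_tendsto 1 \<phi> T \<longrightarrow>
       (\<lambda>n. V (\<lambda>x. cnj (\<phi> n x) * \<psi> x)) \<longlonglongrightarrow> l"
    then show "l = cinner (abs_l2 (\<lambda>\<xi>. of_real (weight \<xi>) * fourier \<psi> \<xi>)) (kernel_op K u)"
      using ex lim LIMSEQ_unique by blast
  qed
  then show ?thesis by (simp only: K_def)
qed

text \<open>The integral operator that represents \<open>- A\<^sub>V(z)\<close> in momentum space.\<close>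

definition birman_kernel :: "l2 \<Rightarrow> complex \<Rightarrow> real \<Rightarrow> real \<Rightarrow> complex" where
  "birman_kernel g z = potential_kernel g (res_symbol z) (res_symbol z)"

lemma l2_kernel_birman: "z \<notin> \<real>\<^sub>\<ge>\<^sub>0 \<Longrightarrow> l2_kernel (birman_kernel g z)"
  unfolding birman_kernel_def by (intro l2_kernel_potential order_one_res_symbol)

lemma birman_kernel_sandwich:
  assumes z: "z \<notin> \<real>\<^sub>\<ge>\<^sub>0"
  defines "b \<equiv> \<lambda>x. of_real (weight x) * res_symbol z x"
  shows "mul_l2 b (kernel_op (potential_kernel g inverse_weight inverse_weight) (mul_l2 b f))
    = kernel_op (birman_kernel g z) f"
proof -
  define K where "K = potential_kernel g inverse_weight inverse_weight"
  have K: "l2_kernel K" unfolding K_def by (intro l2_kernel_potential order_one_inverse_weight)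
  note B = l2_kernel_birman[OF z, of g]
  have b: "bounded_symbol b" unfolding b_def by (rule bounded_symbol_order_one(2)[OF order_one_res_symbol[OF z]])
  have [measurable]: "b \<in> borel_measurable borel" using b by (simp add: bounded_symbol_def)
  have *: "b x * (\<integral>y. K x y * rep_l2 (mul_l2 b f) y \<partial>lborel) = (\<integral>y. birman_kernel g z x y * rep_l2 f y \<partial>lborel)" for x
  proof -
    have [measurable]: "K x \<in> borel_measurable lborel" "birman_kernel g z x \<in> borel_measurable lborel"
      by (rule l2_kernel_measurable1[OF K], rule l2_kernel_measurable1[OF B])
    have "b x * (\<integral>y. K x y * rep_l2 (mul_l2 b f) y \<partial>lborel) = (\<integral>y. b x * (K x y * rep_l2 (mul_l2 b f) y) \<partial>lborel)"
      by simp
    also have "\<dots> = (\<integral>y. birman_kernel g z x y * rep_l2 f y \<partial>lborel)"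
    proof (rule integral_cong_AE)
      show "AE y in lborel. b x * (K x y * rep_l2 (mul_l2 b f) y) = birman_kernel g z x y * rep_l2 f y"
        using rep_mul_l2[OF b, of f]
        by eventually_elim (simp add: b_def K_def birman_kernel_def potential_kernel_def inverse_weight_def)
    qed measurable
    finally show ?thesis .
  qed
  show ?thesis
  proof (rule l2_eqI)
    show "AE x in lborel. rep_l2 (mul_l2 b (kernel_op (potential_kernel g inverse_weight inverse_weight) (mul_l2 b f))) x
        = rep_l2 (kernel_op (birman_kernel g z) f) x"
      unfolding K_def[symmetric]
      using rep_mul_l2[OF b, of "kernel_op K (mul_l2 b f)"] rep_kernel_op[OF K, of "mul_l2 b f"]
        rep_kernel_op[OF B, of f]
      by eventually_elim (simp add: *)
  qed
qed

theorem op_A_eq: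
  assumes V: "potential_density V g"
    and z: "z \<notin> \<real>\<^sub>\<ge>\<^sub>0"
  shows "op_A V z f = - inv_fourier_l2 (kernel_op (birman_kernel g z) (fourier_l2 f))"
proof -
  define b where "b x = of_real (weight x) * res_symbol z x" for x
  have b: "bounded_symbol b" unfolding b_def[abs_def] by (rule bounded_symbol_order_one(2)[OF order_one_res_symbol[OF z]])
  define u where "u = mul_l2 b (fourier_l2 f)"
  define K where "K = potential_kernel g inverse_weight inverse_weight"
  have u: "AE \<xi> in lborel. rep_l2 u \<xi> = of_real (weight \<xi>) * rep_l2 (fourier_l2 (res_half_op z f)) \<xi>"
    using rep_mul_l2[OF b, of "fourier_l2 f"] rep_mul_l2[OF bounded_symbol_res[OF z], of "fourier_l2 f"]
    by eventually_elim (simp add: u_def b_def)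
  have "represents (inv_fourier_l2 (kernel_op (birman_kernel g z) (fourier_l2 f)))
      (res_half z (mult_op V (res_half z (l2_dist f))))"
  proof (rule representsI)
    fix \<psi> assume \<psi>: "\<psi> \<in> schwartz"
    note s = schwartz_cnj_res[OF z \<psi>]
    have "res_half z (mult_op V (res_half z (l2_dist f))) \<psi>
      = mult_op V (res_half z (l2_dist f)) (inv_fourier (\<lambda>x. cnj (res_symbol z x) * fourier \<psi> x))"
      by (rule res_half_unfold)
    also have "\<dots> = cinner (abs_l2 (\<lambda>\<xi>. of_real (weight \<xi>) * (cnj (res_symbol z \<xi>) * fourier \<psi> \<xi>))) (kernel_op K u)"
      using mult_op_eq[OF V res_half_l2_dist[OF z] u inv_fourier_schwartz[OF s]]
      by (simp add: fourier_inv_fourier' s K_def)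
    also have "(\<lambda>\<xi>. of_real (weight \<xi>) * (cnj (res_symbol z \<xi>) * fourier \<psi> \<xi>)) = (\<lambda>\<xi>. cnj (b \<xi>) * fourier \<psi> \<xi>)"
      by (simp add: b_def mult.assoc)
    also have "cinner (abs_l2 \<dots>) (kernel_op K u) = cinner (abs_l2 (fourier \<psi>)) (mul_l2 b (kernel_op K u))"
      by (intro cinner_mul_l2 b schwartz_square_integrable fourier_schwartz \<psi>)
    also have "mul_l2 b (kernel_op K u) = kernel_op (birman_kernel g z) (fourier_l2 f)"
      using birman_kernel_sandwich[OF z] by (simp add: u_def K_def b_def[abs_def])
    finally show "res_half z (mult_op V (res_half z (l2_dist f))) \<psi>
      = cinner (abs_l2 \<psi>) (inv_fourier_l2 (kernel_op (birman_kernel g z) (fourier_l2 f)))"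
      by (simp add: cinner_inv_fourier_l2 \<psi>)
  qed
  then show ?thesis by (simp add: op_A_def l2_of_dist_eq)
qed

section \<open>The Schroedinger operator\<close>

text \<open>The Fourier transform of the product of \<open>V\<close> with the function whose transform is \<open>p\<close>.\<close>

definition fourier_convolution :: "l2 \<Rightarrow> l2 \<Rightarrow> real \<Rightarrow> complex" where
  "fourier_convolution g p \<xi> = of_real fourier_const * (\<integral>\<zeta>. potential g (\<xi> - \<zeta>) * rep_l2 p \<zeta> \<partial>lborel)"

text \<open>The form sum of \<open>H\<^sub>0\<close> and \<open>V\<close>: \<open>f\<close> lies in the Sobolev space of order one, and the distribution
  \<open>- f'' + V f\<close> is the square integrable function \<open>h\<close>.\<close>

definition schroedinger_op :: "l2 \<Rightarrow> l2_op" where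
  "schroedinger_op g = {(f, h).
     square_integrable (\<lambda>\<xi>. of_real (weight \<xi>) * rep_l2 (fourier_l2 f) \<xi>) \<and>
     (AE \<xi> in lborel. of_real (\<xi>\<^sup>2) * rep_l2 (fourier_l2 f) \<xi> + fourier_convolution g (fourier_l2 f) \<xi>
        = rep_l2 (fourier_l2 h) \<xi>)}"

lemma birman_kernel_convolution:
  assumes "z \<notin> \<real>\<^sub>\<ge>\<^sub>0"
  shows "(\<integral>\<zeta>. birman_kernel g z \<xi> \<zeta> * rep_l2 p \<zeta> \<partial>lborel)
    = res_symbol z \<xi> * fourier_convolution g (mul_l2 (res_symbol z) p) \<xi>"
proof -
  have m: "res_symbol z \<in> borel_measurable borel"
    using bounded_symbol_res[OF assms] by (simp add: bounded_symbol_def)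
  have "(\<integral>\<zeta>. birman_kernel g z \<xi> \<zeta> * rep_l2 p \<zeta> \<partial>lborel)
    = (\<integral>\<zeta>. (of_real fourier_const * res_symbol z \<xi>) * (potential g (\<xi> - \<zeta>) * (res_symbol z \<zeta> * rep_l2 p \<zeta>)) \<partial>lborel)"
    by (simp add: birman_kernel_def potential_kernel_def mult.assoc)
  also have "\<dots> = (of_real fourier_const * res_symbol z \<xi>) * (\<integral>\<zeta>. potential g (\<xi> - \<zeta>) * (res_symbol z \<zeta> * rep_l2 p \<zeta>) \<partial>lborel)"
    by (rule integral_mult_right_zero)
  also have "(\<integral>\<zeta>. potential g (\<xi> - \<zeta>) * (res_symbol z \<zeta> * rep_l2 p \<zeta>) \<partial>lborel)
    = (\<integral>\<zeta>. potential g (\<xi> - \<zeta>) * rep_l2 (mul_l2 (res_symbol z) p) \<zeta> \<partial>lborel)"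
  proof (rule integral_cong_AE)
    show "AE \<zeta> in lborel. potential g (\<xi> - \<zeta>) * (res_symbol z \<zeta> * rep_l2 p \<zeta>)
        = potential g (\<xi> - \<zeta>) * rep_l2 (mul_l2 (res_symbol z) p) \<zeta>"
      using rep_mul_l2[OF bounded_symbol_res[OF assms], of p] by eventually_elim simp
  qed (use m in measurable)
  finally show ?thesis by (simp add: fourier_convolution_def mult_ac)
qed

text \<open>The heart of the matter. In momentum space \<open>h - A\<^sub>V(z) h = (H\<^sub>0 - z)\<^sup>-\<^sup>1\<^sup>/\<^sup>2 u\<close> reads
  \<open>h + m (V * m h) = m u\<close>, where \<open>m\<^sup>2 = 1 / (\<xi>\<^sup>2 - z)\<close>. Division by \<open>m\<close> gives for \<open>f = m h\<close> the equation
  \<open>(\<xi>\<^sup>2 - z) f + V * f = u\<close>, in which \<open>z\<close> occurs only as it has to for a resolvent equation.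
  The condition on the domain is equivalent to \<open>f = m h\<close> with square integrable \<open>h\<close>.\<close>

lemma schroedinger_op_iff_birman:
  assumes V: "potential_density V g"
    and z: "z \<notin> \<real>\<^sub>\<ge>\<^sub>0"
  shows "(f, u + z *\<^sub>C f) \<in> schroedinger_op g \<longleftrightarrow>
    (\<exists>h. f = res_half_op z h \<and> h - op_A V z h = res_half_op z u)"
proof -
  define m where "m = res_symbol z"
  have bm: "bounded_symbol m" unfolding m_def by (rule bounded_symbol_res[OF z])
  have m0: "m \<xi> \<noteq> 0" for \<xi> unfolding m_def by (rule res_symbol_nonzero[OF z])
  have m2: "(of_real (\<xi>\<^sup>2) - z) * (m \<xi> * m \<xi>) = 1" for \<xi>
    using symbol_nonzero[OF z, of \<xi>] by (simp add: m_def res_symbol_square del: of_real_power)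
  note B = l2_kernel_birman[OF z, of g]
  define eqn where "eqn f \<longleftrightarrow> (AE \<xi> in lborel. of_real (\<xi>\<^sup>2) * rep_l2 (fourier_l2 f) \<xi>
      + fourier_convolution g (fourier_l2 f) \<xi> = rep_l2 (fourier_l2 (u + z *\<^sub>C f)) \<xi>)" for f
  have core: "eqn (res_half_op z h) \<longleftrightarrow> h - op_A V z h = res_half_op z u" for h
  proof -
    define h' where "h' = fourier_l2 h"
    define f where "f = res_half_op z h"
    have ff: "fourier_l2 f = mul_l2 m h'" by (simp add: f_def h'_def m_def)
    have "h - op_A V z h = res_half_op z u \<longleftrightarrow>
        fourier_l2 (h - op_A V z h) = fourier_l2 (res_half_op z u)"
      by (simp only: fourier_l2_eq_iff)
    also have "fourier_l2 (h - op_A V z h) = h' + kernel_op (birman_kernel g z) h'"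
      by (simp add: op_A_eq[OF V z] fourier_l2_add h'_def)
    also have "fourier_l2 (res_half_op z u) = mul_l2 m (fourier_l2 u)" by (simp add: m_def)
    also have "h' + kernel_op (birman_kernel g z) h' = mul_l2 m (fourier_l2 u) \<longleftrightarrow>
      (AE \<xi> in lborel. rep_l2 (h' + kernel_op (birman_kernel g z) h') \<xi> = rep_l2 (mul_l2 m (fourier_l2 u)) \<xi>)"
      by (auto intro: l2_eqI)
    also have "\<dots> \<longleftrightarrow> (AE \<xi> in lborel. of_real (\<xi>\<^sup>2) * rep_l2 (fourier_l2 f) \<xi>
      + fourier_convolution g (fourier_l2 f) \<xi> = rep_l2 (fourier_l2 (u + z *\<^sub>C f)) \<xi>)"
    proof (rule eventually_subst)
      have "AE \<xi> in lborel. rep_l2 (fourier_l2 (u + z *\<^sub>C f)) \<xi>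
          = rep_l2 (fourier_l2 u) \<xi> + z * rep_l2 (fourier_l2 f) \<xi>"
        using rep_plus[of "fourier_l2 u" "z *\<^sub>C fourier_l2 f"] rep_scaleC[of z "fourier_l2 f"]
        by eventually_elim (simp add: fourier_l2_add fourier_l2_scale)
      then show "AE \<xi> in lborel. (rep_l2 (h' + kernel_op (birman_kernel g z) h') \<xi> = rep_l2 (mul_l2 m (fourier_l2 u)) \<xi>)
        = (of_real (\<xi>\<^sup>2) * rep_l2 (fourier_l2 f) \<xi>
      + fourier_convolution g (fourier_l2 f) \<xi> = rep_l2 (fourier_l2 (u + z *\<^sub>C f)) \<xi>)"
        using rep_plus[of h' "kernel_op (birman_kernel g z) h'"] rep_kernel_op[OF B, of h']
          rep_mul_l2[OF bm, of "fourier_l2 u"] rep_mul_l2[OF bm, of h']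
      proof eventually_elim
        case (elim \<xi>)
        define a where "a = rep_l2 h' \<xi>"
        define c where "c = fourier_convolution g (fourier_l2 f) \<xi>"
        define b where "b = rep_l2 (fourier_l2 u) \<xi>"
        define x where "x = (of_real (\<xi>\<^sup>2) :: complex)"
        have f\<xi>: "rep_l2 (fourier_l2 f) \<xi> = m \<xi> * a" using elim by (simp add: ff a_def)
        have "rep_l2 (h' + kernel_op (birman_kernel g z) h') \<xi> = a + m \<xi> * c"
          using elim birman_kernel_convolution[OF z, of g \<xi> h'] by (simp add: a_def c_def ff m_def)
        moreover have "a + m \<xi> * c = m \<xi> * b \<longleftrightarrow> x * (m \<xi> * a) + c = b + z * (m \<xi> * a)"
        proof -
          have "m \<xi> * ((x - z) * (m \<xi> * a)) = a"
            using m2[of \<xi>] unfolding x_def[symmetric] by algebra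
          then have "a + m \<xi> * c = m \<xi> * b \<longleftrightarrow> m \<xi> * ((x - z) * (m \<xi> * a) + c) = m \<xi> * b"
            by (simp only: distrib_left)
          also have "\<dots> \<longleftrightarrow> (x - z) * (m \<xi> * a) + c = b" using m0 by simp
          also have "\<dots> \<longleftrightarrow> x * (m \<xi> * a) + c = b + z * (m \<xi> * a)" by (auto simp: algebra_simps)
          finally show ?thesis .
        qed
        ultimately show ?case
          using elim f\<xi> by (simp add: b_def c_def x_def)
      qed
    qed
    finally show ?thesis by (simp add: eqn_def f_def)
  qed
  have eqH: "(f, u + z *\<^sub>C f) \<in> schroedinger_op g \<longleftrightarrow>
      square_integrable (\<lambda>\<xi>. of_real (weight \<xi>) * rep_l2 (fourier_l2 f) \<xi>) \<and> eqn f"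
    by (simp add: schroedinger_op_def eqn_def)
  have si: "square_integrable (\<lambda>\<xi>. of_real (weight \<xi>) * rep_l2 (fourier_l2 f) \<xi>) \<longleftrightarrow> (\<exists>h. f = res_half_op z h)"
  proof
    assume s: "square_integrable (\<lambda>\<xi>. of_real (weight \<xi>) * rep_l2 (fourier_l2 f) \<xi>)"
    obtain C where C: "C > 0" "\<And>x. cmod (inverse (res_symbol z x)) \<le> C * weight x"
      using cmod_res_symbol_ge[OF z] by metis
    define p where "p \<xi> = inverse (m \<xi>) * rep_l2 (fourier_l2 f) \<xi>" for \<xi>
    have [measurable]: "m \<in> borel_measurable borel" using bm by (simp add: bounded_symbol_def)
    have sip: "square_integrable p"
    proof (rule square_integrable_bound[OF s, of _ C])
      show "p \<in> borel_measurable lborel" unfolding p_def[abs_def] by measurable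
      have "cmod (p x) \<le> C * cmod (of_real (weight x) * rep_l2 (fourier_l2 f) x)" for x
        using mult_right_mono[OF C(2)[of x] norm_ge_zero, of "rep_l2 (fourier_l2 f) x"]
        by (simp add: p_def m_def norm_mult abs_of_pos mult.assoc)
      then show "AE x in lborel. cmod (p x) \<le> C * cmod (of_real (weight x) * rep_l2 (fourier_l2 f) x)" by simp
    qed
    have "fourier_l2 f = mul_l2 m (abs_l2 p)"
    proof (rule l2_eqI)
      show "AE x in lborel. rep_l2 (fourier_l2 f) x = rep_l2 (mul_l2 m (abs_l2 p)) x"
        using rep_mul_l2[OF bm, of "abs_l2 p"] rep_abs_l2[OF sip]
        by eventually_elim (use m0 in \<open>simp add: p_def\<close>)
    qed
    then have "f = res_half_op z (inv_fourier_l2 (abs_l2 p))"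
      by (metis fourier_inv_l2 fourier_res_half_op fourier_l2_eq_iff m_def)
    then show "\<exists>h. f = res_half_op z h" by blast
  next
    assume "\<exists>h. f = res_half_op z h"
    then obtain h where f: "fourier_l2 f = mul_l2 m (fourier_l2 h)" by (auto simp: m_def)
    have b: "bounded_symbol (\<lambda>x. of_real (weight x) * m x)"
      unfolding m_def by (rule bounded_symbol_order_one(2)[OF order_one_res_symbol[OF z]])
    then obtain C where C: "\<And>x. cmod (of_real (weight x) * m x) \<le> C" by (auto simp: bounded_symbol_def)
    show "square_integrable (\<lambda>\<xi>. of_real (weight \<xi>) * rep_l2 (fourier_l2 f) \<xi>)"
    proof (rule square_integrable_bound[OF square_integrable_rep[of "fourier_l2 h"], of _ C])
      show "AE x in lborel. cmod (of_real (weight x) * rep_l2 (fourier_l2 f) x) \<le> C * cmod (rep_l2 (fourier_l2 h) x)"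
        using rep_mul_l2[OF bm, of "fourier_l2 h"]
      proof eventually_elim
        case (elim x)
        then show ?case
          using mult_right_mono[OF C[of x] norm_ge_zero, of "rep_l2 (fourier_l2 h) x"]
          by (simp add: f norm_mult mult.assoc)
      qed
    qed measurable
  qed
  show ?thesis
    unfolding eqH si using core by blast
qed

lemma bounded_clinear_op_A:
  assumes V: "potential_density V g"
    and z: "z \<notin> \<real>\<^sub>\<ge>\<^sub>0"
  shows "bounded_clinear (op_A V z)"
proof -
  have "op_A V z = (\<lambda>f. - inv_fourier_l2 (kernel_op (birman_kernel g z) (fourier_l2 f)))"
    using op_A_eq[OF V z] by (rule ext)
  then show ?thesis
    using bounded_clinear_neg[OF bounded_clinear_compose[OF bounded_clinear_inv_fourier_l2 bounded_clinear_compose[OF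
        bounded_clinear_kernel_op[OF l2_kernel_birman[OF z]] bounded_clinear_fourier_l2]]] by simp
qed

lemma res_half_op_inj:
  assumes z: "z \<notin> \<real>\<^sub>\<ge>\<^sub>0"
  shows "inj (res_half_op z)"
proof (rule injI)
  fix f h assume "res_half_op z f = res_half_op z h"
  then have eq: "mul_l2 (res_symbol z) (fourier_l2 f) = mul_l2 (res_symbol z) (fourier_l2 h)"
    by (metis fourier_res_half_op)
  have "fourier_l2 f = fourier_l2 h"
  proof (rule l2_eqI)
    show "AE x in lborel. rep_l2 (fourier_l2 f) x = rep_l2 (fourier_l2 h) x"
      using rep_mul_l2[OF bounded_symbol_res[OF z], of "fourier_l2 f"]
        rep_mul_l2[OF bounded_symbol_res[OF z], of "fourier_l2 h"]
      by eventually_elim (use eq res_symbol_nonzero[OF z] in simp)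
  qed
  then show "f = h" by (simp add: fourier_l2_eq_iff)
qed

text \<open>The range contains all Schwartz functions, as division by the symbol only costs a factor of the
  size of the weight.\<close>

lemma res_half_op_dense_range:
  assumes z: "z \<notin> \<real>\<^sub>\<ge>\<^sub>0"
  shows "closure (range (res_half_op z)) = UNIV"
proof -
  have "abs_l2 \<phi> \<in> range (res_half_op z)" if \<phi>: "\<phi> \<in> schwartz" for \<phi>
  proof -
    obtain C where C: "C > 0" "\<And>x. cmod (inverse (res_symbol z x)) \<le> C * weight x"
      using cmod_res_symbol_ge[OF z] by metis
    define p where "p \<xi> = inverse (res_symbol z \<xi>) * fourier \<phi> \<xi>" for \<xi>
    have [measurable]: "res_symbol z \<in> borel_measurable borel" "fourier \<phi> \<in> borel_measurable borel"
      using bounded_symbol_res[OF z] schwartz_measurable[OF fourier_schwartz[OF \<phi>]] by (auto simp: bounded_symbol_def)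
    have sip: "square_integrable p"
    proof (rule square_integrable_bound[OF schwartz_square_integrable[OF schwartz_weight[OF fourier_schwartz[OF \<phi>]]], of _ C])
      show "p \<in> borel_measurable lborel" unfolding p_def[abs_def] by measurable
      have "cmod (p x) \<le> C * cmod (of_real (weight x) * fourier \<phi> x)" for x
        using mult_right_mono[OF C(2)[of x] norm_ge_zero, of "fourier \<phi> x"]
        by (simp add: p_def norm_mult abs_of_pos mult.assoc)
      then show "AE x in lborel. cmod (p x) \<le> C * cmod (of_real (weight x) * fourier \<phi> x)" by simp
    qed
    have "fourier_l2 (res_half_op z (inv_fourier_l2 (abs_l2 p))) = abs_l2 (fourier \<phi>)"
    proof (rule abs_l2_eqI[OF schwartz_square_integrable[OF fourier_schwartz[OF \<phi>]]])
      show "AE x in lborel. rep_l2 (fourier_l2 (res_half_op z (inv_fourier_l2 (abs_l2 p)))) x = fourier \<phi> x"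
        using rep_mul_l2[OF bounded_symbol_res[OF z], of "abs_l2 p"] rep_abs_l2[OF sip]
        by eventually_elim (use res_symbol_nonzero[OF z] in \<open>simp add: p_def\<close>)
    qed
    then have "res_half_op z (inv_fourier_l2 (abs_l2 p)) = abs_l2 \<phi>"
      by (metis fourier_l2_schwartz[OF \<phi>] fourier_l2_eq_iff)
    then show ?thesis by (metis rangeI)
  qed
  then have "closure (abs_l2 ` schwartz) \<subseteq> closure (range (res_half_op z))"
    by (intro closure_mono) blast
  then show ?thesis using schwartz_dense by blast
qed

section \<open>Graphs of inverses\<close>

lemma inverse_shift_eq_graph_iff:
  "(op_shift H z)\<inverse> = op_graph B \<longleftrightarrow> (\<forall>f u. (f, u + z *\<^sub>C f) \<in> H \<longleftrightarrow> f = B u)"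
proof -
  have *: "(u, f) \<in> (op_shift H z)\<inverse> \<longleftrightarrow> (f, u + z *\<^sub>C f) \<in> H" for u f
  proof
    assume "(u, f) \<in> (op_shift H z)\<inverse>"
    then show "(f, u + z *\<^sub>C f) \<in> H" by (auto simp: op_shift_def)
  next
    assume "(f, u + z *\<^sub>C f) \<in> H"
    moreover have "u = (u + z *\<^sub>C f) - z *\<^sub>C f" by simp
    ultimately show "(u, f) \<in> (op_shift H z)\<inverse>" unfolding op_shift_def by blast
  qed
  have "(op_shift H z)\<inverse> = op_graph B \<longleftrightarrow> (\<forall>f u. (u, f) \<in> (op_shift H z)\<inverse> \<longleftrightarrow> (u, f) \<in> op_graph B)"
    by auto
  then show ?thesis unfolding * by (simp add: op_graph_def)
qed

lemma resolvent_eq: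
  assumes "(op_shift H z)\<inverse> = op_graph B"
  shows "resolvent H z = B"
  unfolding resolvent_def
proof (rule the_equality)
  show "(op_shift H z)\<inverse> = op_graph B" by (rule assms)
  fix B' assume "(op_shift H z)\<inverse> = op_graph B'"
  then have "op_graph B' = op_graph B" using assms by simp
  then show "B' = B" by (auto simp: op_graph_def fun_eq_iff)
qed

lemma one_in_resolvent_set_iff:
  "1 \<in> resolvent_set (op_graph A) \<longleftrightarrow> (\<exists>B. bounded_clinear B \<and> (\<forall>f u. f - A f = u \<longleftrightarrow> f = B u))"
proof
  assume "1 \<in> resolvent_set (op_graph A)"
  then obtain B where B: "bounded_clinear B" "\<And>f u. (f, u + 1 *\<^sub>C f) \<in> op_graph A \<longleftrightarrow> f = B u"
    unfolding resolvent_set_def inverse_shift_eq_graph_iff by auto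
  have "f - A f = u \<longleftrightarrow> f = - B u" for f u
  proof -
    have "f - A f = u \<longleftrightarrow> (f, - u + 1 *\<^sub>C f) \<in> op_graph A" by (auto simp: op_graph_def algebra_simps)
    also have "\<dots> \<longleftrightarrow> f = B (- u)" by (rule B(2))
    also have "B (- u) = - B u" using bounded_clinear_scale[OF B(1), of "-1" u] by simp
    finally show ?thesis .
  qed
  then show "\<exists>B. bounded_clinear B \<and> (\<forall>f u. f - A f = u \<longleftrightarrow> f = B u)"
    using bounded_clinear_neg[OF B(1)] by blast
next
  assume "\<exists>B. bounded_clinear B \<and> (\<forall>f u. f - A f = u \<longleftrightarrow> f = B u)"
  then obtain B where B: "bounded_clinear B" "\<And>f u. f - A f = u \<longleftrightarrow> f = B u" by blast
  have "(f, u + 1 *\<^sub>C f) \<in> op_graph A \<longleftrightarrow> f = - B u" for f u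
  proof -
    have "(f, u + 1 *\<^sub>C f) \<in> op_graph A \<longleftrightarrow> f - A f = - u" by (auto simp: op_graph_def algebra_simps)
    also have "\<dots> \<longleftrightarrow> f = B (- u)" by (rule B(2))
    also have "B (- u) = - B u" using bounded_clinear_scale[OF B(1), of "-1" u] by simp
    finally show ?thesis .
  qed
  then show "1 \<in> resolvent_set (op_graph A)"
    unfolding resolvent_set_def inverse_shift_eq_graph_iff using bounded_clinear_neg[OF B(1)] by blast
qed

lemma dim_image_injective:
  assumes lin: "Vector_Spaces.linear scaleC scaleC L" and inj: "inj L" and S: "l2.subspace S"
  shows "l2.dim (L ` S) = l2.dim S"
proof -
  interpret L: Vector_Spaces.linear scaleC scaleC L by (rule lin)
  obtain B where B: "B \<subseteq> S" "l2.independent B" "S \<subseteq> l2.span B"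
    using l2.maximal_independent_subset[of S] by metis
  have "l2.span B = S" using B S by (simp add: l2.span_minimal subset_antisym)
  have "l2.independent (L ` B)"
    using B(2) inj by (intro L.independent_injective_image) (auto intro: inj_on_subset)
  moreover have "l2.span (L ` B) = l2.span (L ` S)"
    using \<open>l2.span B = S\<close> by (metis L.span_image l2.span_span)
  ultimately have "l2.dim (L ` S) = card (L ` B)" by (rule l2.dim_eq_card[rotated])
  also have "\<dots> = card B" using inj by (intro card_image) (auto intro: inj_on_subset)
  also have "card B = l2.dim S"
    using l2.dim_eq_card[of B S] B(2) \<open>l2.span B = S\<close> S by (metis l2.span_span)
  finally show ?thesis .
qed

section \<open>The free operator\<close>

lemma schwartz_seminorm_upper:
  assumes "\<psi> \<in> schwartz"
  shows "cmod (of_real (x ^ m) * nth_deriv n \<psi> x) \<le> schwartz_seminorm m n \<psi>"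
proof -
  have "bounded (range (\<lambda>x. of_real (x ^ m) * nth_deriv n \<psi> x))"
    using assms by (simp add: schwartz_def)
  then obtain C where "\<And>x. cmod (of_real (x ^ m) * nth_deriv n \<psi> x) \<le> C"
    unfolding bounded_iff by blast
  then have "bdd_above (range (\<lambda>x. cmod (of_real (x ^ m) * nth_deriv n \<psi> x)))"
    by (rule bdd_aboveI2)
  then show ?thesis unfolding schwartz_seminorm_def by (rule cSUP_upper[OF UNIV_I])
qed

text \<open>The constant stems from \<open>\<integral> 1 / (1 + x\<^sup>2) = \<pi>\<close>.\<close>

lemma norm_schwartz_le_seminorms:
  assumes \<psi>: "\<psi> \<in> schwartz"
  shows "norm (abs_l2 \<psi>) \<le> sqrt pi * (\<Sum>m\<le>2. \<Sum>n\<le>2. schwartz_seminorm m n \<psi>)"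
proof -
  have nonneg: "0 \<le> schwartz_seminorm m n \<psi>" for m n
    using schwartz_seminorm_upper[OF \<psi>, of 0 m n] by (rule order_trans[OF norm_ge_zero])
  define B where "B = schwartz_seminorm 0 0 \<psi> + schwartz_seminorm 2 0 \<psi>"
  have B0: "0 \<le> B" by (simp add: B_def nonneg)
  have "B = (\<Sum>m\<in>{0, 2}. schwartz_seminorm m 0 \<psi>)" by (simp add: B_def)
  also have "\<dots> \<le> (\<Sum>m\<le>2. schwartz_seminorm m 0 \<psi>)"
    by (rule sum_mono2) (auto simp: nonneg)
  also have "\<dots> \<le> (\<Sum>m\<le>2. \<Sum>n\<le>2. schwartz_seminorm m n \<psi>)"
    by (rule sum_mono, rule member_le_sum) (auto simp: nonneg)
  finally have BS: "B \<le> (\<Sum>m\<le>2. \<Sum>n\<le>2. schwartz_seminorm m n \<psi>)" .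
  have pt: "(cmod (\<psi> x))\<^sup>2 \<le> B\<^sup>2 * inverse (1 + x\<^sup>2)" for x
  proof -
    have p: "0 < 1 + x\<^sup>2" by (rule add_pos_nonneg) simp_all
    have 1: "cmod (\<psi> x) \<le> schwartz_seminorm 0 0 \<psi>"
      using schwartz_seminorm_upper[OF \<psi>, of x 0 0] by simp
    have 2: "x\<^sup>2 * cmod (\<psi> x) \<le> schwartz_seminorm 2 0 \<psi>"
      using schwartz_seminorm_upper[OF \<psi>, of x 2 0] by (simp add: norm_mult norm_power)
    have "cmod (\<psi> x) * ((1 + x\<^sup>2) * cmod (\<psi> x)) \<le> B * B"
      using 1 2 nonneg[of 2 0] B0 by (intro mult_mono) (auto simp: B_def distrib_right)
    then have "(cmod (\<psi> x))\<^sup>2 * (1 + x\<^sup>2) \<le> B\<^sup>2" by (simp add: power2_eq_square mult_ac)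
    then show ?thesis using p by (simp add: pos_le_divide_eq flip: divide_inverse)
  qed
  have total: "(\<integral>x. inverse (1 + (x::real)\<^sup>2) \<partial>lborel) = pi"
    using LBINT_inverse_1_plus_square by (simp add: interval_lebesgue_integral_def set_lebesgue_integral_def)
  have "(norm (abs_l2 \<psi>))\<^sup>2 = (\<integral>x. (cmod (\<psi> x))\<^sup>2 \<partial>lborel)"
    by (rule norm_abs_l2_sq[OF schwartz_square_integrable[OF \<psi>]])
  also have "\<dots> \<le> (\<integral>x. B\<^sup>2 * inverse (1 + x\<^sup>2) \<partial>lborel)"
    using schwartz_square_integrable[OF \<psi>]
    by (intro integral_mono integrable_mult_right integrable_inverse_1_plus_sq pt) (simp add: square_integrable_def)
  also have "\<dots> = (sqrt pi * B)\<^sup>2" by (simp add: total power_mult_distrib)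
  finally have "norm (abs_l2 \<psi>) \<le> sqrt pi * B"
    by (rule power2_le_imp_le) (simp add: B0)
  also have "\<dots> \<le> sqrt pi * (\<Sum>m\<le>2. \<Sum>n\<le>2. schwartz_seminorm m n \<psi>)"
    by (rule mult_left_mono[OF BS]) simp
  finally show ?thesis .
qed

lemma tempered_l2_dist: "tempered (l2_dist f)"
  unfolding tempered_def
proof (intro conjI ballI allI exI)
  fix \<phi> \<psi> :: "real \<Rightarrow> complex" assume s: "\<phi> \<in> schwartz" "\<psi> \<in> schwartz"
  then show "l2_dist f (\<lambda>x. \<phi> x + \<psi> x) = l2_dist f \<phi> + l2_dist f \<psi>"
    by (simp add: l2_dist_schwartz schwartz_add cinner_add_left[symmetric] abs_l2_add schwartz_square_integrable)
next
  fix c and \<psi> :: "real \<Rightarrow> complex" assume s: "\<psi> \<in> schwartz"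
  then show "l2_dist f (\<lambda>x. c * \<psi> x) = cnj c * l2_dist f \<psi>"
    by (simp add: l2_dist_schwartz schwartz_scale cinner_scale_left[symmetric] abs_l2_scale schwartz_square_integrable)
next
  fix \<psi> :: "real \<Rightarrow> complex" assume s: "\<psi> \<in> schwartz"
  have "cmod (l2_dist f \<psi>) \<le> norm (abs_l2 \<psi>) * norm f"
    by (simp add: l2_dist_schwartz s cauchy_schwarz_l2)
  also have "\<dots> \<le> (sqrt pi * (\<Sum>m\<le>2. \<Sum>n\<le>2. schwartz_seminorm m n \<psi>)) * norm f"
    by (rule mult_right_mono[OF norm_schwartz_le_seminorms[OF s]]) simp
  finally show "cmod (l2_dist f \<psi>) \<le> (sqrt pi * norm f) * (\<Sum>m\<le>2. \<Sum>n\<le>2. schwartz_seminorm m n \<psi>)"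
    by (simp add: mult_ac)
qed

lemma schwartz_real_sq: "\<phi> \<in> schwartz \<Longrightarrow> (\<lambda>x. of_real (x\<^sup>2) * \<phi> x) \<in> schwartz"
  using schwartz_mult_moderate[OF moderate_poly[of "[:0, 0, 1:]"]] by (simp add: power2_eq_square)

lemma cinner_real_multiplier:
  assumes "\<psi> \<in> schwartz" "(\<lambda>x. of_real (r x) * \<psi> x) \<in> schwartz"
    and r: "r \<in> borel_measurable borel" and h: "AE x in lborel. rep_l2 h x = of_real (r x) * rep_l2 f x"
  shows "cinner (abs_l2 (\<lambda>x. of_real (r x) * \<psi> x)) f = cinner (abs_l2 \<psi>) h"
  unfolding cinner_abs_left[OF schwartz_square_integrable[OF assms(1)]]
    cinner_abs_left[OF schwartz_square_integrable[OF assms(2)]]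
proof (rule integral_cong_AE)
  show "(\<lambda>x. cnj (of_real (r x) * \<psi> x) * rep_l2 f x) \<in> borel_measurable lborel"
    "(\<lambda>x. cnj (\<psi> x) * rep_l2 h x) \<in> borel_measurable lborel"
    using schwartz_measurable[OF schwartz_cnj[OF assms(1)]] schwartz_measurable[OF schwartz_cnj[OF assms(2)]]
    by (auto intro!: borel_measurable_times measurable_rep[simplified])
  show "AE x in lborel. cnj (of_real (r x) * \<psi> x) * rep_l2 f x = cnj (\<psi> x) * rep_l2 h x"
    using h by eventually_elim simp
qed

text \<open>That \<open>- f''\<close> is the square integrable function \<open>h\<close> means, after testing with
  \<open>\<theta> / (1 + \<xi>\<^sup>2)\<close>, that the transform of \<open>f\<close> is \<open>1 / (1 + \<xi>\<^sup>2)\<close> times that of \<open>f + h\<close>; this includes the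
  Sobolev regularity of order two.\<close>

lemma op_H0_iff:
  "(f, h) \<in> op_H0 \<longleftrightarrow> (AE \<xi> in lborel. of_real (\<xi>\<^sup>2) * rep_l2 (fourier_l2 f) \<xi> = rep_l2 (fourier_l2 h) \<xi>)"
proof -
  have sqm: "(\<lambda>x::real. x\<^sup>2) \<in> borel_measurable borel" by measurable
  have lap: "- deriv_dist (deriv_dist (l2_dist f)) \<psi>
      = cinner (abs_l2 (\<lambda>\<xi>. of_real (\<xi>\<^sup>2) * fourier \<psi> \<xi>)) (fourier_l2 f)" if \<psi>: "\<psi> \<in> schwartz" for f \<psi>
  proof -
    define \<psi>2 where "\<psi>2 = (\<lambda>x. vector_derivative (\<lambda>x. vector_derivative \<psi> (at x)) (at x))"
    have s2: "\<psi>2 \<in> schwartz" unfolding \<psi>2_def by (intro schwartz_deriv \<psi>)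
    have i2: "\<i> * x * (\<i> * x * c) = (-1) * (x\<^sup>2 * c)" for x c
      using i_squared by algebra
    have "fourier \<psi>2 \<xi> = (-1) * (of_real (\<xi>\<^sup>2) * fourier \<psi> \<xi>)" for \<xi>
      unfolding \<psi>2_def fourier_deriv[OF schwartz_deriv[OF \<psi>]] fourier_deriv[OF \<psi>]
      by (simp only: i2 of_real_power)
    then have "fourier \<psi>2 = (\<lambda>\<xi>. (-1) * (of_real (\<xi>\<^sup>2) * fourier \<psi> \<xi>))" by (rule ext)
    then have f2: "abs_l2 (fourier \<psi>2) = (-1) *\<^sub>C abs_l2 (\<lambda>\<xi>. of_real (\<xi>\<^sup>2) * fourier \<psi> \<xi>)"
      by (simp only: abs_l2_scale schwartz_square_integrable schwartz_real_sq fourier_schwartz \<psi>)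
    have "- deriv_dist (deriv_dist (l2_dist f)) \<psi> = - cinner (abs_l2 \<psi>2) f"
      using s2 by (simp add: deriv_dist_def l2_dist_schwartz \<psi>2_def)
    also have "\<dots> = - cinner (abs_l2 (fourier \<psi>2)) (fourier_l2 f)"
      by (simp add: cinner_fourier_l2 s2)
    also have "\<dots> = cinner (abs_l2 (\<lambda>\<xi>. of_real (\<xi>\<^sup>2) * fourier \<psi> \<xi>)) (fourier_l2 f)"
      unfolding f2 by (simp add: cinner_minus_left)
    finally show ?thesis .
  qed
  show ?thesis
  proof
    assume "(f, h) \<in> op_H0"
    then have r: "represents h (\<lambda>\<psi>. - deriv_dist (deriv_dist (l2_dist f)) \<psi>)" by (simp add: op_H0_def)
    have eq: "cinner (abs_l2 (\<lambda>\<xi>. of_real (\<xi>\<^sup>2) * \<theta> \<xi>)) (fourier_l2 f) = cinner (abs_l2 \<theta>) (fourier_l2 h)"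
      if \<theta>: "\<theta> \<in> schwartz" for \<theta>
    proof -
      note s = inv_fourier_schwartz[OF \<theta>]
      have "cinner (abs_l2 (\<lambda>\<xi>. of_real (\<xi>\<^sup>2) * fourier (inv_fourier \<theta>) \<xi>)) (fourier_l2 f)
        = cinner (abs_l2 (inv_fourier \<theta>)) h"
        using representsD[OF r s] lap[OF s] by simp
      then show ?thesis by (simp add: fourier_inv_fourier' \<theta> cinner_inv_fourier_schwartz)
    qed
    \<comment> \<open>the symbol \<open>1 / (1 + x\<^sup>2)\<close>\<close>
    define a where "a x = inverse_weight x * inverse_weight x" for x
    have ab: "bounded_symbol a"
    proof -
      have "cmod (a x) \<le> 1" for x
        using weight_ge_1[of x] by (simp add: a_def inverse_weight_def norm_mult norm_inverse abs_of_pos mult_le_one inverse_le_1_iff)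
      moreover have "a \<in> borel_measurable borel"
        unfolding a_def[abs_def] inverse_weight_def by measurable
      ultimately show ?thesis by (auto simp: bounded_symbol_def)
    qed
    have a1: "of_real (1 + x\<^sup>2) * (a x * c) = c" for x c
      unfolding weight_sq[symmetric] a_def
      by (simp only: power2_eq_square of_real_mult mult.assoc inverse_weight_cancel)
    have "fourier_l2 f = mul_l2 a (fourier_l2 f + fourier_l2 h)"
    proof (rule l2_eq_if_schwartz_pairings_eq)
      fix \<theta> assume \<theta>: "\<theta> \<in> schwartz"
      define \<eta> where "\<eta> = (\<lambda>x. a x * \<theta> x)"
      have s: "\<eta> \<in> schwartz"
        using schwartz_inverse_weight[OF schwartz_inverse_weight[OF \<theta>]] by (simp add: \<eta>_def a_def mult.assoc)
      have "\<theta> = (\<lambda>x. \<eta> x + of_real (x\<^sup>2) * \<eta> x)"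
      proof
        fix x show "\<theta> x = \<eta> x + of_real (x\<^sup>2) * \<eta> x"
          using a1[of x "\<theta> x"] by (simp add: \<eta>_def distrib_right)
      qed
      then have "abs_l2 \<theta> = abs_l2 \<eta> + abs_l2 (\<lambda>x. of_real (x\<^sup>2) * \<eta> x)"
        by (simp only: abs_l2_add schwartz_square_integrable schwartz_real_sq s)
      then have "cinner (abs_l2 \<theta>) (fourier_l2 f) = cinner (abs_l2 \<eta>) (fourier_l2 f + fourier_l2 h)"
        by (simp only: cinner_add_left cinner_add_right eq[OF s])
      also have "\<eta> = (\<lambda>x. cnj (a x) * \<theta> x)" by (simp add: \<eta>_def a_def inverse_weight_def)
      also have "cinner (abs_l2 (\<lambda>x. cnj (a x) * \<theta> x)) (fourier_l2 f + fourier_l2 h)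
          = cinner (abs_l2 \<theta>) (mul_l2 a (fourier_l2 f + fourier_l2 h))"
        by (rule cinner_mul_l2[OF ab schwartz_square_integrable[OF \<theta>]])
      finally show "cinner (abs_l2 \<theta>) (fourier_l2 f) = cinner (abs_l2 \<theta>) (mul_l2 a (fourier_l2 f + fourier_l2 h))" .
    qed
    then have "AE x in lborel. rep_l2 (fourier_l2 f) x = a x * rep_l2 (fourier_l2 f + fourier_l2 h) x"
      using rep_mul_l2[OF ab, of "fourier_l2 f + fourier_l2 h"] by simp
    then show "AE \<xi> in lborel. of_real (\<xi>\<^sup>2) * rep_l2 (fourier_l2 f) \<xi> = rep_l2 (fourier_l2 h) \<xi>"
      using rep_plus[of "fourier_l2 f" "fourier_l2 h"]
    proof eventually_elim
      case (elim x)
      then have "of_real (1 + x\<^sup>2) * rep_l2 (fourier_l2 f) x = rep_l2 (fourier_l2 f) x + rep_l2 (fourier_l2 h) x"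
        using a1[of x "rep_l2 (fourier_l2 f + fourier_l2 h) x"] by metis
      then show ?case by (simp add: distrib_right)
    qed
  next
    assume ae: "AE \<xi> in lborel. of_real (\<xi>\<^sup>2) * rep_l2 (fourier_l2 f) \<xi> = rep_l2 (fourier_l2 h) \<xi>"
    have h: "cinner (abs_l2 (\<lambda>\<xi>. of_real (\<xi>\<^sup>2) * \<theta> \<xi>)) (fourier_l2 f) = cinner (abs_l2 \<theta>) (fourier_l2 h)"
      if \<theta>: "\<theta> \<in> schwartz" for \<theta>
      by (rule cinner_real_multiplier[OF \<theta> schwartz_real_sq[OF \<theta>] sqm]) (use ae in \<open>eventually_elim, simp\<close>)
    have "represents h (\<lambda>\<psi>. - deriv_dist (deriv_dist (l2_dist f)) \<psi>)"
      by (rule representsI) (simp only: lap h fourier_schwartz cinner_fourier_l2)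
    moreover have "represents (fourier_l2 f + fourier_l2 h) (weighted_fourier 2 (l2_dist f))"
    proof (rule representsI)
      fix \<psi> assume \<psi>: "\<psi> \<in> schwartz"
      have e: "(\<lambda>\<xi>. cnj (of_real ((1 + \<xi>\<^sup>2) powr (2 / 2))) * \<psi> \<xi>) = (\<lambda>\<xi>. \<psi> \<xi> + of_real (\<xi>\<^sup>2) * \<psi> \<xi>)"
        unfolding powr_half_weight(3) by (simp add: distrib_right)
      note s = schwartz_add[OF \<psi> schwartz_real_sq[OF \<psi>]]
      have "weighted_fourier 2 (l2_dist f) \<psi> = cinner (abs_l2 (\<lambda>\<xi>. \<psi> \<xi> + of_real (\<xi>\<^sup>2) * \<psi> \<xi>)) (fourier_l2 f)"
        unfolding weighted_fourier_def mult_dist_def fourier_dist_def e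
        by (simp only: l2_dist_schwartz inv_fourier_schwartz s cinner_inv_fourier_schwartz)
      also have "abs_l2 (\<lambda>\<xi>. \<psi> \<xi> + of_real (\<xi>\<^sup>2) * \<psi> \<xi>) = abs_l2 \<psi> + abs_l2 (\<lambda>\<xi>. of_real (\<xi>\<^sup>2) * \<psi> \<xi>)"
        by (simp only: abs_l2_add schwartz_square_integrable schwartz_real_sq \<psi>)
      finally show "weighted_fourier 2 (l2_dist f) \<psi> = cinner (abs_l2 \<psi>) (fourier_l2 f + fourier_l2 h)"
        by (simp only: cinner_add_left cinner_add_right h[OF \<psi>])
    qed
    ultimately show "(f, h) \<in> op_H0"
      using tempered_l2_dist by (auto simp: op_H0_def sobolev_def)
  qed
qed

lemma op_H0_resolvent:
  assumes z: "z \<notin> \<real>\<^sub>\<ge>\<^sub>0"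
  shows "(f, u + z *\<^sub>C f) \<in> op_H0 \<longleftrightarrow> f = res_half_op z (res_half_op z u)"
proof -
  define m where "m = res_symbol z"
  have bm: "bounded_symbol m" unfolding m_def by (rule bounded_symbol_res[OF z])
  have m2: "(of_real (\<xi>\<^sup>2) - z) * (m \<xi> * m \<xi>) = 1" for \<xi>
    using symbol_nonzero[OF z, of \<xi>] by (simp add: m_def res_symbol_square del: of_real_power)
  have "f = res_half_op z (res_half_op z u) \<longleftrightarrow> fourier_l2 f = fourier_l2 (res_half_op z (res_half_op z u))"
    by (simp only: fourier_l2_eq_iff)
  also have "fourier_l2 (res_half_op z (res_half_op z u)) = mul_l2 m (mul_l2 m (fourier_l2 u))"
    by (simp add: m_def)
  also have "fourier_l2 f = mul_l2 m (mul_l2 m (fourier_l2 u)) \<longleftrightarrow>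
      (AE \<xi> in lborel. rep_l2 (fourier_l2 f) \<xi> = rep_l2 (mul_l2 m (mul_l2 m (fourier_l2 u))) \<xi>)"
    by (auto intro: l2_eqI)
  also have "\<dots> \<longleftrightarrow> (f, u + z *\<^sub>C f) \<in> op_H0"
    unfolding op_H0_iff
  proof (rule eventually_subst)
    show "AE \<xi> in lborel. (rep_l2 (fourier_l2 f) \<xi> = rep_l2 (mul_l2 m (mul_l2 m (fourier_l2 u))) \<xi>)
      = (of_real (\<xi>\<^sup>2) * rep_l2 (fourier_l2 f) \<xi> = rep_l2 (fourier_l2 (u + z *\<^sub>C f)) \<xi>)"
      using rep_mul_l2[OF bm, of "fourier_l2 u"] rep_mul_l2[OF bm, of "mul_l2 m (fourier_l2 u)"]
        rep_plus[of "fourier_l2 u" "z *\<^sub>C fourier_l2 f"] rep_scaleC[of z "fourier_l2 f"]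
    proof eventually_elim
      case (elim \<xi>)
      define a where "a = rep_l2 (fourier_l2 f) \<xi>"
      define b where "b = rep_l2 (fourier_l2 u) \<xi>"
      define x where "x = (of_real (\<xi>\<^sup>2) :: complex)"
      have "(a = m \<xi> * (m \<xi> * b)) = (x * a = b + z * a)"
      proof
        assume "a = m \<xi> * (m \<xi> * b)"
        then show "x * a = b + z * a" using m2[of \<xi>] unfolding x_def[symmetric] by algebra
      next
        assume "x * a = b + z * a"
        then show "a = m \<xi> * (m \<xi> * b)" using m2[of \<xi>] unfolding x_def[symmetric] by algebra
      qed
      then show ?case
        using elim by (simp add: fourier_l2_add fourier_l2_scale a_def b_def x_def)
    qed
  qed
  finally show ?thesis by blast
qed

section \<open>Smallness at large negative spectral parameters\<close>

text \<open>The shift by one keeps the points off the half-axis.\<close>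

definition neg_sq :: "nat \<Rightarrow> complex" where
  "neg_sq n = of_real (- ((real (Suc n))\<^sup>2))"

lemma neg_sq_notin: "neg_sq n \<notin> \<real>\<^sub>\<ge>\<^sub>0"
proof -
  have "0 < (real (Suc n))\<^sup>2" by (rule zero_less_power) simp
  then show ?thesis by (simp add: neg_sq_def del: of_real_power of_real_minus of_nat_Suc)
qed

lemma cmod_res_symbol_neg_sq: "cmod (res_symbol (neg_sq n) x) = 1 / sqrt (x\<^sup>2 + (real (Suc n))\<^sup>2)"
proof -
  have "of_real (x\<^sup>2) - neg_sq n = of_real (x\<^sup>2 + (real (Suc n))\<^sup>2)"
    by (simp add: neg_sq_def del: of_nat_Suc)
  moreover have "0 \<le> x\<^sup>2 + (real (Suc n))\<^sup>2" by simp
  ultimately show ?thesis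
    unfolding cmod_res_symbol by (simp only: norm_of_real abs_of_nonneg)
qed

text \<open>At \<open>z = - n\<^sup>2\<close> the kernel is dominated by the one at \<open>z = - 1\<close> and tends to zero
  pointwise.\<close>

lemma birman_kernel_norm_tendsto_zero: "(\<lambda>n. kernel_norm (birman_kernel g (neg_sq n))) \<longlonglongrightarrow> 0"
proof -
  define r where "r n x = cmod (res_symbol (neg_sq n) x)" for n x
  have r_mono: "r n x \<le> r 0 x" for n x
  proof -
    have "(real (Suc 0))\<^sup>2 \<le> (real (Suc n))\<^sup>2" by (rule power_mono) auto
    moreover have "0 < x\<^sup>2 + (real (Suc 0))\<^sup>2" by (rule add_nonneg_pos) auto
    ultimately show ?thesis
      unfolding r_def cmod_res_symbol_neg_sq by (intro frac_le) auto
  qed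
  have r_lim: "(\<lambda>n. r n x) \<longlonglongrightarrow> 0" for x
  proof (rule tendsto_sandwich[OF _ _ tendsto_const])
    show "(\<lambda>n. 1 / real (Suc n)) \<longlonglongrightarrow> 0" by (rule LIMSEQ_Suc[OF lim_1_over_n])
    have "r n x \<le> 1 / real (Suc n)" for n
    proof -
      have "real (Suc n) = sqrt ((real (Suc n))\<^sup>2)" by simp
      also have "\<dots> \<le> sqrt (x\<^sup>2 + (real (Suc n))\<^sup>2)" by (rule real_sqrt_le_mono) simp
      finally show ?thesis unfolding r_def cmod_res_symbol_neg_sq by (intro frac_le) auto
    qed
    then show "\<forall>\<^sub>F n in sequentially. r n x \<le> 1 / real (Suc n)" by simp
  qed (simp add: r_def)
  have K: "l2_kernel (birman_kernel g (neg_sq n))" for n by (rule l2_kernel_birman[OF neg_sq_notin])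
  have eq: "cmod (birman_kernel g (neg_sq n) x y) = fourier_const * cmod (potential g (x - y)) * (r n x * r n y)" for n x y
    by (simp add: birman_kernel_def potential_kernel_def norm_mult r_def abs_of_pos)
  have "(\<lambda>n. \<integral>p. (case p of (x, y) \<Rightarrow> (cmod (birman_kernel g (neg_sq n) x y))\<^sup>2) \<partial>(lborel \<Otimes>\<^sub>M lborel))
      \<longlonglongrightarrow> (\<integral>p. (0::real) \<partial>((lborel :: real measure) \<Otimes>\<^sub>M (lborel :: real measure)))"
  proof (rule integral_dominated_convergence[where w = "\<lambda>(x, y). (cmod (birman_kernel g (neg_sq 0) x y))\<^sup>2"])
    show "integrable (lborel \<Otimes>\<^sub>M lborel) (\<lambda>(x, y). (cmod (birman_kernel g (neg_sq 0) x y))\<^sup>2)"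
      using K[of 0] by (simp add: l2_kernel_def)
    show "(\<lambda>(x, y). (cmod (birman_kernel g (neg_sq n) x y))\<^sup>2) \<in> borel_measurable (lborel \<Otimes>\<^sub>M lborel)" for n
      by (rule borel_measurable_integrable) (use K[of n] in \<open>simp add: l2_kernel_def\<close>)
    have le: "cmod (birman_kernel g (neg_sq n) x y) \<le> cmod (birman_kernel g (neg_sq 0) x y)" for n x y
      unfolding eq by (intro mult_left_mono mult_mono r_mono) (auto simp: r_def less_imp_le)
    show "AE p in lborel \<Otimes>\<^sub>M lborel. norm (case p of (x, y) \<Rightarrow> (cmod (birman_kernel g (neg_sq n) x y))\<^sup>2)
        \<le> (case p of (x, y) \<Rightarrow> (cmod (birman_kernel g (neg_sq 0) x y))\<^sup>2)" for n
      by (intro AE_I2) (auto intro!: power_mono le)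
    have "(\<lambda>n. (cmod (birman_kernel g (neg_sq n) x y))\<^sup>2) \<longlonglongrightarrow> (fourier_const * cmod (potential g (x - y)) * (0 * 0))\<^sup>2" for x y
      unfolding eq by (intro tendsto_intros r_lim)
    then show "AE p in lborel \<Otimes>\<^sub>M lborel. (\<lambda>n. case p of (x, y) \<Rightarrow> (cmod (birman_kernel g (neg_sq n) x y))\<^sup>2) \<longlonglongrightarrow> 0"
      by (intro AE_I2) auto
  qed simp
  then have "(\<lambda>n. sqrt (\<integral>p. (case p of (x, y) \<Rightarrow> (cmod (birman_kernel g (neg_sq n) x y))\<^sup>2) \<partial>(lborel \<Otimes>\<^sub>M lborel)))
      \<longlonglongrightarrow> sqrt (\<integral>p. (0::real) \<partial>((lborel :: real measure) \<Otimes>\<^sub>M (lborel :: real measure)))"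
    by (rule tendsto_real_sqrt)
  then show ?thesis by (simp add: kernel_norm_def)
qed

text \<open>Without such a point every operator would satisfy the defining condition, and
  uniqueness would fail.\<close>

lemma exists_point_off_D_H0:
  assumes V: "potential_density V g"
  obtains z where "z \<notin> \<real>\<^sub>\<ge>\<^sub>0 \<union> D_H0 V"
proof -
  have "\<forall>\<^sub>F n in sequentially. kernel_norm (birman_kernel g (neg_sq n)) < 1"
    by (rule order_tendstoD(2)[OF birman_kernel_norm_tendsto_zero]) simp
  then obtain n where n: "kernel_norm (birman_kernel g (neg_sq n)) < 1"
    by (auto simp: eventually_sequentially)
  note z = neg_sq_notin[of n]
  have "norm (op_A V (neg_sq n) f) \<le> kernel_norm (birman_kernel g (neg_sq n)) * norm f" for f
    using norm_kernel_op_le[OF l2_kernel_birman[OF z], of g "fourier_l2 f"]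
    by (simp add: op_A_eq[OF V z])
  then obtain B where "bounded_clinear B" "\<And>f u. f - op_A V (neg_sq n) f = u \<longleftrightarrow> f = B u"
    using neumann[OF bounded_clinear_op_A[OF V z] n] by metis
  then have "1 \<in> resolvent_set (op_graph (op_A V (neg_sq n)))"
    unfolding one_in_resolvent_set_iff by blast
  then show ?thesis using that[of "neg_sq n"] z by (simp add: D_H0_def)
qed

section \<open>The operator defined by the resolvents\<close>

lemma op_R_schroedinger:
  assumes V: "potential_density V g"
    and z: "z \<notin> \<real>\<^sub>\<ge>\<^sub>0 \<union> D_H0 V"
  shows "\<exists>B. bounded_clinear B \<and> (\<forall>f u. f - op_A V z f = u \<longleftrightarrow> f = B u) \<and>
    op_R V z = (\<lambda>u. res_half_op z (B (res_half_op z u)))"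
    and "(f, u + z *\<^sub>C f) \<in> schroedinger_op g \<longleftrightarrow> f = op_R V z u"
proof -
  have z0: "z \<notin> \<real>\<^sub>\<ge>\<^sub>0" using z by simp
  have "1 \<in> resolvent_set (op_graph (op_A V z))" using z by (auto simp: D_H0_def)
  then obtain B where B: "bounded_clinear B" "\<And>f u. f - op_A V z f = u \<longleftrightarrow> f = B u"
    unfolding one_in_resolvent_set_iff by blast
  have "inv (\<lambda>f. f - op_A V z f) = B"
    by (rule inv_equality) (use B(2) in metis)+
  then have R: "op_R V z = (\<lambda>u. res_half_op z (B (res_half_op z u)))"
    by (simp add: op_R_def res_half_l2_eq[OF z0] o_def)
  show "\<exists>B. bounded_clinear B \<and> (\<forall>f u. f - op_A V z f = u \<longleftrightarrow> f = B u) \<and>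
    op_R V z = (\<lambda>u. res_half_op z (B (res_half_op z u)))"
    using B R by (intro exI[of _ B] conjI allI)
  have "(\<exists>h. f = res_half_op z h \<and> h - op_A V z h = res_half_op z u) \<longleftrightarrow> f = res_half_op z (B (res_half_op z u))"
    by (auto simp: B(2))
  from trans[OF schroedinger_op_iff_birman[OF V z0, of f u] this]
  show "(f, u + z *\<^sub>C f) \<in> schroedinger_op g \<longleftrightarrow> f = op_R V z u"
    unfolding R .
qed

lemma bounded_clinear_op_R:
  assumes V: "potential_density V g"
    and z: "z \<notin> \<real>\<^sub>\<ge>\<^sub>0 \<union> D_H0 V"
  shows "bounded_clinear (op_R V z)"
proof -
  obtain B where B: "bounded_clinear B" "op_R V z = (\<lambda>u. res_half_op z (B (res_half_op z u)))"
    using op_R_schroedinger(1)[OF V z] by blast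
  have M: "bounded_clinear (res_half_op z)" using z by (intro bounded_clinear_res_half_op) simp
  show ?thesis unfolding B(2) by (rule bounded_clinear_compose[OF M bounded_clinear_compose[OF B(1) M]])
qed

text \<open>\<open>I - A\<^sub>V(z)\<close> has a bounded inverse, so \<open>R(z)\<close> has a dense range like the outer factors.\<close>

lemma op_R_dense_range:
  assumes V: "potential_density V g"
    and z: "z \<notin> \<real>\<^sub>\<ge>\<^sub>0 \<union> D_H0 V"
  shows "closure (range (op_R V z)) = UNIV"
proof -
  obtain B where B: "bounded_clinear B" "\<And>f u. f - op_A V z f = u \<longleftrightarrow> f = B u"
    "op_R V z = (\<lambda>u. res_half_op z (B (res_half_op z u)))"
    using op_R_schroedinger(1)[OF V z] by blast
  have z0: "z \<notin> \<real>\<^sub>\<ge>\<^sub>0" using z by simp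
  have "res_half_op z h \<in> closure (range (op_R V z))" for h
  proof -
    define k where "k = h - op_A V z h"
    have h: "h = B k" using B(2) k_def by blast
    have "k \<in> closure (range (res_half_op z))" by (simp add: res_half_op_dense_range[OF z0])
    then obtain a where a: "\<And>n. a n \<in> range (res_half_op z)" "a \<longlonglongrightarrow> k"
      unfolding closure_sequential by blast
    have "(\<lambda>n. res_half_op z (B (a n))) \<longlonglongrightarrow> res_half_op z (B k)"
      by (intro bounded_clinear_tendsto[OF bounded_clinear_res_half_op[OF z0]] bounded_clinear_tendsto[OF B(1)] a(2))
    moreover have "res_half_op z (B (a n)) \<in> range (op_R V z)" for n
      using a(1)[of n] by (auto simp: B(3))
    ultimately have "res_half_op z (B k) \<in> closure (range (op_R V z))"
      unfolding closure_sequential by (intro exI[of _ "\<lambda>n. res_half_op z (B (a n))"] conjI allI)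
    then show ?thesis by (simp only: h[symmetric])
  qed
  then have "closure (range (res_half_op z)) \<subseteq> closure (range (op_R V z))"
    by (intro closure_minimal) auto
  then show ?thesis using res_half_op_dense_range[OF z0] by (simp add: top.extremum_unique)
qed

text \<open>A relation is recovered from the inverse of its shift at a single point.\<close>

lemma defined_by_R_unique:
  assumes V: "potential_density V g"
  shows "defined_by_R V H \<longleftrightarrow> H = schroedinger_op g"
proof
  assume H: "defined_by_R V H"
  obtain z where z: "z \<notin> \<real>\<^sub>\<ge>\<^sub>0 \<union> D_H0 V" using exists_point_off_D_H0[OF V] by metis
  have 1: "(f, u + z *\<^sub>C f) \<in> H \<longleftrightarrow> f = op_R V z u" for f u
    using H z unfolding defined_by_R_def inverse_shift_eq_graph_iff by blast
  have 2: "(f, u + z *\<^sub>C f) \<in> schroedinger_op g \<longleftrightarrow> f = op_R V z u" for f u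
    by (rule op_R_schroedinger(2)[OF V z])
  have "(f, h) \<in> H \<longleftrightarrow> (f, h) \<in> schroedinger_op g" for f h
    using 1[of f "h - z *\<^sub>C f"] 2[of f "h - z *\<^sub>C f"] by simp
  then show "H = schroedinger_op g" by auto
next
  assume H: "H = schroedinger_op g"
  show "defined_by_R V H"
    unfolding defined_by_R_def inverse_shift_eq_graph_iff H
    using op_R_schroedinger(2)[OF V] by blast
qed

text \<open>The domain is the range of the resolvent at one point, which is dense, and the graph is the preimage of
  the graph of that bounded operator under a continuous linear map.\<close>

lemma schroedinger_op_regular:
  assumes V: "potential_density V g"
  shows "densely_defined (schroedinger_op g)" "closed (schroedinger_op g)" "linear_op (schroedinger_op g)"
proof -
  obtain z where z: "z \<notin> \<real>\<^sub>\<ge>\<^sub>0 \<union> D_H0 V" using exists_point_off_D_H0[OF V] by metis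
  define R where "R = op_R V z"
  have R: "bounded_clinear R" unfolding R_def by (rule bounded_clinear_op_R[OF V z])
  have H: "(f, h) \<in> schroedinger_op g \<longleftrightarrow> f = R (h - z *\<^sub>C f)" for f h
    using op_R_schroedinger(2)[OF V z, of f "h - z *\<^sub>C f"] by (simp add: R_def)
  have "range R \<subseteq> Domain (schroedinger_op g)"
  proof
    fix f assume "f \<in> range R"
    then obtain u where "f = R u" by auto
    then have "(f, u + z *\<^sub>C f) \<in> schroedinger_op g" by (simp add: H)
    then show "f \<in> Domain (schroedinger_op g)" by blast
  qed
  then have "closure (range R) \<subseteq> closure (Domain (schroedinger_op g))" by (rule closure_mono)
  then show "densely_defined (schroedinger_op g)"
    using op_R_dense_range[OF V z] unfolding densely_defined_def R_def by blast
  show "closed (schroedinger_op g)"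
    unfolding closed_sequential_limits
  proof (intro allI impI, elim conjE)
    fix x and l :: "l2 \<times> l2" assume x: "\<forall>n. x n \<in> schroedinger_op g" and l: "x \<longlonglongrightarrow> l"
    have "fst (x n) = R (snd (x n) - z *\<^sub>C fst (x n))" for n
      using x H[of "fst (x n)" "snd (x n)"] by simp
    moreover have "(\<lambda>n. R (snd (x n) - z *\<^sub>C fst (x n))) \<longlonglongrightarrow> R (snd l - z *\<^sub>C fst l)"
      by (intro bounded_clinear_tendsto[OF R] tendsto_diff tendsto_scaleC tendsto_fst tendsto_snd l)
    ultimately have "(\<lambda>n. fst (x n)) \<longlonglongrightarrow> R (snd l - z *\<^sub>C fst l)" by simp
    then have "fst l = R (snd l - z *\<^sub>C fst l)" using tendsto_fst[OF l] LIMSEQ_unique by blast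
    then show "l \<in> schroedinger_op g" using H[of "fst l" "snd l"] by simp
  qed
  show "linear_op (schroedinger_op g)"
    unfolding linear_op_def
  proof (intro conjI allI impI)
    show "single_valued (schroedinger_op g)"
    proof (rule single_valuedI)
      fix f h h' assume "(f, h) \<in> schroedinger_op g" "(f, h') \<in> schroedinger_op g"
      then have "AE \<xi> in lborel. rep_l2 (fourier_l2 h) \<xi> = rep_l2 (fourier_l2 h') \<xi>"
        unfolding schroedinger_op_def by (auto elim: eventually_elim2)
      then show "h = h'" using l2_eqI fourier_l2_eq_iff by blast
    qed
    show "(0, 0) \<in> schroedinger_op g" by (simp add: H bounded_clinear_zero[OF R])
    fix f h assume fh: "(f, h) \<in> schroedinger_op g"
    show "(c *\<^sub>C f, c *\<^sub>C h) \<in> schroedinger_op g" for c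
    proof -
      have "c *\<^sub>C h - z *\<^sub>C c *\<^sub>C f = c *\<^sub>C (h - z *\<^sub>C f)"
        by (simp add: l2.scale_right_diff_distrib mult.commute)
      then show ?thesis using fh unfolding H by (metis bounded_clinear_scale[OF R])
    qed
    show "(f + f', h + h') \<in> schroedinger_op g" if "(f', h') \<in> schroedinger_op g" for f' h'
    proof -
      have "h + h' - z *\<^sub>C (f + f') = (h - z *\<^sub>C f) + (h' - z *\<^sub>C f')"
        by (simp add: l2.scale_right_distrib)
      then show ?thesis using fh that unfolding H by (metis bounded_clinear_add[OF R])
    qed
  qed
qed

text \<open>The two-point resolvent identity
  \<open>R(z) - R\<^sub>0(z) = (1 + (z - w) R(z)) (R(w) - R\<^sub>0(w)) (1 + (z - w) R\<^sub>0(z))\<close>.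
  It carries the
  Hilbert-Schmidt property from one point \<open>w\<close> to all common points of the resolvent sets.\<close>

lemma resolvent_difference:
  assumes B: "bounded_clinear B" "\<And>f u. (f, u + z *\<^sub>C f) \<in> H \<longleftrightarrow> f = B u"
    and B0: "\<And>f u. (f, u + z *\<^sub>C f) \<in> H0 \<longleftrightarrow> f = B0 u"
    and R: "\<And>f u. (f, u + w *\<^sub>C f) \<in> H \<longleftrightarrow> f = R u"
    and R0: "\<And>f u. (f, u + w *\<^sub>C f) \<in> H0 \<longleftrightarrow> f = R0 u"
  shows "B u - B0 u = (\<lambda>d. d + (z - w) *\<^sub>C B d) (R (u + (z - w) *\<^sub>C B0 u) - R0 (u + (z - w) *\<^sub>C B0 u))"
proof -
  define p where "p = u + (z - w) *\<^sub>C B0 u"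
  have "(B0 u, p + w *\<^sub>C B0 u) \<in> H0"
    using B0[of "B0 u" u] by (simp add: p_def l2.scale_left_diff_distrib)
  then have R0p: "R0 p = B0 u" using R0 by simp
  define d where "d = R p - R0 p"
  have "(R p, p + w *\<^sub>C R p) \<in> H" using R by simp
  moreover have "p + w *\<^sub>C R p = (u - (z - w) *\<^sub>C d) + z *\<^sub>C R p"
  proof -
    have "(u + (z - w) *\<^sub>C b) + w *\<^sub>C q = (u - (z - w) *\<^sub>C (q - b)) + z *\<^sub>C q" for b q
      by (simp add: l2.scale_left_diff_distrib l2.scale_right_diff_distrib)
    from this[of "B0 u" "R p"] show ?thesis
      unfolding p_def[symmetric] d_def R0p .
  qed
  ultimately have "R p = B (u - (z - w) *\<^sub>C d)" using B(2) by metis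
  then have "R p = B u - (z - w) *\<^sub>C B d"
    by (simp add: bounded_clinear_diff[OF B(1)] bounded_clinear_scale[OF B(1)])
  then have "B u = R p + (z - w) *\<^sub>C B d" by simp
  also have "R p = d + B0 u" by (simp add: d_def R0p)
  finally have "B u - B0 u = d + (z - w) *\<^sub>C B d" by simp
  then show ?thesis unfolding p_def[symmetric] d_def[symmetric] .
qed

text \<open>At \<open>w\<close> the difference equals \<open>M (I - A\<^sub>V(w))\<^sup>-\<^sup>1 A\<^sub>V(w) M\<close> with \<open>M = (H\<^sub>0 - w)\<^sup>-\<^sup>1\<^sup>/\<^sup>2\<close>, and
  \<open>A\<^sub>V(w)\<close> has a square integrable kernel.\<close>

lemma resolvent_difference_hilbert_schmidt:
  assumes V: "potential_density V g"
    and z: "z \<in> resolvent_set op_H0" "z \<in> resolvent_set (schroedinger_op g)"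
  shows "hilbert_schmidt (\<lambda>f. resolvent (schroedinger_op g) z f - resolvent op_H0 z f)"
proof -
  obtain B0 where B0: "bounded_clinear B0" "(op_shift op_H0 z)\<inverse> = op_graph B0"
    using z(1) by (auto simp: resolvent_set_def)
  obtain B where B: "bounded_clinear B" "(op_shift (schroedinger_op g) z)\<inverse> = op_graph B"
    using z(2) by (auto simp: resolvent_set_def)
  obtain w where w: "w \<notin> \<real>\<^sub>\<ge>\<^sub>0 \<union> D_H0 V" using exists_point_off_D_H0[OF V] by metis
  then have w0: "w \<notin> \<real>\<^sub>\<ge>\<^sub>0" by simp
  obtain N where N: "bounded_clinear N" "\<And>f u. f - op_A V w f = u \<longleftrightarrow> f = N u"
    "op_R V w = (\<lambda>u. res_half_op w (N (res_half_op w u)))"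
    using op_R_schroedinger(1)[OF V w] by blast
  define M where "M = res_half_op w"
  have M: "bounded_clinear M" unfolding M_def by (rule bounded_clinear_res_half_op[OF w0])
  define S where "S d = d + (z - w) *\<^sub>C B d" for d
  define S0 where "S0 u = u + (z - w) *\<^sub>C B0 u" for u
  have S: "bounded_clinear S" and S0: "bounded_clinear S0"
    unfolding S_def[abs_def] S0_def[abs_def]
    by (intro bounded_clinear_plus bounded_clinear_id bounded_clinear_scaled B B0)+
  have rR: "resolvent (schroedinger_op g) z = B" "resolvent op_H0 z = B0"
    by (rule resolvent_eq[OF B(2)], rule resolvent_eq[OF B0(2)])
  define C where "C d = - S (M (N (inv_fourier_l2 d)))" for d
  define D where "D u = fourier_l2 (M (S0 u))" for u
  have C: "bounded_clinear C"
    unfolding C_def[abs_def]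
    by (rule bounded_clinear_neg[OF bounded_clinear_compose[OF S bounded_clinear_compose[OF M
          bounded_clinear_compose[OF N(1) bounded_clinear_inv_fourier_l2]]]])
  have D: "bounded_clinear D"
    unfolding D_def[abs_def]
    by (rule bounded_clinear_compose[OF bounded_clinear_fourier_l2 bounded_clinear_compose[OF M S0]])
  have "B u - B0 u = C (kernel_op (birman_kernel g w) (D u))" for u
  proof -
    have Bx: "(f, u + z *\<^sub>C f) \<in> schroedinger_op g \<longleftrightarrow> f = B u"
      and B0x: "(f, u + z *\<^sub>C f) \<in> op_H0 \<longleftrightarrow> f = B0 u" for f u
      using B(2) B0(2) unfolding inverse_shift_eq_graph_iff by blast+
    have "B u - B0 u = S (op_R V w (S0 u) - M (M (S0 u)))"
      unfolding S_def S0_def M_def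
      by (rule resolvent_difference[OF B(1) Bx B0x op_R_schroedinger(2)[OF V w] op_H0_resolvent[OF w0]])
    also have "op_R V w (S0 u) - M (M (S0 u)) = M (N (op_A V w (M (S0 u))))"
    proof -
      define k where "k = M (S0 u)"
      have "k = N (k - op_A V w k)" using N(2) by blast
      then have "N (op_A V w k) = N k - k"
        using bounded_clinear_diff[OF N(1), of k "op_A V w k"] by (metis diff_diff_eq2 add_diff_cancel_left')
      then show ?thesis
        by (simp add: N(3) M_def[symmetric] k_def[symmetric] bounded_clinear_diff[OF M])
    qed
    also have "op_A V w (M (S0 u)) = - inv_fourier_l2 (kernel_op (birman_kernel g w) (D u))"
      by (simp add: op_A_eq[OF V w0] D_def)
    also have "S (M (N (- inv_fourier_l2 (kernel_op (birman_kernel g w) (D u)))))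
        = C (kernel_op (birman_kernel g w) (D u))"
    proof -
      have neg: "X (- h) = - X h" if "bounded_clinear X" for X h
        using bounded_clinear_scale[OF that, of "-1" h] by simp
      show ?thesis by (simp add: C_def neg[OF N(1)] neg[OF M] neg[OF S])
    qed
    finally show ?thesis .
  qed
  then show ?thesis
    unfolding rR using hilbert_schmidt_kernel_op[OF l2_kernel_birman[OF w0] C D] by simp
qed

text \<open>For \<open>u = 0\<close> the equivalence behind the resolvent formula says that \<open>(H\<^sub>0 - z)\<^sup>-\<^sup>1\<^sup>/\<^sup>2\<close> maps the fixed
  vectors of \<open>A\<^sub>V(z)\<close> onto the eigenvectors of \<open>H\<close>.\<close>

lemma eigenvalue_correspondence:
  assumes V: "potential_density V g"
    and z: "z \<notin> \<real>\<^sub>\<ge>\<^sub>0"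
  shows "eigenvalue_of_mult (schroedinger_op g) z k \<longleftrightarrow> eigenvalue_of_mult (op_graph (op_A V z)) 1 k"
proof -
  note M = bounded_clinear_res_half_op[OF z] and A = bounded_clinear_op_A[OF V z]
  define E where "E = eigenspace (op_graph (op_A V z)) 1"
  have E: "h \<in> E \<longleftrightarrow> op_A V z h = h" for h
    by (auto simp: E_def eigenspace_def op_graph_def)
  have sub: "l2.subspace E"
    by (auto simp: l2.subspace_def E bounded_clinear_zero[OF A] bounded_clinear_add[OF A] bounded_clinear_scale[OF A])
  have img: "eigenspace (schroedinger_op g) z = res_half_op z ` E"
  proof -
    have "f \<in> eigenspace (schroedinger_op g) z \<longleftrightarrow> f \<in> res_half_op z ` E" for f
      using schroedinger_op_iff_birman[OF V z, of f 0]
      by (auto simp: eigenspace_def E image_iff bounded_clinear_zero[OF M] eq_commute[of _ "op_A V z _"])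
    then show ?thesis by auto
  qed
  have lin: "Vector_Spaces.linear scaleC scaleC (res_half_op z)" using M by (simp add: bounded_clinear_def)
  have inj: "inj (res_half_op z)" by (rule res_half_op_inj[OF z])
  have "(\<exists>f. f \<noteq> 0 \<and> f \<in> res_half_op z ` E) \<longleftrightarrow> (\<exists>f. f \<noteq> 0 \<and> f \<in> E)"
    using bounded_clinear_zero[OF M] inj by (metis (no_types, lifting) image_iff injD)
  then show ?thesis
    unfolding eigenvalue_of_mult_def img E_def[symmetric] dim_image_injective[OF lin inj sub] by simp
qed

theorem theorem3p3:
  fixes V :: distribution
  assumes "V \<in> sobolev (-1)"
  shows "(\<exists>!H. densely_defined H \<and> closed H \<and> linear_op H \<and> defined_by_R V H) \<and>
    (\<forall>H. densely_defined H \<and> closed H \<and> linear_op H \<and> defined_by_R V H \<longrightarrow>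
       - (\<real>\<^sub>\<ge>\<^sub>0 \<union> D_H0 V) \<subseteq> resolvent_set H \<and>
       (\<forall>z \<in> resolvent_set op_H0 \<inter> resolvent_set H.
          hilbert_schmidt (\<lambda>f. resolvent H z f - resolvent op_H0 z f)) \<and>
       (\<forall>lam k. lam \<notin> \<real>\<^sub>\<ge>\<^sub>0 \<longrightarrow> k \<ge> 1 \<longrightarrow>
          (eigenvalue_of_mult H lam k \<longleftrightarrow> eigenvalue_of_mult (op_graph (op_A V lam)) 1 k)))"
proof -
  obtain g where V: "potential_density V g"
    using sobolev_minus_one_density[OF assms] by metis
  have def: "defined_by_R V H \<longleftrightarrow> H = schroedinger_op g" for H
    by (rule defined_by_R_unique[OF V])
  have "z \<in> resolvent_set (schroedinger_op g)" if "z \<notin> \<real>\<^sub>\<ge>\<^sub>0 \<union> D_H0 V" for z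
  proof -
    have "(op_shift (schroedinger_op g) z)\<inverse> = op_graph (op_R V z)"
      using def that unfolding defined_by_R_def by blast
    then show ?thesis
      using bounded_clinear_op_R[OF V that] unfolding resolvent_set_def by blast
  qed
  then have "- (\<real>\<^sub>\<ge>\<^sub>0 \<union> D_H0 V) \<subseteq> resolvent_set (schroedinger_op g)" by blast
  moreover have "\<forall>z \<in> resolvent_set op_H0 \<inter> resolvent_set (schroedinger_op g).
      hilbert_schmidt (\<lambda>f. resolvent (schroedinger_op g) z f - resolvent op_H0 z f)"
    using resolvent_difference_hilbert_schmidt[OF V] by blast
  moreover have "\<forall>lam k. lam \<notin> \<real>\<^sub>\<ge>\<^sub>0 \<longrightarrow> k \<ge> 1 \<longrightarrow>
      (eigenvalue_of_mult (schroedinger_op g) lam k \<longleftrightarrow> eigenvalue_of_mult (op_graph (op_A V lam)) 1 k)"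
    using eigenvalue_correspondence[OF V] by blast
  ultimately show ?thesis
    unfolding def using schroedinger_op_regular[OF V] by blast
qed

end
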